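(* The decision problem Bounded-Two-Stage$(\mathcal{X}_c,\mathcal{U}_d,\mathcal{Y}_d)$ is in $\Sigma_3^p$.
   Context: An instance consists of rational data encoded in binary: a bound $R\in\mathbb{Z}_+$, vectors $a\in\mathbb{Q}^{m_x}$, $b\in\mathbb{Q}^{m_u}$, matrices $A\in\mathbb{Q}^{m_x\times n_x}$, $B\in\mathbb{Q}^{m_u\times n_u}$, $W\in\mathbb{Q}^{m_y\times n_y}$, and an $m_y\times n_x$ matrix $T(u)$ whose entries depend linearly on $u$ with rational coefficients. Let $\mathcal{X}_c=\{x\in[0,R]^{n_x}: Ax\le a\}$, $\mathcal{U}_d=\{u\in[0,R]^{n_u}\cap\mathbb{Z}^{n_u}: Bu\le b\}$, $\mathcal{Y}_d(x,u)=\{y\in[0,R]^{n_y}\cap\mathbb{Z}^{n_y}: T(u)x+Wy\le 0\}$. Bounded-Two-Stage$(\mathcal{X}_c,\mathcal{U}_d,\mathcal{Y}_d)$ is the decision problem $$\exists x\in\mathcal{X}_c\ \ \forall u\in\mathcal{U}_d\ \ \exists y\in\mathcal{Y}_d(x,u)\,?$$ $\Sigma_3^p$ is the class of problems expressible as $\exists X\,\forall Y\,\exists Z: P(I,X,Y,Z)$, where $I$ is the instance, $X,Y,Z$ range over objects of encoding length polynomial in that of $I$, and $P$ is decidable in polynomial time. *)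

theory Defs
  imports
    "Jordan_Normal_Form.Matrix"
    "HOL-Computational_Algebra.Polynomial"
begin

section \<open>Deterministic multitape Turing machines\<close>

text \<open>Tapes are infinite in both directions. States are natural numbers, and each machine comes
  with finite sets of states and of tape symbols under which its transition function is closed.\<close>

datatype sym = Blank | Bit bool | Aux nat

datatype dir = MoveL | Stay | MoveR

type_synonym tape = "(int \<Rightarrow> sym) \<times> int"

record tm =
  num_tapes :: nat
  states :: "nat set"
  symbols :: "sym set"
  start :: nat
  accept :: nat
  reject :: nat
  delta :: "nat \<Rightarrow> sym list \<Rightarrow> nat \<times> (sym \<times> dir) list"

definition wf_tm :: "tm \<Rightarrow> bool" where
  "wf_tm M \<longleftrightarrow>
     num_tapes M \<ge> 1 \<and> finite (states M) \<and> finite (symbols M) \<and>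
     {Blank, Bit False, Bit True} \<subseteq> symbols M \<and>
     {start M, accept M, reject M} \<subseteq> states M \<and> accept M \<noteq> reject M \<and>
     (\<forall>q\<in>states M. \<forall>ss. length ss = num_tapes M \<and> set ss \<subseteq> symbols M \<longrightarrow>
        (case delta M q ss of (q', acts) \<Rightarrow>
           q' \<in> states M \<and> length acts = num_tapes M \<and> fst ` set acts \<subseteq> symbols M))"

fun shift :: "dir \<Rightarrow> int" where
  "shift MoveL = -1"
| "shift Stay = 0"
| "shift MoveR = 1"

fun read_tape :: "tape \<Rightarrow> sym" where
  "read_tape (t, h) = t h"

fun act_tape :: "sym \<times> dir \<Rightarrow> tape \<Rightarrow> tape" where
  "act_tape (s, d) (t, h) = (t(h := s), h + shift d)"

text \<open>Halting configurations (state accept or reject) are fixed points of a step.\<close>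

fun step :: "tm \<Rightarrow> nat \<times> tape list \<Rightarrow> nat \<times> tape list" where
  "step M (q, ts) =
     (if q = accept M \<or> q = reject M then (q, ts)
      else case delta M q (map read_tape ts) of (q', acts) \<Rightarrow> (q', map2 act_tape acts ts))"

definition blank_tape :: tape where
  "blank_tape = ((\<lambda>_. Blank), 0)"

definition input_tape :: "bool list \<Rightarrow> tape" where
  "input_tape w = ((\<lambda>i. if 0 \<le> i \<and> i < int (length w) then Bit (w ! nat i) else Blank), 0)"

definition init_config :: "tm \<Rightarrow> bool list \<Rightarrow> nat \<times> tape list" where
  "init_config M w = (start M, input_tape w # replicate (num_tapes M - 1) blank_tape)"

definition decides_in_time :: "tm \<Rightarrow> bool list set \<Rightarrow> (nat \<Rightarrow> nat) \<Rightarrow> bool" where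
  "decides_in_time M L t \<longleftrightarrow>
     (\<forall>w. fst ((step M ^^ t (length w)) (init_config M w)) =
          (if w \<in> L then accept M else reject M))"

section \<open>The classes P and \<open>\<Sigma>\<^sub>3\<^sup>p\<close>\<close>

definition PTIME :: "bool list set set" where
  "PTIME = {L. \<exists>M (p :: nat poly). wf_tm M \<and> decides_in_time M L (poly p)}"

text \<open>Self-delimiting code of a word: every bit is preceded by the marker True, and the code ends
  with False. Concatenations of such codes can therefore be split uniquely.\<close>

definition delim :: "bool list \<Rightarrow> bool list" where
  "delim w = concat (map (\<lambda>b. [True, b]) w) @ [False]"

definition tuple_code :: "bool list list \<Rightarrow> bool list" where
  "tuple_code ws = concat (map delim ws)"

definition words_upto :: "nat \<Rightarrow> bool list set" where
  "words_upto n = {w. length w \<le> n}"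

definition Sigma3P :: "bool list set set" where
  "Sigma3P = {L. \<exists>P\<in>PTIME. \<exists>p :: nat poly. \<forall>w. w \<in> L \<longleftrightarrow>
     (\<exists>X \<in> words_upto (poly p (length w)).
      \<forall>Y \<in> words_upto (poly p (length w)).
      \<exists>Z \<in> words_upto (poly p (length w)). tuple_code [w, X, Y, Z] \<in> P)}"

section \<open>Instances of the two-stage problem\<close>

text \<open>The matrix \<open>T(u)\<close> is the sum of the \<open>u\<^sub>k T\<^sub>k\<close>, where the list of rational matrices \<open>T\<^sub>k\<close>
  has one entry for each coordinate of \<open>u\<close>. All dimensions may vary with the instance.\<close>

record two_stage =
  bnd_R :: nat
  vec_a :: "rat vec"
  vec_b :: "rat vec"
  mat_A :: "rat mat"
  mat_B :: "rat mat"
  mat_W :: "rat mat"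
  mats_T :: "rat mat list"

abbreviation m_x :: "two_stage \<Rightarrow> nat" where "m_x I \<equiv> dim_row (mat_A I)"
abbreviation n_x :: "two_stage \<Rightarrow> nat" where "n_x I \<equiv> dim_col (mat_A I)"
abbreviation m_u :: "two_stage \<Rightarrow> nat" where "m_u I \<equiv> dim_row (mat_B I)"
abbreviation n_u :: "two_stage \<Rightarrow> nat" where "n_u I \<equiv> dim_col (mat_B I)"
abbreviation m_y :: "two_stage \<Rightarrow> nat" where "m_y I \<equiv> dim_row (mat_W I)"
abbreviation n_y :: "two_stage \<Rightarrow> nat" where "n_y I \<equiv> dim_col (mat_W I)"

definition wf_instance :: "two_stage \<Rightarrow> bool" where
  "wf_instance I \<longleftrightarrow>
     vec_a I \<in> carrier_vec (m_x I) \<and> vec_b I \<in> carrier_vec (m_u I) \<and>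
     length (mats_T I) = n_u I \<and> set (mats_T I) \<subseteq> carrier_mat (m_y I) (n_x I)"

abbreviation real_vec :: "rat vec \<Rightarrow> real vec" where "real_vec \<equiv> map_vec real_of_rat"
abbreviation real_mat :: "rat mat \<Rightarrow> real mat" where "real_mat \<equiv> map_mat real_of_rat"

definition box :: "nat \<Rightarrow> nat \<Rightarrow> real vec set" where
  "box R n = {v \<in> carrier_vec n. \<forall>i<n. 0 \<le> v $ i \<and> v $ i \<le> real R}"

definition int_vecs :: "nat \<Rightarrow> real vec set" where
  "int_vecs n = {v \<in> carrier_vec n. \<forall>i<n. v $ i \<in> \<int>}"

definition T_of :: "two_stage \<Rightarrow> real vec \<Rightarrow> real mat" where
  "T_of I u = mat (m_y I) (n_x I)
     (\<lambda>(i, j). \<Sum>k<n_u I. u $ k * real_of_rat (mats_T I ! k $$ (i, j)))"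

definition X_c :: "two_stage \<Rightarrow> real vec set" where
  "X_c I = {x \<in> box (bnd_R I) (n_x I). real_mat (mat_A I) *\<^sub>v x \<le> real_vec (vec_a I)}"

definition U_d :: "two_stage \<Rightarrow> real vec set" where
  "U_d I = {u \<in> box (bnd_R I) (n_u I) \<inter> int_vecs (n_u I).
              real_mat (mat_B I) *\<^sub>v u \<le> real_vec (vec_b I)}"

definition Y_d :: "two_stage \<Rightarrow> real vec \<Rightarrow> real vec \<Rightarrow> real vec set" where
  "Y_d I x u = {y \<in> box (bnd_R I) (n_y I) \<inter> int_vecs (n_y I).
                  T_of I u *\<^sub>v x + real_mat (mat_W I) *\<^sub>v y \<le> 0\<^sub>v (m_y I)}"

definition yes_instance :: "two_stage \<Rightarrow> bool" where
  "yes_instance I \<longleftrightarrow> (\<exists>x \<in> X_c I. \<forall>u \<in> U_d I. \<exists>y. y \<in> Y_d I x u)"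

section \<open>Binary encoding of instances\<close>

text \<open>Binary digits, least significant digit first, without leading zeros.\<close>

fun binary :: "nat \<Rightarrow> bool list" where
  "binary n = (if n = 0 then [] else odd n # binary (n div 2))"

declare binary.simps [simp del]

definition enc_nat :: "nat \<Rightarrow> bool list" where
  "enc_nat n = delim (binary n)"

definition enc_int :: "int \<Rightarrow> bool list" where
  "enc_int z = delim ((z < 0) # binary (nat \<bar>z\<bar>))"

text \<open>Dimensions are written in unary, so that the code of an instance is at least as long as the
  vectors \<open>x\<close>, \<open>u\<close>, \<open>y\<close> have coordinates, also when some matrices have no rows. Whenever all
  dimensions are positive this changes the length of a code by at most a polynomial, because the
  code lists all entries.\<close>

definition enc_dim :: "nat \<Rightarrow> bool list" where
  "enc_dim n = replicate n True @ [False]"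

definition mat_entries :: "rat mat \<Rightarrow> rat list" where
  "mat_entries M = concat (mat_to_list M)"

definition rat_entries :: "two_stage \<Rightarrow> rat list" where
  "rat_entries I = list_of_vec (vec_a I) @ list_of_vec (vec_b I) @
     mat_entries (mat_A I) @ mat_entries (mat_B I) @ mat_entries (mat_W I) @
     concat (map mat_entries (mats_T I))"

text \<open>A rational number is written as a pair of binary integers, numerator and positive
  denominator; the fraction need not be in lowest terms, so an instance has several codes, but a
  word is the code of at most one well-formed instance.\<close>

definition encodes :: "bool list \<Rightarrow> two_stage \<Rightarrow> bool" where
  "encodes w I \<longleftrightarrow> (\<exists>fs :: (int \<times> int) list.
     list_all2 (\<lambda>(p, q) r. q > 0 \<and> r = Fract p q) fs (rat_entries I) \<and>
     w = concat (map enc_dim [m_x I, n_x I, m_u I, n_u I, m_y I, n_y I]) @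
         enc_nat (bnd_R I) @ concat (map (\<lambda>(p, q). enc_int p @ enc_int q) fs))"

definition Bounded_Two_Stage :: "bool list set" where
  "Bounded_Two_Stage = {w. \<exists>I. wf_instance I \<and> encodes w I \<and> yes_instance I}"

end

theory Submission
  imports Defs "HOL-Library.Countable" "Jordan_Normal_Form.Determinant"
begin

text \<open>
  If an instance is solvable, it has a solution \<open>x\<close> whose code has polynomial length: fixing a
  \<open>y\<close> for every \<open>u\<close> turns the conditions on \<open>x\<close> into a bounded system of possibly exponentially many
  linear inequalities, each with coefficients of polynomial length. Such a system has a solution at
  which \<open>n\<^sub>x\<close> linearly independent inequalities are tight, and by Cramer's rule its coordinates have
  a common denominator of polynomial length, namely a determinant. So \<open>x\<close>, \<open>u\<close> and \<open>y\<close> can be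
  quantified over words of polynomial length.

  The first certificate also contains the decoded instance and its entries over a common denominator.
  The verifier then only has to encode the instance again, compare the result with the input, and
  compare sums of products of natural numbers, with negative terms moved to the other side.

  That the verifier runs in polynomial time is shown by a closure argument. All data are coded as binary
  trees, and a stack program keeps the codes of its arguments on top of one stack. Since the preorder
  serialisation of a tree is a prefix code, programs do not disturb what is below their argument, so
  they compose; recursion on lists is allowed if the size of the accumulator stays polynomial. Stack
  programs are translated to Turing machines whose states are the remaining commands.
\<close>

text \<open>The answers \<open>y = f u\<close> are frozen before \<open>x\<close> is moved: for a
  fixed \<open>f\<close> the admissible \<open>x\<close> form a polytope that contains the old
  point, and each of its points answers every \<open>u\<close> by the same \<open>f\<close>. There
  may be exponentially many \<open>u\<close>, but a basic solution involves only \<open>n_x\<close>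
  of the inequalities, so their number never enters the bound.

  Two obstacles shape the verifier. An instance has many codes and parsing one is laborious; the
  certificate therefore supplies numerators and denominators exactly as the input writes them, and
  only an encoder has to be programmed. Moreover, the quantified words have no prescribed format.
  Decoding is total: reads out of range give a default and leading zeros are allowed, so every word
  denotes something and malformed words need no special treatment.

  In the complexity argument the danger is iteration: a step that doubles its accumulator is cheap
  once, but exponential in a loop. Hence every fold carries an explicit size bound.\<close>

text \<open>A Turing machine needs two steps for a push: \<open>Write\<close> is what remains after the first one. It does
  not occur in programs, so \<open>exec\<close> has no rule for it.\<close>

datatype com =
    Skip
  | Push nat bool
  | Write nat bool
  | Pop nat
  | Seq com com
  | If_Top nat "bool option" com com
  | While_Not nat "bool option" com

instance com :: countable
  by countable_datatype

section \<open>Stack programs and their running time\<close>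

definition stack_top :: "bool list \<Rightarrow> bool option" where
  "stack_top l = (case l of [] \<Rightarrow> None | b # _ \<Rightarrow> Some b)"

lemma stack_top_simps [simp]: "stack_top [] = None" "stack_top (b # l) = Some b"
  by (simp_all add: stack_top_def)

text \<open>The cost is the exact number of steps of the compiled machine, not merely a bound.
  \<open>Seq\<close> and each test cost one step of their own, in which the machine rewrites its
  list of remaining commands.\<close>

inductive exec :: "com \<Rightarrow> (nat \<Rightarrow> bool list) \<Rightarrow> nat \<Rightarrow> (nat \<Rightarrow> bool list) \<Rightarrow> bool" where
  exec_Skip: "exec Skip s 1 s"
| exec_Push: "exec (Push i b) s 2 (s(i := b # s i))"
| exec_Pop: "exec (Pop i) s 1 (s(i := tl (s i)))"
| exec_Seq: "exec a s t s' \<Longrightarrow> exec b s' t' s'' \<Longrightarrow> exec (Seq a b) s (1 + t + t') s''"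
| exec_If_True: "stack_top (s i) = x \<Longrightarrow> exec a s t s' \<Longrightarrow> exec (If_Top i x a b) s (1 + t) s'"
| exec_If_False: "stack_top (s i) \<noteq> x \<Longrightarrow> exec b s t s' \<Longrightarrow> exec (If_Top i x a b) s (1 + t) s'"
| exec_While_End: "stack_top (s i) = x \<Longrightarrow> exec (While_Not i x a) s 1 s"
| exec_While_Step: "stack_top (s i) \<noteq> x \<Longrightarrow> exec a s t s' \<Longrightarrow> exec (While_Not i x a) s' t' s'' \<Longrightarrow>
    exec (While_Not i x a) s (1 + t + t') s''"

text \<open>One step pushes at most one symbol. Through this, a time bound yields a bound on the
  size of the output.\<close>

lemma exec_length_le: "exec c s t s' \<Longrightarrow> length (s' i) \<le> length (s i) + t"
  by (induction rule: exec.induct) auto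

section \<open>Compilation to Turing machines\<close>

fun num_stacks :: "com \<Rightarrow> nat" where
  "num_stacks Skip = 1"
| "num_stacks (Push i b) = Suc i"
| "num_stacks (Write i b) = Suc i"
| "num_stacks (Pop i) = Suc i"
| "num_stacks (Seq a b) = max (num_stacks a) (num_stacks b)"
| "num_stacks (If_Top i x a b) = max (Suc i) (max (num_stacks a) (num_stacks b))"
| "num_stacks (While_Not i x a) = max (Suc i) (num_stacks a)"

definition sym_of :: "bool option \<Rightarrow> sym" where
  "sym_of x = (case x of None \<Rightarrow> Blank | Some b \<Rightarrow> Bit b)"

definition idle :: "sym list \<Rightarrow> (sym \<times> dir) list" where
  "idle ss = map (\<lambda>s. (s, Stay)) ss"

text \<open>An action writes first and moves afterwards. A push must reach the cell left of the top
  before it can write there, so it moves in one step and leaves \<open>Write\<close> for the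
  next.\<close>

fun next_com :: "com list \<Rightarrow> sym list \<Rightarrow> com list \<times> (sym \<times> dir) list" where
  "next_com [] ss = ([], idle ss)"
| "next_com (Skip # l) ss = (l, idle ss)"
| "next_com (Push i b # l) ss = (Write i b # l, (idle ss)[i := (ss ! i, MoveL)])"
| "next_com (Write i b # l) ss = (l, (idle ss)[i := (Bit b, Stay)])"
| "next_com (Pop i # l) ss = (l, (idle ss)[i := (ss ! i, MoveR)])"
| "next_com (Seq a b # l) ss = (a # b # l, idle ss)"
| "next_com (If_Top i x a b # l) ss = ((if ss ! i = sym_of x then a else b) # l, idle ss)"
| "next_com (While_Not i x a # l) ss =
     (if ss ! i = sym_of x then l else a # While_Not i x a # l, idle ss)"

text \<open>The lists that occur while \<open>c\<close> runs in front of the continuation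
  \<open>l\<close>. The set stays finite in spite of loops because the body of a loop runs with that
  same loop as the head of its continuation.\<close>

fun residuals :: "com \<Rightarrow> com list \<Rightarrow> com list set" where
  "residuals (Push i b) l = {Push i b # l, Write i b # l}"
| "residuals (Seq a b) l = insert (Seq a b # l) (residuals a (b # l) \<union> residuals b l)"
| "residuals (If_Top i x a b) l = insert (If_Top i x a b # l) (residuals a l \<union> residuals b l)"
| "residuals (While_Not i x a) l = insert (While_Not i x a # l) (residuals a (While_Not i x a # l))"
| "residuals c l = {c # l}"

lemma finite_residuals: "finite (residuals c l)"
  by (induction c arbitrary: l) auto

lemma residuals_self: "c # l \<in> residuals c l"
  by (cases c) auto

text \<open>A residual either steps to another residual or has finished \<open>c\<close> and leaves
  \<open>l\<close>; this is what closes the state set of \<open>tm_of\<close> under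
  \<open>delta\<close>.\<close>

lemma residuals_closed:
  "r \<in> residuals c l \<Longrightarrow> fst (next_com r ss) \<in> insert l (residuals c l)"
proof (induction c arbitrary: l)
  case (Seq a b)
  then show ?case using residuals_self[of a "b # l"] residuals_self[of b l] by fastforce
next
  case (If_Top i x a b)
  then show ?case using residuals_self[of a l] residuals_self[of b l] by (auto split: if_splits)
next
  case (While_Not i x a)
  then show ?case using While_Not.IH[of "While_Not i x a # l"] residuals_self[of a "While_Not i x a # l"]
    by (auto split: if_splits)
qed auto

text \<open>States 0 and 1 are the accepting and the rejecting state; every other state stands for the
  list of commands that remain to be executed.\<close>

definition state_of :: "com list \<Rightarrow> nat" where
  "state_of l = to_nat l + 2"

definition tm_of :: "com \<Rightarrow> tm" where
  "tm_of c = \<lparr>num_tapes = num_stacks c,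
     states = {0, 1} \<union> state_of ` insert [] (residuals c []),
     symbols = {Blank, Bit False, Bit True},
     start = state_of [c], accept = 0, reject = 1,
     delta = (\<lambda>q ss.
       if q < 2 then (q, idle ss)
       else let l = from_nat (q - 2)
         in if l = [] then (if ss ! 0 = Bit True then 0 else 1, idle ss)
            else (state_of (fst (next_com l ss)), snd (next_com l ss)))\<rparr>"

lemma next_com_acts:
  assumes "set ss \<subseteq> S" and "{Bit False, Bit True} \<subseteq> S"
  shows "length (snd (next_com l ss)) = length ss \<and> fst ` set (snd (next_com l ss)) \<subseteq> S"
proof -
  have upd: "fst ` set ((idle ss)[i := (a, d)]) \<subseteq> S" if "i < length ss \<Longrightarrow> a \<in> S" for i a d
  proof (cases "i < length ss")
    case True
    have "set ((idle ss)[i := (a, d)]) \<subseteq> insert (a, d) (set (idle ss))"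
      by (rule set_update_subset_insert)
    then show ?thesis using True that assms(1) by (fastforce simp: idle_def)
  next
    case False
    then have "(idle ss)[i := (a, d)] = idle ss" by (simp add: idle_def list_update_beyond)
    then show ?thesis using assms(1) by (auto simp: idle_def)
  qed
  have idle: "fst ` set (idle ss) \<subseteq> S" "length (idle ss) = length ss"
    using assms(1) by (auto simp: idle_def)
  have nth: "ss ! i \<in> S" if "i < length ss" for i
    using assms(1) that by (meson nth_mem subsetD)
  have bit: "Bit b \<in> S" for b
    using assms(2) by (cases b) auto
  show ?thesis
    by (cases "(l, ss)" rule: next_com.cases) (use idle upd nth bit in auto)
qed

lemma num_stacks_pos: "num_stacks c \<ge> 1"
  by (induction c) auto

lemma tm_of_simps [simp]:
  "accept (tm_of c) = 0" "reject (tm_of c) = 1" "start (tm_of c) = state_of [c]"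
  "num_tapes (tm_of c) = num_stacks c"
  by (simp_all add: tm_of_def)

lemma delta_tm_of:
  "delta (tm_of c) (state_of l) ss =
    (if l = [] then (if ss ! 0 = Bit True then 0 else 1, idle ss)
     else (state_of (fst (next_com l ss)), snd (next_com l ss)))"
  by (simp add: tm_of_def state_of_def)

lemma delta_tm_of_halted: "q < 2 \<Longrightarrow> delta (tm_of c) q ss = (q, idle ss)"
  by (simp add: tm_of_def)

lemma wf_tm_of: "wf_tm (tm_of c)"
proof -
  have "case delta (tm_of c) q ss of (q', acts) \<Rightarrow>
      q' \<in> states (tm_of c) \<and> length acts = num_tapes (tm_of c) \<and> fst ` set acts \<subseteq> symbols (tm_of c)"
    if q: "q \<in> states (tm_of c)" and ss: "length ss = num_tapes (tm_of c)" "set ss \<subseteq> symbols (tm_of c)"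
    for q ss
  proof -
    have idle: "length (idle ss) = num_tapes (tm_of c)" "fst ` set (idle ss) \<subseteq> symbols (tm_of c)"
      using ss by (auto simp: idle_def)
    consider "q < 2" "q \<in> {0, 1}" | "q = state_of []" | r where "q = state_of r" "r \<in> residuals c []" "r \<noteq> []"
      using q by (auto simp: tm_of_def)
    then show ?thesis
    proof cases
      case 1
      then show ?thesis using idle delta_tm_of_halted[of q c ss] by (auto simp: tm_of_def)
    next
      case 2
      then show ?thesis using idle by (auto simp: delta_tm_of) (auto simp: tm_of_def)
    next
      case 3
      have "length (snd (next_com r ss)) = length ss \<and> fst ` set (snd (next_com r ss)) \<subseteq> symbols (tm_of c)"
        using ss by (intro next_com_acts) (auto simp: tm_of_def)
      moreover have "state_of (fst (next_com r ss)) \<in> states (tm_of c)"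
        using residuals_closed[OF 3(2), of ss] by (auto simp: tm_of_def)
      ultimately show ?thesis using 3 ss by (simp add: delta_tm_of)
    qed
  qed
  then show ?thesis
    using num_stacks_pos[of c] unfolding wf_tm_def
    by (auto simp: finite_residuals residuals_self tm_of_def)
qed

text \<open>A stack is stored with its top under the head and its bottom to the right; the cells to the
  left of the head may contain garbage.\<close>

definition holds_stack :: "bool list \<Rightarrow> tape \<Rightarrow> bool" where
  "holds_stack l t \<longleftrightarrow>
     (\<forall>j. fst t (snd t + int j) = (if j < length l then Bit (l ! j) else Blank))"

lemma read_holds_stack: "holds_stack l t \<Longrightarrow> read_tape t = sym_of (stack_top l)"
  by (cases t; cases l) (auto simp: holds_stack_def sym_of_def dest: spec[of _ 0])

lemma act_idle [simp]: "act_tape (read_tape t, Stay) t = t"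
  by (cases t) simp

lemma holds_stack_pop:
  assumes "holds_stack l t"
  shows "holds_stack (tl l) (act_tape (read_tape t, MoveR) t)"
proof (cases t)
  case (Pair f h)
  have "f (h + 1 + int j) = (if j < length (tl l) then Bit (tl l ! j) else Blank)" for j
    using assms[unfolded holds_stack_def, rule_format, of "Suc j"] Pair
    by (auto simp: nth_tl algebra_simps)
  then show ?thesis by (simp add: Pair holds_stack_def)
qed

lemma holds_stack_push:
  assumes "holds_stack l t"
  shows "holds_stack (b # l) (act_tape (Bit b, Stay) (act_tape (read_tape t, MoveL) t))"
proof (cases t)
  case (Pair f h)
  have "(f(h - 1 := Bit b)) (h - 1 + int j) = (if j < length (b # l) then Bit ((b # l) ! j) else Blank)" for j
    using assms[unfolded holds_stack_def, rule_format, of "j - 1"] Pair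
    by (cases j) (auto simp: algebra_simps)
  then show ?thesis by (simp add: Pair holds_stack_def)
qed

section \<open>Simulation of stack programs by machines\<close>

definition represents :: "nat \<Rightarrow> (nat \<Rightarrow> bool list) \<Rightarrow> tape list \<Rightarrow> bool" where
  "represents k s ts \<longleftrightarrow> length ts = k \<and> (\<forall>i<k. holds_stack (s i) (ts ! i))"

lemma map2_act_idle: "map2 act_tape (idle (map read_tape ts)) ts = ts"
  by (rule nth_equalityI) (auto simp: idle_def)

lemma map2_act_update:
  assumes "i < length ts"
  shows "map2 act_tape ((idle (map read_tape ts))[i := a]) ts = ts[i := act_tape a (ts ! i)]"
  using assms by (intro nth_equalityI) (auto simp: idle_def nth_list_update)

declare step.simps [simp del]

lemma step_tm_of:
  assumes "l \<noteq> []"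
  shows "step (tm_of c) (state_of l, ts) =
    (state_of (fst (next_com l (map read_tape ts))),
     map2 act_tape (snd (next_com l (map read_tape ts))) ts)"
  using assms by (simp add: step.simps delta_tm_of) (simp add: state_of_def)

lemma sym_of_eq_iff [simp]: "sym_of x = sym_of y \<longleftrightarrow> x = y"
  by (auto simp: sym_of_def split: option.splits)

lemma represents_update:
  "represents k s ts \<Longrightarrow> i < k \<Longrightarrow> holds_stack l t \<Longrightarrow> represents k (s(i := l)) (ts[i := t])"
  by (auto simp: represents_def nth_list_update)

lemma represents_read:
  "represents k s ts \<Longrightarrow> i < k \<Longrightarrow> map read_tape ts ! i = sym_of (stack_top (s i))"
  by (simp add: represents_def read_holds_stack)

lemma funpow_add_apply: "(f ^^ (m + n)) x = (f ^^ n) ((f ^^ m) x)"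
  by (metis add.commute comp_apply funpow_add)

text \<open>On nonempty command lists the transition function is the same for all programs, so the
  machine \<open>tm_of c0\<close> can stay fixed while the induction descends into parts of its
  program. The continuation \<open>l\<close> is arbitrary because \<open>Seq\<close> and loops run
  their parts with longer continuations.\<close>

lemma exec_simulation:
  "exec c s t s' \<Longrightarrow> num_stacks c \<le> k \<Longrightarrow> represents k s ts \<Longrightarrow>
    \<exists>ts'. represents k s' ts' \<and> (step (tm_of c0) ^^ t) (state_of (c # l), ts) = (state_of l, ts')"
proof (induction arbitrary: ts l rule: exec.induct)
  case (exec_Skip s)
  then show ?case by (auto simp: step_tm_of map2_act_idle)
next
  case (exec_Push i b s)
  let ?t1 = "act_tape (read_tape (ts ! i), MoveL) (ts ! i)"
  let ?ts = "ts[i := ?t1]"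
  have i: "i < k" "i < length ts" using exec_Push by (auto simp: represents_def)
  have "step (tm_of c0) (state_of (Push i b # l), ts) = (state_of (Write i b # l), ?ts)"
    using i by (simp add: step_tm_of map2_act_update)
  moreover have "step (tm_of c0) (state_of (Write i b # l), ?ts) =
      (state_of l, ts[i := act_tape (Bit b, Stay) ?t1])"
    using i by (simp add: step_tm_of map2_act_update del: map_update)
  moreover have "represents k (s(i := b # s i)) (ts[i := act_tape (Bit b, Stay) ?t1])"
    using exec_Push i by (intro represents_update holds_stack_push) (auto simp: represents_def)
  ultimately show ?case
    by (intro exI[of _ "ts[i := act_tape (Bit b, Stay) ?t1]"]) (simp add: numeral_2_eq_2 fun_upd_def)
next
  case (exec_Pop i s)
  have i: "i < k" "i < length ts" using exec_Pop by (auto simp: represents_def)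
  have "represents k (s(i := tl (s i))) (ts[i := act_tape (read_tape (ts ! i), MoveR) (ts ! i)])"
    using exec_Pop i by (intro represents_update holds_stack_pop) (auto simp: represents_def)
  then show ?case using i by (auto simp: step_tm_of map2_act_update fun_upd_def)
next
  case (exec_Seq a s t s' b t' s'')
  obtain ts1 where 1: "represents k s' ts1"
      "(step (tm_of c0) ^^ t) (state_of (a # b # l), ts) = (state_of (b # l), ts1)"
    using exec_Seq.IH(1)[of ts "b # l"] exec_Seq.prems by auto
  obtain ts2 where 2: "represents k s'' ts2"
      "(step (tm_of c0) ^^ t') (state_of (b # l), ts1) = (state_of l, ts2)"
    using exec_Seq.IH(2)[of ts1 l] exec_Seq.prems 1 by auto
  have "step (tm_of c0) (state_of (Seq a b # l), ts) = (state_of (a # b # l), ts)"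
    by (simp add: step_tm_of map2_act_idle)
  then show ?case using 1 2 by (auto simp: funpow_add_apply simp del: funpow.simps(2) simp: funpow_Suc_right)
next
  case (exec_If_True s i x a t s' b)
  have "i < k" using exec_If_True.prems by simp
  then have "step (tm_of c0) (state_of (If_Top i x a b # l), ts) = (state_of (a # l), ts)"
    using exec_If_True.prems exec_If_True.hyps represents_read[of k s ts i]
    by (auto simp: step_tm_of map2_act_idle)
  then show ?case using exec_If_True.IH[of ts l] exec_If_True.prems
    by (auto simp del: funpow.simps(2) simp: funpow_Suc_right)
next
  case (exec_If_False s i x b t s' a)
  have "i < k" using exec_If_False.prems by simp
  then have "step (tm_of c0) (state_of (If_Top i x a b # l), ts) = (state_of (b # l), ts)"
    using exec_If_False.prems exec_If_False.hyps represents_read[of k s ts i]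
    by (auto simp: step_tm_of map2_act_idle)
  then show ?case using exec_If_False.IH[of ts l] exec_If_False.prems
    by (auto simp del: funpow.simps(2) simp: funpow_Suc_right)
next
  case (exec_While_End s i x a)
  have "i < k" using exec_While_End.prems by simp
  then have "step (tm_of c0) (state_of (While_Not i x a # l), ts) = (state_of l, ts)"
    using exec_While_End.prems exec_While_End.hyps represents_read[of k s ts i]
    by (auto simp: step_tm_of map2_act_idle)
  then show ?case using exec_While_End.prems by auto
next
  case (exec_While_Step s i x a t s' t' s'')
  let ?W = "While_Not i x a"
  have "i < k" using exec_While_Step.prems by simp
  then have *: "step (tm_of c0) (state_of (?W # l), ts) = (state_of (a # ?W # l), ts)"
    using exec_While_Step.prems exec_While_Step.hyps represents_read[of k s ts i]
    by (auto simp: step_tm_of map2_act_idle)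
  obtain ts1 where 1: "represents k s' ts1"
      "(step (tm_of c0) ^^ t) (state_of (a # ?W # l), ts) = (state_of (?W # l), ts1)"
    using exec_While_Step.IH(1)[of ts "?W # l"] exec_While_Step.prems by auto
  obtain ts2 where 2: "represents k s'' ts2"
      "(step (tm_of c0) ^^ t') (state_of (?W # l), ts1) = (state_of l, ts2)"
    using exec_While_Step.IH(2)[of ts1 l] exec_While_Step.prems 1 by auto
  show ?case using * 1 2 by (auto simp: funpow_add_apply simp del: funpow.simps(2) simp: funpow_Suc_right)
qed

lemma halted_stays:
  "q = accept M \<or> q = reject M \<Longrightarrow> (step M ^^ n) (q, ts) = (q, ts)"
  by (induction n) (auto simp: step.simps)

lemma PTIME_if_exec:
  fixes p :: "nat poly"
  assumes "\<And>w. \<exists>t s. t \<le> poly p (length w) \<and> exec c ((\<lambda>_. [])(0 := w)) t s \<and>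
    (stack_top (s 0) = Some True \<longleftrightarrow> w \<in> L)"
  shows "L \<in> PTIME"
proof -
  let ?M = "tm_of c"
  let ?k = "num_stacks c"
  have "decides_in_time ?M L (poly (p + 1))"
    unfolding decides_in_time_def
  proof
    fix w :: "bool list"
    let ?n = "length w"
    obtain t s where t: "t \<le> poly p ?n" and ex: "exec c ((\<lambda>_. [])(0 := w)) t s"
      and stack_top: "stack_top (s 0) = Some True \<longleftrightarrow> w \<in> L"
      using assms by blast
    have k: "1 \<le> ?k" by (rule num_stacks_pos)
    have "holds_stack w (input_tape w)" "holds_stack [] blank_tape"
      by (auto simp: holds_stack_def input_tape_def blank_tape_def)
    then have "represents ?k ((\<lambda>_. [])(0 := w)) (input_tape w # replicate (?k - 1) blank_tape)"
      using k by (auto simp: represents_def nth_Cons split: nat.split)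
    from exec_simulation[OF ex _ this, of c "[]"] obtain ts where ts: "represents ?k s ts"
      and run: "(step ?M ^^ t) (init_config ?M w) = (state_of [], ts)"
      by (auto simp: init_config_def)
    have "read_tape (ts ! 0) = sym_of (stack_top (s 0))" "ts \<noteq> []"
      using ts k by (auto simp: represents_def intro!: read_holds_stack)
    moreover have "sym_of (stack_top (s 0)) = Bit True \<longleftrightarrow> w \<in> L"
      using stack_top by (auto simp: sym_of_def split: option.splits)
    ultimately have fin: "step ?M (state_of [], ts) = (if w \<in> L then 0 else 1, ts)"
      by (simp add: step.simps delta_tm_of map2_act_idle) (simp add: state_of_def)
    \<comment> \<open>Exactly \<open>poly (p + 1) ?n\<close> steps are demanded: \<open>t\<close>
      for the program, one for the verdict read off stack 0, and the remaining \<open>d\<close> in a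
      halting state, which is a fixed point.\<close>
    obtain d where d: "poly (p + 1) ?n = t + Suc d"
      using t le_Suc_ex[of t "poly p ?n"] by auto
    have "(step ?M ^^ d) (if w \<in> L then 0 else 1, ts) = (if w \<in> L then 0 else 1, ts)"
      by (rule halted_stays) simp
    then have "(step ?M ^^ (poly (p + 1) ?n)) (init_config ?M w) = (if w \<in> L then 0 else 1, ts)"
      unfolding d funpow_add_apply run by (simp add: fin funpow_Suc_right del: funpow.simps(2))
    then show "fst ((step ?M ^^ poly (p + 1) ?n) (init_config ?M w)) =
        (if w \<in> L then accept ?M else reject ?M)"
      by simp
  qed
  then show ?thesis using wf_tm_of unfolding PTIME_def by blast
qed

section \<open>Polynomial bounds\<close>

definition poly_bounded :: "(nat \<Rightarrow> nat) \<Rightarrow> bool" where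
  "poly_bounded f \<longleftrightarrow> (\<exists>p :: nat poly. \<forall>n. f n \<le> poly p n)"

text \<open>Natural coefficients make every polynomial monotone, so a time bound may be evaluated at
  an upper bound of the size.\<close>

lemma poly_nat_mono: "m \<le> n \<Longrightarrow> poly p m \<le> poly (p :: nat poly) n"
  by (induction p) (auto intro!: add_mono mult_mono)

named_theorems poly_bounded_intros

lemma poly_bounded_poly [poly_bounded_intros]: "poly_bounded (\<lambda>n. poly p n)"
  by (auto simp: poly_bounded_def)

lemma poly_bounded_id [poly_bounded_intros]: "poly_bounded (\<lambda>n. n)"
  unfolding poly_bounded_def by (rule exI[of _ "[:0, 1:]"]) simp

lemma poly_bounded_const [poly_bounded_intros]: "poly_bounded (\<lambda>n. c)"
  unfolding poly_bounded_def by (rule exI[of _ "[:c:]"]) simp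

lemma poly_bounded_add [poly_bounded_intros]:
  "poly_bounded f \<Longrightarrow> poly_bounded g \<Longrightarrow> poly_bounded (\<lambda>n. f n + g n)"
  unfolding poly_bounded_def by (metis add_mono poly_add)

lemma poly_bounded_mult [poly_bounded_intros]:
  "poly_bounded f \<Longrightarrow> poly_bounded g \<Longrightarrow> poly_bounded (\<lambda>n. f n * g n)"
  unfolding poly_bounded_def by (metis mult_le_mono poly_mult)

lemma poly_bounded_compose:
  assumes "poly_bounded f" "poly_bounded g"
  shows "poly_bounded (\<lambda>n. f (g n))"
proof -
  obtain p q where p: "\<And>n. f n \<le> poly p n" and q: "\<And>n. g n \<le> poly q n"
    using assms by (auto simp: poly_bounded_def)
  have "f (g n) \<le> poly (pcompose p q) n" for n
    using order_trans[OF p[of "g n"] poly_nat_mono[OF q]] by (simp add: poly_pcompose)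
  then show ?thesis unfolding poly_bounded_def by blast
qed

lemma poly_bounded_poly_compose [poly_bounded_intros]:
  "poly_bounded g \<Longrightarrow> poly_bounded (\<lambda>n. poly p (g n))"
  by (rule poly_bounded_compose[OF poly_bounded_poly])

section \<open>Timed execution\<close>

notation Seq (infixr ";;" 60)

definition runs :: "com \<Rightarrow> (nat \<Rightarrow> bool list) \<Rightarrow> nat \<Rightarrow> (nat \<Rightarrow> bool list) \<Rightarrow> bool" where
  "runs c s T s' \<longleftrightarrow> (\<exists>t\<le>T. exec c s t s')"

lemma runs_mono: "runs c s T s' \<Longrightarrow> T \<le> T' \<Longrightarrow> runs c s T' s'"
  unfolding runs_def by (meson order_trans)

lemma runs_Skip: "runs Skip s 1 s"
  unfolding runs_def using exec_Skip by blast

lemma runs_Push: "runs (Push i b) s 2 (s(i := b # s i))"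
  unfolding runs_def using exec_Push by blast

lemma runs_Pop: "runs (Pop i) s 1 (s(i := tl (s i)))"
  unfolding runs_def using exec_Pop by blast

lemma runs_Seq: "runs a s T s' \<Longrightarrow> runs b s' T' s'' \<Longrightarrow> runs (a ;; b) s (1 + T + T') s''"
  unfolding runs_def by (metis add_mono exec_Seq order_refl)

lemma runs_If_True: "stack_top (s i) = x \<Longrightarrow> runs a s T s' \<Longrightarrow> runs (If_Top i x a b) s (1 + T) s'"
  unfolding runs_def by (metis exec_If_True nat_add_left_cancel_le)

lemma runs_If_False: "stack_top (s i) \<noteq> x \<Longrightarrow> runs b s T s' \<Longrightarrow> runs (If_Top i x a b) s (1 + T) s'"
  unfolding runs_def by (metis exec_If_False nat_add_left_cancel_le)

lemma runs_If_bit: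
  assumes "s i = b # l" "runs (if b then c else c') s T s'"
  shows "runs (If_Top i (Some True) c c') s (1 + T) s'"
proof (cases b)
  case True
  then show ?thesis using assms by (intro runs_If_True) auto
next
  case False
  then show ?thesis using assms by (intro runs_If_False) auto
qed

lemma runs_While_End: "stack_top (s i) = x \<Longrightarrow> runs (While_Not i x a) s 1 s"
  unfolding runs_def using exec_While_End by blast

lemma runs_While_Step:
  "stack_top (s i) \<noteq> x \<Longrightarrow> runs a s T s' \<Longrightarrow> runs (While_Not i x a) s' T' s'' \<Longrightarrow>
    runs (While_Not i x a) s (1 + T + T') s''"
  unfolding runs_def by (metis add_mono exec_While_Step order_refl)

text \<open>Stack 0 holds the data, 1 and 3 are buffers, and 2 is the counter of
  \<open>move_loop\<close>.\<close>

definition stacks :: "bool list \<Rightarrow> bool list \<Rightarrow> bool list \<Rightarrow> bool list \<Rightarrow> nat \<Rightarrow> bool list" where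
  "stacks a b c d = (\<lambda>_. [])(0 := a, 1 := b, 2 := c, 3 := d)"

lemma stacks_simps [simp]:
  "stacks a b c d 0 = a" "stacks a b c d 1 = b" "stacks a b c d (Suc 0) = b"
  "stacks a b c d 2 = c" "stacks a b c d 3 = d"
  "(stacks a b c d)(0 := e) = stacks e b c d" "(stacks a b c d)(1 := e) = stacks a e c d"
  "(stacks a b c d)(Suc 0 := e) = stacks a e c d"
  "(stacks a b c d)(2 := e) = stacks a b e d" "(stacks a b c d)(3 := e) = stacks a b c e"
  by (auto simp: stacks_def fun_eq_iff)

section \<open>Trees on a stack\<close>

datatype tree = Leaf | Node tree tree

fun ser :: "tree \<Rightarrow> bool list" where
  "ser Leaf = [False]"
| "ser (Node l r) = True # ser l @ ser r"

lemma length_ser_pos: "length (ser t) \<ge> 1"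
  by (cases t) auto

text \<open>Stack 2 counts the subtrees that still have to be moved.\<close>

definition move_loop :: "nat \<Rightarrow> com" where
  "move_loop j = While_Not 2 None (If_Top 0 (Some True)
     (Pop 0 ;; Push j True ;; Push 2 True) (Pop 0 ;; Push j False ;; Pop 2))"

definition move_tree :: "nat \<Rightarrow> com" where
  "move_tree j = (Push 2 True ;; move_loop j)"

text \<open>After the left subtree the loop continues with the right one without being left. The
  rest of the run is therefore a hypothesis, and the induction on the tree prepends the cost of one
  subtree at a time. Each symbol costs at most 9 steps: two tests and at most 7 for the
  body.\<close>

lemma runs_move_loop:
  assumes "j \<noteq> 0" "j \<noteq> 2" "s 0 = ser x @ m" "s 2 = True # c"
    and "runs (move_loop j) (s(0 := m, 2 := c, j := rev (ser x) @ s j)) T s'"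
  shows "runs (move_loop j) s (T + 9 * length (ser x)) s'"
  using assms(3-)
proof (induction x arbitrary: s m c T)
  case Leaf
  have eq: "s(0 := m, 2 := c, j := False # s j) = s(0 := m, j := False # s j, 2 := c)"
    using assms(1,2) by auto
  have "runs (Pop 0) s 1 (s(0 := m))"
    using runs_Pop[of 0 s] Leaf by simp
  moreover have "runs (Push j False) (s(0 := m)) 2 (s(0 := m, j := False # s j))"
    using runs_Push[of j False "s(0 := m)"] assms(1) by simp
  moreover have "runs (Pop 2) (s(0 := m, j := False # s j)) 1 (s(0 := m, j := False # s j, 2 := c))"
    using runs_Pop[of 2 "s(0 := m, j := False # s j)"] assms(2) Leaf by simp
  ultimately have "runs (Pop 0 ;; Push j False ;; Pop 2) s (1 + 1 + (1 + 2 + 1)) (s(0 := m, 2 := c, j := False # s j))"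
    unfolding eq by (intro runs_Seq)
  then have "runs (If_Top 0 (Some True)
     (Pop 0 ;; Push j True ;; Push 2 True) (Pop 0 ;; Push j False ;; Pop 2)) s (1 + (1 + 1 + (1 + 2 + 1)))
       (s(0 := m, 2 := c, j := False # s j))"
    using Leaf by (intro runs_If_False) auto
  then have "runs (move_loop j) s (1 + (1 + (1 + 1 + (1 + 2 + 1))) + T) s'"
    unfolding move_loop_def by (rule runs_While_Step[rotated]) (use Leaf in \<open>auto simp: move_loop_def fun_upd_def\<close>)
  then show ?case by (rule runs_mono) simp
next
  case (Node l r)
  let ?s = "s(0 := ser l @ ser r @ m, j := True # s j, 2 := True # True # c)"
  have "runs (Pop 0) s 1 (s(0 := ser l @ ser r @ m))"
    using runs_Pop[of 0 s] Node.prems by simp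
  moreover have "runs (Push j True) (s(0 := ser l @ ser r @ m)) 2 (s(0 := ser l @ ser r @ m, j := True # s j))"
    using runs_Push[of j True "s(0 := ser l @ ser r @ m)"] assms(1) by simp
  moreover have "runs (Push 2 True) (s(0 := ser l @ ser r @ m, j := True # s j)) 2 ?s"
    using runs_Push[of 2 True "s(0 := ser l @ ser r @ m, j := True # s j)"] assms(2) Node.prems by simp
  ultimately have "runs (Pop 0 ;; Push j True ;; Push 2 True) s (1 + 1 + (1 + 2 + 2)) ?s"
    by (intro runs_Seq)
  then have body: "runs (If_Top 0 (Some True)
     (Pop 0 ;; Push j True ;; Push 2 True) (Pop 0 ;; Push j False ;; Pop 2)) s (1 + (1 + 1 + (1 + 2 + 2))) ?s"
    using Node.prems by (intro runs_If_True) auto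
  let ?s1 = "?s(0 := ser r @ m, 2 := True # c, j := rev (ser l) @ ?s j)"
  have eq: "?s1(0 := m, 2 := c, j := rev (ser r) @ ?s1 j) = s(0 := m, 2 := c, j := rev (ser (Node l r)) @ s j)"
    using assms(1,2) by auto
  have "runs (move_loop j) (?s1(0 := m, 2 := c, j := rev (ser r) @ ?s1 j)) T s'"
    unfolding eq by (rule Node.prems(3))
  then have "runs (move_loop j) ?s1 (T + 9 * length (ser r)) s'"
    by (rule Node.IH(2)[rotated 2]) (use assms(1,2) in auto)
  then have "runs (move_loop j) ?s (T + 9 * length (ser r) + 9 * length (ser l)) s'"
    by (rule Node.IH(1)[rotated 2]) (use assms(1,2) in auto)
  then have "runs (move_loop j) s (1 + (1 + (1 + 1 + (1 + 2 + 2))) + (T + 9 * length (ser r) + 9 * length (ser l))) s'"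
    using body unfolding move_loop_def by (intro runs_While_Step) (use Node.prems in auto)
  then show ?case by (rule runs_mono) simp
qed

lemma runs_move_tree_1:
  "runs (move_tree 1) (stacks (ser x @ m) b [] d) (4 + 9 * length (ser x)) (stacks m (rev (ser x) @ b) [] d)"
proof -
  have "runs (move_loop 1) (stacks m (rev (ser x) @ b) [] d) 1 (stacks m (rev (ser x) @ b) [] d)"
    unfolding move_loop_def by (rule runs_While_End) simp
  then have "runs (move_loop 1) (stacks (ser x @ m) b [True] d) (1 + 9 * length (ser x))
      (stacks m (rev (ser x) @ b) [] d)"
    by (intro runs_move_loop[where c = "[]"]) auto
  from runs_Seq[OF runs_Push[of 2 True "stacks (ser x @ m) b [] d", simplified] this]
  show ?thesis unfolding move_tree_def by (rule runs_mono) simp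
qed

lemma runs_move_tree_3:
  "runs (move_tree 3) (stacks (ser x @ m) b [] d) (4 + 9 * length (ser x)) (stacks m b [] (rev (ser x) @ d))"
proof -
  have "runs (move_loop 3) (stacks m b [] (rev (ser x) @ d)) 1 (stacks m b [] (rev (ser x) @ d))"
    unfolding move_loop_def by (rule runs_While_End) simp
  then have "runs (move_loop 3) (stacks (ser x @ m) b [True] d) (1 + 9 * length (ser x))
      (stacks m b [] (rev (ser x) @ d))"
    by (intro runs_move_loop[where c = "[]"]) auto
  from runs_Seq[OF runs_Push[of 2 True "stacks (ser x @ m) b [] d", simplified] this]
  show ?thesis unfolding move_tree_def by (rule runs_mono) simp
qed

definition pour :: "nat \<Rightarrow> nat \<Rightarrow> com" where
  "pour i j = While_Not i None (If_Top i (Some True) (Pop i ;; Push j True) (Pop i ;; Push j False))"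

lemma runs_pour:
  assumes "i \<noteq> j"
  shows "runs (pour i j) s (1 + 6 * length (s i)) (s(i := [], j := rev (s i) @ s j))"
proof (induction "s i" arbitrary: s)
  case Nil
  have "runs (pour i j) s 1 s" unfolding pour_def by (rule runs_While_End) (simp flip: Nil)
  moreover have "s(i := [], j := rev (s i) @ s j) = s" using Nil assms by auto
  ultimately show ?case by (simp add: fun_upd_def flip: Nil)
next
  case (Cons b l)
  let ?s = "s(i := l, j := b # s j)"
  have "runs (Pop i ;; Push j b) s (1 + 1 + 2) ?s"
    using runs_Seq[OF runs_Pop[of i s] runs_Push[of j b "s(i := tl (s i))"]] assms
    by (simp flip: Cons.hyps(2))
  then have "runs (If_Top i (Some True) (Pop i ;; Push j True) (Pop i ;; Push j False)) s (1 + (1 + 1 + 2)) ?s"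
    by (intro runs_If_bit[of _ _ b l]) (cases b; simp flip: Cons.hyps(2))+
  moreover have "runs (pour i j) ?s (1 + 6 * length (?s i)) (?s(i := [], j := rev (?s i) @ ?s j))"
    using assms by (intro Cons.hyps(1)) simp
  moreover have "?s(i := [], j := rev (?s i) @ ?s j) = s(i := [], j := rev (s i) @ s j)"
    using assms by (auto simp flip: Cons.hyps(2))
  ultimately have "runs (pour i j) s (1 + (1 + (1 + 1 + 2)) + (1 + 6 * length (?s i))) (s(i := [], j := rev (s i) @ s j))"
    unfolding pour_def by (intro runs_While_Step) (auto simp flip: Cons.hyps(2))
  then show ?case by (rule runs_mono) (use assms in \<open>simp flip: Cons.hyps(2)\<close>)
qed

definition pour2 :: com where
  "pour2 = While_Not 1 None (If_Top 1 (Some True)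
     (Pop 1 ;; Push 0 True ;; Push 3 True) (Pop 1 ;; Push 0 False ;; Push 3 False))"

lemma runs_pour2:
  "runs pour2 (stacks a l [] d) (1 + 9 * length l) (stacks (rev l @ a) [] [] (rev l @ d))"
proof (induction l arbitrary: a d)
  case Nil
  show ?case unfolding pour2_def using runs_While_End[of "stacks a [] [] d" 1 None] by simp
next
  case (Cons b l)
  have "runs (Pop 1 ;; Push 0 b ;; Push 3 b) (stacks a (b # l) [] d) (1 + 1 + (1 + 2 + 2))
      (stacks (b # a) l [] (b # d))"
    using runs_Pop[of 1 "stacks a (b # l) [] d"] runs_Push[of 0 b "stacks a l [] d"]
      runs_Push[of 3 b "stacks (b # a) l [] d"] by (intro runs_Seq) simp_all
  then have "runs (If_Top 1 (Some True)
     (Pop 1 ;; Push 0 True ;; Push 3 True) (Pop 1 ;; Push 0 False ;; Push 3 False))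
     (stacks a (b # l) [] d) (1 + (1 + 1 + (1 + 2 + 2))) (stacks (b # a) l [] (b # d))"
    by (intro runs_If_bit[of _ _ b l]) (cases b; simp)+
  from runs_While_Step[OF _ this Cons.IH[of "b # a" "b # d", unfolded pour2_def]]
  show ?case by (auto simp: pour2_def elim!: runs_mono)
qed

abbreviation main_stack :: "bool list \<Rightarrow> nat \<Rightarrow> bool list" where
  "main_stack m \<equiv> stacks m [] [] []"

text \<open>Every transfer between stacks reverses. \<open>pour2\<close> leaves copies in the right
  order on stacks 0 and 3, and the one on stack 3 takes the detour through stack 1 to keep its
  order.\<close>

definition dup_tree :: com where
  "dup_tree = (move_tree 1 ;; pour2 ;; pour 3 1 ;; pour 1 0)"

lemma runs_dup_tree:
  "runs dup_tree (main_stack (ser x @ m)) (10 + 30 * length (ser x)) (main_stack (ser x @ ser x @ m))"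
proof -
  have "runs (pour 1 0) (stacks (ser x @ m) (rev (ser x)) [] []) (1 + 6 * length (ser x)) (main_stack (ser x @ ser x @ m))"
    using runs_pour[of 1 0 "stacks (ser x @ m) (rev (ser x)) [] []"] by simp
  moreover have "runs (pour 3 1) (stacks (ser x @ m) [] [] (ser x)) (1 + 6 * length (ser x)) (stacks (ser x @ m) (rev (ser x)) [] [])"
    using runs_pour[of 3 1 "stacks (ser x @ m) [] [] (ser x)"] by simp
  moreover have "runs pour2 (stacks m (rev (ser x)) [] []) (1 + 9 * length (ser x)) (stacks (ser x @ m) [] [] (ser x))"
    using runs_pour2[of m "rev (ser x)" "[]"] by simp
  moreover have "runs (move_tree 1) (main_stack (ser x @ m)) (4 + 9 * length (ser x)) (stacks m (rev (ser x)) [] [])"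
    using runs_move_tree_1[of x m "[]" "[]"] by simp
  ultimately have "runs dup_tree (main_stack (ser x @ m))
      (1 + (4 + 9 * length (ser x)) + (1 + (1 + 9 * length (ser x)) + (1 + (1 + 6 * length (ser x)) + (1 + 6 * length (ser x)))))
      (main_stack (ser x @ ser x @ m))"
    unfolding dup_tree_def by (intro runs_Seq)
  then show ?thesis by (rule runs_mono) simp
qed

definition swap_trees :: com where
  "swap_trees = (move_tree 1 ;; move_tree 3 ;; pour 1 0 ;; pour 3 0)"

lemma runs_swap_trees:
  "runs swap_trees (main_stack (ser x @ ser y @ m)) (13 + 15 * length (ser x) + 15 * length (ser y))
     (main_stack (ser y @ ser x @ m))"
proof -
  have "runs (pour 3 0) (stacks (ser x @ m) [] [] (rev (ser y))) (1 + 6 * length (ser y)) (main_stack (ser y @ ser x @ m))"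
    using runs_pour[of 3 0 "stacks (ser x @ m) [] [] (rev (ser y))"] by simp
  moreover have "runs (pour 1 0) (stacks m (rev (ser x)) [] (rev (ser y))) (1 + 6 * length (ser x)) (stacks (ser x @ m) [] [] (rev (ser y)))"
    using runs_pour[of 1 0 "stacks m (rev (ser x)) [] (rev (ser y))"] by simp
  moreover have "runs (move_tree 3) (stacks (ser y @ m) (rev (ser x)) [] []) (4 + 9 * length (ser y)) (stacks m (rev (ser x)) [] (rev (ser y)))"
    using runs_move_tree_3[of y m "rev (ser x)" "[]"] by simp
  moreover have "runs (move_tree 1) (main_stack (ser x @ ser y @ m)) (4 + 9 * length (ser x)) (stacks (ser y @ m) (rev (ser x)) [] [])"
    using runs_move_tree_1[of x "ser y @ m" "[]" "[]"] by simp
  ultimately have "runs swap_trees (main_stack (ser x @ ser y @ m))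
      (1 + (4 + 9 * length (ser x)) + (1 + (4 + 9 * length (ser y)) + (1 + (1 + 6 * length (ser x)) + (1 + 6 * length (ser y)))))
      (main_stack (ser y @ ser x @ m))"
    unfolding swap_trees_def by (intro runs_Seq)
  then show ?thesis by (rule runs_mono) simp
qed

definition drop_tree :: com where
  "drop_tree = (move_tree 1 ;; While_Not 1 None (Pop 1))"

lemma runs_drop_tree:
  "runs drop_tree (main_stack (ser x @ m)) (6 + 11 * length (ser x)) (main_stack m)"
proof -
  have clear: "runs (While_Not 1 None (Pop 1)) (stacks m l [] []) (1 + 2 * length l) (main_stack m)" for l
  proof (induction l)
    case Nil
    show ?case using runs_While_End[of "stacks m [] [] []" 1 None] by simp
  next
    case (Cons b l)
    have "runs (Pop 1) (stacks m (b # l) [] []) 1 (stacks m l [] [])"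
      using runs_Pop[of 1 "stacks m (b # l) [] []"] by simp
    from runs_While_Step[OF _ this Cons] show ?case by (auto elim!: runs_mono)
  qed
  from runs_Seq[OF runs_move_tree_1[of x m "[]" "[]"] clear[of "rev (ser x) @ []"]]
  have "runs (move_tree 1 ;; While_Not 1 None (Pop 1)) (main_stack (ser x @ m))
      (1 + (4 + 9 * length (ser x)) + (1 + 2 * length (ser x))) (main_stack m)" by simp
  then show ?thesis unfolding drop_tree_def by (rule runs_mono) simp
qed

fun push_word :: "bool list \<Rightarrow> com" where
  "push_word [] = Skip"
| "push_word (b # l) = (push_word l ;; Push 0 b)"

lemma runs_push_word:
  "runs (push_word l) (stacks a b c d) (1 + 3 * length l) (stacks (l @ a) b c d)"
proof (induction l)
  case Nil
  show ?case using runs_Skip[of "stacks a b c d"] by simp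
next
  case (Cons x l)
  from runs_Seq[OF Cons.IH runs_Push[of 0 x "stacks (l @ a) b c d"]]
  have "runs (push_word (x # l)) (stacks a b c d) (1 + (1 + 3 * length l) + 2) (stacks ((x # l) @ a) b c d)" by simp
  then show ?case by (rule runs_mono) auto
qed

section \<open>Functions computable in polynomial time\<close>

class coded =
  fixes tree_of :: "'a \<Rightarrow> tree"

instantiation bool :: coded
begin
definition "tree_of b = (if b then Node Leaf Leaf else Leaf)"
instance ..
end

instantiation prod :: (coded, coded) coded
begin
definition "tree_of p = Node (tree_of (fst p)) (tree_of (snd p))"
instance ..
end

primrec list_tree :: "'a::coded list \<Rightarrow> tree" where
  "list_tree [] = Leaf"
| "list_tree (x # xs) = Node (tree_of x) (list_tree xs)"

instantiation list :: (coded) coded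
begin
definition "tree_of (xs :: 'a list) = list_tree xs"
instance ..
end

definition word :: "'a::coded \<Rightarrow> bool list" where
  "word x = ser (tree_of x)"

abbreviation csize :: "'a::coded \<Rightarrow> nat" where
  "csize x \<equiv> length (word x)"

lemma word_simps [simp]:
  "word False = [False]" "word True = [True, False, False]"
  "word (x, y) = True # word x @ word y"
  "word [] = [False]" "word (x # xs) = True # word x @ word xs"
  by (simp_all add: word_def tree_of_bool_def tree_of_prod_def tree_of_list_def)

lemma csize_pos: "csize x \<ge> 1"
  by (simp add: word_def length_ser_pos[unfolded One_nat_def])

text \<open>The rest \<open>m\<close> of the stack is arbitrary and does not enter the time bound,
  so intermediate results can be parked below the argument of the next program at no cost.\<close>

definition polyf :: "('a::coded \<Rightarrow> 'b::coded) \<Rightarrow> bool" where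
  "polyf f \<longleftrightarrow> (\<exists>c (p :: nat poly). \<forall>x m.
     runs c (main_stack (word x @ m)) (poly p (csize x)) (main_stack (word (f x) @ m)))"

lemma polyfI:
  assumes "poly_bounded T"
    and "\<And>x m. runs c (main_stack (word x @ m)) (T (csize x)) (main_stack (word (f x) @ m))"
  shows "polyf f"
proof -
  obtain p where "\<And>n. T n \<le> poly p n" using assms(1) by (auto simp: poly_bounded_def)
  then show ?thesis unfolding polyf_def using runs_mono[OF assms(2)] by blast
qed

text \<open>The size bound on \<open>f x\<close> comes for free: a program cannot write more symbols
  than it makes steps.\<close>

lemma polyfE:
  assumes "polyf f"
  obtains c p where "\<And>x m. runs c (main_stack (word x @ m)) (poly p (csize x)) (main_stack (word (f x) @ m))"
    and "\<And>x. csize (f x) \<le> csize x + poly p (csize x)"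
proof -
  obtain c p where r: "\<And>x m. runs c (main_stack (word x @ m)) (poly p (csize x)) (main_stack (word (f x) @ m))"
    using assms by (auto simp: polyf_def)
  have "csize (f x) \<le> csize x + poly p (csize x)" for x
    using r[of x "[]"] exec_length_le[of c "main_stack (word x)" _ "main_stack (word (f x))" 0]
    by (force simp: runs_def)
  then show ?thesis using that r by blast
qed

lemma polyf_size:
  assumes "polyf f"
  obtains q :: "nat poly" where "\<And>x. csize (f x) \<le> poly q (csize x)"
proof -
  from assms obtain p :: "nat poly" where "\<And>x. csize (f x) \<le> csize x + poly p (csize x)"
    by (elim polyfE) blast
  then show ?thesis by (intro that[of "[:0, 1:] + p"]) simp
qed

named_theorems polyf_intros

text \<open>Types may share trees, for instance pairs and nonempty lists. Passing between them is
  done by \<open>Skip\<close>.\<close>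

lemma polyf_recode: "(\<And>x. tree_of (f x) = tree_of x) \<Longrightarrow> polyf f"
  by (rule polyfI[of "\<lambda>_. 1" Skip]) (auto intro!: poly_bounded_intros runs_Skip simp: word_def simp del: One_nat_def)

lemma polyf_id [polyf_intros]: "polyf (\<lambda>x. x)"
  by (rule polyf_recode) simp

lemma polyf_const [polyf_intros]: "polyf (\<lambda>x. c)"
proof (rule polyfI)
  show "runs (drop_tree ;; push_word (word c)) (main_stack (word x @ m))
      (1 + (6 + 11 * csize x) + (1 + 3 * csize c)) (main_stack (word c @ m))" for x :: 'a and m
    using runs_Seq[OF runs_drop_tree[of "tree_of x" m, folded word_def] runs_push_word[of "word c" m "[]" "[]" "[]"]] .
qed (intro poly_bounded_intros)

lemma polyf_comp:
  assumes "polyf f" "polyf g"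
  shows "polyf (\<lambda>x. f (g x))"
proof -
  obtain c p where f: "\<And>x m. runs c (main_stack (word x @ m)) (poly p (csize x)) (main_stack (word (f x) @ m))"
    using assms(1) by (elim polyfE) blast
  obtain d q where g: "\<And>x m. runs d (main_stack (word x @ m)) (poly q (csize x)) (main_stack (word (g x) @ m))"
      "\<And>x. csize (g x) \<le> csize x + poly q (csize x)"
    using assms(2) by (elim polyfE) blast
  show ?thesis
  proof (rule polyfI)
    show "runs (d ;; c) (main_stack (word x @ m)) (1 + poly q (csize x) + poly p (csize x + poly q (csize x)))
        (main_stack (word (f (g x)) @ m))" for x m
      by (intro runs_Seq[OF g(1)] runs_mono[OF f] poly_nat_mono g(2))
  qed (intro poly_bounded_intros)
qed

text \<open>\<open>g\<close> is evaluated first, on a copy of the argument, and swapped below it,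
  because the left component has to end up on top. The final push supplies the symbol of the
  node.\<close>

lemma polyf_Pair [polyf_intros]:
  assumes "polyf f" "polyf g"
  shows "polyf (\<lambda>x. (f x, g x))"
proof -
  obtain c p where f: "\<And>x m. runs c (main_stack (word x @ m)) (poly p (csize x)) (main_stack (word (f x) @ m))"
    using assms(1) by (elim polyfE) blast
  obtain d q where g: "\<And>x m. runs d (main_stack (word x @ m)) (poly q (csize x)) (main_stack (word (g x) @ m))"
      "\<And>x. csize (g x) \<le> csize x + poly q (csize x)"
    using assms(2) by (elim polyfE) blast
  show ?thesis
  proof (rule polyfI)
    show "runs (dup_tree ;; d ;; swap_trees ;; c ;; Push 0 True) (main_stack (word x @ m))
       (1 + (10 + 30 * csize x) + (1 + poly q (csize x) +
         (1 + (13 + 15 * (csize x + poly q (csize x)) + 15 * csize x) + (1 + poly p (csize x) + 2))))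
       (main_stack (word (f x, g x) @ m))" for x m
    proof (intro runs_Seq)
      show "runs dup_tree (main_stack (word x @ m)) (10 + 30 * csize x) (main_stack (word x @ word x @ m))"
        unfolding word_def by (rule runs_dup_tree)
      show "runs d (main_stack (word x @ word x @ m)) (poly q (csize x)) (main_stack (word (g x) @ word x @ m))"
        by (rule g)
      show "runs swap_trees (main_stack (word (g x) @ word x @ m))
        (13 + 15 * (csize x + poly q (csize x)) + 15 * csize x) (main_stack (word x @ word (g x) @ m))"
        using runs_swap_trees[of "tree_of (g x)" "tree_of x" m] g(2)[of x]
        by (auto simp: word_def elim: runs_mono)
      show "runs c (main_stack (word x @ word (g x) @ m)) (poly p (csize x)) (main_stack (word (f x) @ word (g x) @ m))"
        by (rule f)
      show "runs (Push 0 True) (main_stack (word (f x) @ word (g x) @ m)) 2 (main_stack (word (f x, g x) @ m))"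
        using runs_Push[of 0 True "main_stack (word (f x) @ word (g x) @ m)"] by simp
    qed
  qed (intro poly_bounded_intros)
qed

lemma runs_fst: "runs (Pop 0 ;; swap_trees ;; drop_tree) (main_stack (True # word x @ word y @ m))
  (22 + 41 * (csize x + csize y)) (main_stack (word x @ m))"
proof -
  have "runs (Pop 0) (main_stack (True # word x @ word y @ m)) 1 (main_stack (word x @ word y @ m))"
    using runs_Pop[of 0 "main_stack (True # word x @ word y @ m)"] by simp
  from runs_Seq[OF this runs_Seq[OF runs_swap_trees[of "tree_of x" "tree_of y" m, folded word_def]
     runs_drop_tree[of "tree_of y" "word x @ m", folded word_def]]]
  show ?thesis by (rule runs_mono) simp
qed

lemma runs_snd: "runs (Pop 0 ;; drop_tree) (main_stack (True # word x @ word y @ m))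
  (22 + 41 * (csize x + csize y)) (main_stack (word y @ m))"
proof -
  have "runs (Pop 0) (main_stack (True # word x @ word y @ m)) 1 (main_stack (word x @ word y @ m))"
    using runs_Pop[of 0 "main_stack (True # word x @ word y @ m)"] by simp
  from runs_Seq[OF this runs_drop_tree[of "tree_of x" "word y @ m", folded word_def]]
  show ?thesis by (rule runs_mono) simp
qed

lemma polyf_fst0: "polyf fst"
proof (rule polyfI)
  show "runs (Pop 0 ;; swap_trees ;; drop_tree) (main_stack (word p @ m)) (22 + 41 * csize p)
      (main_stack (word (fst p) @ m))" for p :: "'a \<times> 'b" and m
    using runs_fst[of "fst p" "snd p" m] by (cases p) (auto elim: runs_mono)
qed (intro poly_bounded_intros)

lemma polyf_snd0: "polyf snd"
proof (rule polyfI)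
  show "runs (Pop 0 ;; drop_tree) (main_stack (word p @ m)) (22 + 41 * csize p)
      (main_stack (word (snd p) @ m))" for p :: "'a \<times> 'b" and m
    using runs_snd[of "fst p" "snd p" m] by (cases p) (auto elim: runs_mono)
qed (intro poly_bounded_intros)

lemmas polyf_fst [polyf_intros] = polyf_comp[OF polyf_fst0]
lemmas polyf_snd [polyf_intros] = polyf_comp[OF polyf_snd0]

lemma polyf_Cons [polyf_intros]:
  assumes "polyf f" "polyf g"
  shows "polyf (\<lambda>x. f x # g x)"
proof -
  have "polyf (\<lambda>p :: 'b \<times> 'b list. fst p # snd p)"
    by (rule polyf_recode) (simp add: tree_of_prod_def tree_of_list_def)
  from polyf_comp[OF this polyf_Pair[OF assms]] show ?thesis by simp
qed

text \<open>The first bit of a code tells a leaf from a node, hence the empty list from a nonempty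
  one.\<close>

lemma polyf_if_top:
  fixes f g :: "'a::coded \<Rightarrow> 'b::coded"
  assumes "poly_bounded T"
    and "\<And>x m. hd (word x) \<Longrightarrow> runs c (main_stack (word x @ m)) (T (csize x)) (main_stack (word (f x) @ m))"
    and "\<And>x m. \<not> hd (word x) \<Longrightarrow> runs d (main_stack (word x @ m)) (T (csize x)) (main_stack (word (f x) @ m))"
  shows "polyf f"
proof (rule polyfI)
  show "runs (If_Top 0 (Some True) c d) (main_stack (word x @ m)) (1 + T (csize x)) (main_stack (word (f x) @ m))" for x m
  proof -
    obtain b l where bl: "word x = b # l" using csize_pos[of x] by (cases "word x") auto
    show ?thesis
      by (rule runs_If_bit[of _ _ b "l @ m"]) (use assms(2,3)[of x m] bl in \<open>auto split: if_splits\<close>)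
  qed
qed (intro poly_bounded_intros assms(1))

lemma polyf_null0: "polyf (\<lambda>l. l = [])"
proof (rule polyf_if_top)
  show "runs (drop_tree ;; push_word (word False)) (main_stack (word l @ m)) (20 + 11 * csize l)
      (main_stack (word (l = []) @ m))" if "hd (word l)" for l :: "'a list" and m
    using runs_Seq[OF runs_drop_tree[of "tree_of l" m, folded word_def] runs_push_word[of "word False" m "[]" "[]" "[]"]] that
    by (cases l) (auto elim: runs_mono)
  show "runs (drop_tree ;; push_word (word True)) (main_stack (word l @ m)) (20 + 11 * csize l)
      (main_stack (word (l = []) @ m))" if "\<not> hd (word l)" for l :: "'a list" and m
    using runs_Seq[OF runs_drop_tree[of "tree_of l" m, folded word_def] runs_push_word[of "word True" m "[]" "[]" "[]"]] that
    by (cases l) (auto elim: runs_mono)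
qed (intro poly_bounded_intros)

lemma polyf_tl0: "polyf tl"
proof (rule polyf_if_top)
  show "runs (Pop 0 ;; drop_tree) (main_stack (word l @ m)) (22 + 41 * csize l)
      (main_stack (word (tl l) @ m))" if "hd (word l)" for l :: "'a list" and m
    using runs_snd[of "hd l" "tl l" m] that by (cases l) (auto elim: runs_mono)
  show "runs Skip (main_stack (word l @ m)) (22 + 41 * csize l)
      (main_stack (word (tl l) @ m))" if "\<not> hd (word l)" for l :: "'a list" and m
    using runs_Skip[of "main_stack (word l @ m)"] that by (cases l) (auto elim: runs_mono)
qed (intro poly_bounded_intros)

lemma polyf_hd0: "polyf (hd :: 'a::coded list \<Rightarrow> 'a)"
proof (rule polyf_if_top)
  \<comment> \<open>\<open>hd []\<close> is unspecified but a fixed value, so its code is a constant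
    that the program can push.\<close>
  let ?d = "csize (hd [] :: 'a)"
  show "runs (Pop 0 ;; swap_trees ;; drop_tree) (main_stack (word l @ m)) (22 + 41 * csize l + 3 * ?d)
      (main_stack (word (hd l) @ m))" if "hd (word l)" for l :: "'a list" and m
    using runs_fst[of "hd l" "tl l" m] that by (cases l) (auto elim: runs_mono)
  show "runs (drop_tree ;; push_word (word (hd [] :: 'a))) (main_stack (word l @ m)) (22 + 41 * csize l + 3 * ?d)
      (main_stack (word (hd l) @ m))" if "\<not> hd (word l)" for l :: "'a list" and m
    using runs_Seq[OF runs_drop_tree[of "tree_of l" m, folded word_def] runs_push_word[of "word (hd [] :: 'a)" m]] that
    by (cases l) (auto elim: runs_mono)
qed (intro poly_bounded_intros)

lemmas polyf_null [polyf_intros] = polyf_comp[OF polyf_null0]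
lemmas polyf_tl [polyf_intros] = polyf_comp[OF polyf_tl0]
lemmas polyf_hd [polyf_intros] = polyf_comp[OF polyf_hd0]

lemma polyf_If [polyf_intros]:
  assumes "polyf b" "polyf f" "polyf g"
  shows "polyf (\<lambda>x. if b x then f x else g x)"
proof -
  obtain c p where f: "\<And>x m. runs c (main_stack (word x @ m)) (poly p (csize x)) (main_stack (word (f x) @ m))"
    using assms(2) by (elim polyfE) blast
  obtain d q where g: "\<And>x m. runs d (main_stack (word x @ m)) (poly q (csize x)) (main_stack (word (g x) @ m))"
    using assms(3) by (elim polyfE) blast
  obtain e r where b: "\<And>x m. runs e (main_stack (word x @ m)) (poly r (csize x)) (main_stack (word (b x) @ m))"
    using assms(1) by (elim polyfE) blast
  have test: "runs (If_Top 0 (Some True) (drop_tree ;; c) (drop_tree ;; d)) (main_stack (word (b x) @ word x @ m))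
    (1 + (1 + 39 + (poly p (csize x) + poly q (csize x)))) (main_stack (word (if b x then f x else g x) @ m))" for x m
  proof (rule runs_If_bit)
    show "main_stack (word (b x) @ word x @ m) 0 = b x # tl (word (b x)) @ word x @ m"
      by (cases "b x") auto
    \<comment> \<open>The code of a Boolean has at most 3 bits, and
      \<open>6 + 11 * 3 = 39\<close>.\<close>
    have drop: "runs drop_tree (main_stack (word (b x) @ word x @ m)) 39 (main_stack (word x @ m))"
      using runs_drop_tree[of "tree_of (b x)" "word x @ m"]
      by (cases "b x") (auto simp: tree_of_bool_def elim: runs_mono)
    show "runs (if b x then drop_tree ;; c else drop_tree ;; d) (main_stack (word (b x) @ word x @ m))
        (1 + 39 + (poly p (csize x) + poly q (csize x))) (main_stack (word (if b x then f x else g x) @ m))"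
      using runs_mono[OF runs_Seq[OF drop f]] runs_mono[OF runs_Seq[OF drop g]] by (cases "b x") simp_all
  qed
  show ?thesis
  proof (rule polyfI)
    show "runs (dup_tree ;; e ;; If_Top 0 (Some True) (drop_tree ;; c) (drop_tree ;; d)) (main_stack (word x @ m))
      (1 + (10 + 30 * csize x) + (1 + poly r (csize x) + (1 + (1 + 39 + (poly p (csize x) + poly q (csize x))))))
      (main_stack (word (if b x then f x else g x) @ m))" for x m
      by (intro runs_Seq[OF runs_dup_tree[of "tree_of x" m, folded word_def]] runs_Seq[OF b] test)
  qed (intro poly_bounded_intros)
qed

lemma polyf_conj [polyf_intros]:
  assumes "polyf P" "polyf Q"
  shows "polyf (\<lambda>x. P x \<and> Q x)"
proof -
  have "(\<lambda>x. P x \<and> Q x) = (\<lambda>x. if P x then Q x else False)" by auto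
  then show ?thesis by (simp only:) (intro polyf_If polyf_const assms)
qed

lemma polyf_not [polyf_intros]:
  assumes "polyf P"
  shows "polyf (\<lambda>x. \<not> P x)"
proof -
  have "(\<lambda>x. \<not> P x) = (\<lambda>x. if P x then False else True)" by auto
  then show ?thesis by (simp only:) (intro polyf_If polyf_const assms)
qed

lemma polyf_disj [polyf_intros]:
  assumes "polyf P" "polyf Q"
  shows "polyf (\<lambda>x. P x \<or> Q x)"
proof -
  have "(\<lambda>x. P x \<or> Q x) = (\<lambda>x. if P x then True else Q x)" by auto
  then show ?thesis by (simp only:) (intro polyf_If polyf_const assms)
qed

lemma polyf_imp [polyf_intros]: "polyf P \<Longrightarrow> polyf Q \<Longrightarrow> polyf (\<lambda>x. P x \<longrightarrow> Q x)"
  unfolding imp_conv_disj by (intro polyf_disj polyf_not)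

lemma polyf_bool_eq [polyf_intros]:
  assumes "polyf P" "polyf Q"
  shows "polyf (\<lambda>x. P x = (Q x :: bool))"
proof -
  have "(\<lambda>x. P x = Q x) = (\<lambda>x. if P x then Q x else \<not> Q x)" by auto
  then show ?thesis by (simp only:) (intro polyf_If polyf_not assms)
qed

section \<open>Bounded recursion on lists\<close>

lemma csize_list_pos: "length xs < csize xs"
  by (induction xs) (auto simp: less_Suc_eq)

text \<open>Between rounds the remaining list lies on top without the symbol of the enclosing pair,
  so the loop test sees its constructor; the code of the empty list starts with
  \<open>False\<close>. The push restores the triple for \<open>c\<close>, and the pop removes the
  symbol again. The 2 in the last assumption counts the two pair symbols of the triple.\<close>

lemma runs_loop:
  fixes g :: "'e::coded \<Rightarrow> 'h::coded \<Rightarrow> 'b::coded \<Rightarrow> 'b"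
  assumes "\<And>l a m. runs c (main_stack (word (l :: 'h list, e, a) @ m)) (poly p (csize (l, e, a)))
      (main_stack (word (tl l, e, g e (hd l) a) @ m))"
    and "\<And>n. n \<le> length l \<Longrightarrow> csize (foldl (\<lambda>a h. g e h a) a (take n l)) \<le> K"
    and "csize l + csize e + K + 2 \<le> N"
  shows "runs (While_Not 0 (Some False) (Push 0 True ;; c ;; Pop 0)) (main_stack (word l @ word (e, a) @ m))
     (1 + length l * (6 + poly p N)) (main_stack (word ([] :: 'h list) @ word (e, foldl (\<lambda>a h. g e h a) a l) @ m))"
  using assms(2-)
proof (induction l arbitrary: a)
  case Nil
  show ?case using runs_While_End[of "main_stack (False # word (e, a) @ m)" 0 "Some False"] by simp
next
  case (Cons h l)
  let ?a = "g e h a"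
  have N: "csize (h # l, e, a) \<le> N" using Cons.prems(1)[of 0] Cons.prems(2) by simp
  have "runs (Push 0 True ;; c ;; Pop 0) (main_stack (word (h # l) @ word (e, a) @ m)) (1 + 2 + (1 + poly p N + 1))
      (main_stack (word l @ word (e, ?a) @ m))"
  proof (intro runs_Seq)
    show "runs (Push 0 True) (main_stack (word (h # l) @ word (e, a) @ m)) 2 (main_stack (word (h # l, e, a) @ m))"
      using runs_Push[of 0 True "main_stack (word (h # l) @ word (e, a) @ m)"] by simp
    show "runs c (main_stack (word (h # l, e, a) @ m)) (poly p N) (main_stack (word (l, e, ?a) @ m))"
      using runs_mono[OF assms(1)[of "h # l" a m] poly_nat_mono[OF N]] by simp
    show "runs (Pop 0) (main_stack (word (l, e, ?a) @ m)) 1 (main_stack (word l @ word (e, ?a) @ m))"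
      using runs_Pop[of 0 "main_stack (word (l, e, ?a) @ m)"] by simp
  qed
  moreover have "csize (foldl (\<lambda>a h. g e h a) ?a (take n l)) \<le> K" if "n \<le> length l" for n
    using Cons.prems(1)[of "Suc n"] that by simp
  ultimately have "runs (While_Not 0 (Some False) (Push 0 True ;; c ;; Pop 0)) (main_stack (word (h # l) @ word (e, a) @ m))
      (1 + (1 + 2 + (1 + poly p N + 1)) + (1 + length l * (6 + poly p N)))
      (main_stack (word ([] :: 'h list) @ word (e, foldl (\<lambda>a h. g e h a) ?a l) @ m))"
    by (intro runs_While_Step[OF _ _ Cons.IH]) (use Cons.prems in auto)
  then have "runs (While_Not 0 (Some False) (Push 0 True ;; c ;; Pop 0)) (main_stack (word (h # l) @ word (e, a) @ m))
      (1 + length (h # l) * (6 + poly p N))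
      (main_stack (word ([] :: 'h list) @ word (e, foldl (\<lambda>a h. g e h a) ?a l) @ m))"
    by (rule runs_mono) simp
  then show ?case by simp
qed

text \<open>The time of a round depends on the size of the accumulator at that moment, so
  \<open>B\<close> must bound the results of all prefixes, not just the final one. The argument
  \<open>x\<close> itself is carried along as the environment of \<open>g\<close>.\<close>

lemma polyf_foldl:
  fixes g :: "'e::coded \<Rightarrow> 'h::coded \<Rightarrow> 'b::coded \<Rightarrow> 'b"
  assumes g: "polyf (\<lambda>p. g (fst p) (fst (snd p)) (snd (snd p)))"
    and l: "polyf l" and a: "polyf a" and "poly_bounded B"
    and B: "\<And>x n. n \<le> length (l x) \<Longrightarrow> csize (foldl (\<lambda>a h. g x h a) (a x) (take n (l x))) \<le> B (csize x)"
  shows "polyf (\<lambda>x. foldl (\<lambda>a h. g x h a) (a x) (l x))"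
proof -
  obtain bp where bp: "\<And>n. B n \<le> poly bp n" using assms(4) by (auto simp: poly_bounded_def)
  have "polyf (\<lambda>q. (\<lambda>p. g (fst p) (fst (snd p)) (snd (snd p)))
      (fst (snd q), hd (fst q :: 'h list), snd (snd q)))"
    by (rule polyf_comp[OF g]) (intro polyf_intros)
  then have "polyf (\<lambda>q :: 'h list \<times> 'e \<times> 'b. (tl (fst q), fst (snd q), g (fst (snd q)) (hd (fst q)) (snd (snd q))))"
    by (intro polyf_intros) simp
  then obtain c p where "\<And>q m. runs c (main_stack (word q @ m)) (poly p (csize q))
      (main_stack (word (tl (fst q), fst (snd q), g (fst (snd q)) (hd (fst q)) (snd (snd q))) @ m))"
    by (elim polyfE) blast
  from this[of "(_, _, _)"] have c: "\<And>l e a m. runs c (main_stack (word (l, e, a) @ m)) (poly p (csize (l, e, a)))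
      (main_stack (word (tl l, e, g e (hd l) a) @ m))"
    by simp
  obtain lp where lp: "\<And>x. csize (l x) \<le> poly lp (csize x)"
    using l by (elim polyf_size) blast
  have "polyf (\<lambda>x. (l x, x, a x))" by (intro polyf_intros l a)
  then obtain d q where d: "\<And>x m. runs d (main_stack (word x @ m)) (poly q (csize x)) (main_stack (word (l x, x, a x) @ m))"
    by (elim polyfE) blast
  have "polyf (\<lambda>p :: 'h list \<times> 'e \<times> 'b. snd (snd p))" by (intro polyf_intros)
  then obtain f r where f: "\<And>p m. runs f (main_stack (word (p :: 'h list \<times> 'e \<times> 'b) @ m)) (poly r (csize p))
      (main_stack (word (snd (snd p)) @ m))"
    by (elim polyfE) blast
  let ?W = "While_Not 0 (Some False) (Push 0 True ;; c ;; Pop 0)"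
  show ?thesis
  proof (rule polyfI)
    fix x :: 'e and m
    let ?n = "csize x"
    let ?r = "foldl (\<lambda>a h. g x h a) (a x) (l x)"
    let ?N = "poly lp ?n + ?n + poly bp ?n + 2"
    show "runs (d ;; Pop 0 ;; ?W ;; Push 0 True ;; f) (main_stack (word x @ m))
      (1 + poly q ?n + (1 + 1 + (1 + (1 + poly lp ?n * (6 + poly p ?N)) + (1 + 2 + poly r ?N)))) (main_stack (word ?r @ m))"
    proof (intro runs_Seq)
      show "runs d (main_stack (word x @ m)) (poly q ?n) (main_stack (word (l x, x, a x) @ m))" by (rule d)
      show "runs (Pop 0) (main_stack (word (l x, x, a x) @ m)) 1 (main_stack (word (l x) @ word (x, a x) @ m))"
        using runs_Pop[of 0 "main_stack (word (l x, x, a x) @ m)"] by simp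
      have "runs ?W (main_stack (word (l x) @ word (x, a x) @ m)) (1 + length (l x) * (6 + poly p ?N))
          (main_stack (word ([] :: 'h list) @ word (x, ?r) @ m))"
        by (rule runs_loop[where K = "poly bp ?n"]) (use c order_trans[OF B bp] lp[of x] in auto)
      moreover have "length (l x) \<le> poly lp ?n"
        using csize_list_pos[of "l x"] lp[of x] by simp
      ultimately show "runs ?W (main_stack (word (l x) @ word (x, a x) @ m)) (1 + poly lp ?n * (6 + poly p ?N))
          (main_stack (word ([] :: 'h list) @ word (x, ?r) @ m))"
        by (auto elim!: runs_mono)
      show "runs (Push 0 True) (main_stack (word ([] :: 'h list) @ word (x, ?r) @ m)) 2
          (main_stack (word ([] :: 'h list, x, ?r) @ m))"
        using runs_Push[of 0 True "main_stack (word ([] :: 'h list) @ word (x, ?r) @ m)"] by simp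
      have "csize ?r \<le> poly bp ?n" using order_trans[OF B bp, of "length (l x)" x] by simp
      moreover have "csize (l x) \<ge> 1" by (rule csize_pos)
      ultimately have "csize ([] :: 'h list, x, ?r) \<le> ?N" using lp[of x] by simp
      from runs_mono[OF f poly_nat_mono[OF this]]
      show "runs f (main_stack (word ([] :: 'h list, x, ?r) @ m)) (poly r ?N) (main_stack (word ?r @ m))" by simp
    qed
  qed (intro poly_bounded_intros)
qed

lemma csize_mem: "x \<in> set xs \<Longrightarrow> csize x < csize xs"
  by (induction xs) auto

text \<open>The size of the accumulator is measured by \<open>\<mu>\<close>, because the code of a word with \<open>n\<close> bits does not
  have a fixed size: adding a bit to the binary representation of a number may change all other bits.\<close>

lemma polyf_foldl_additive:
  fixes g :: "'e::coded \<Rightarrow> 'h::coded \<Rightarrow> 'b::coded \<Rightarrow> 'b" and \<mu> :: "'b \<Rightarrow> nat"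
  assumes g: "polyf (\<lambda>p. g (fst p) (fst (snd p)) (snd (snd p)))"
    and l: "polyf l" and a: "polyf a" and "poly_bounded B"
    and \<mu>: "\<And>b. \<mu> b \<le> csize b" "\<And>b. csize b \<le> C * \<mu> b + C"
    and B: "\<And>x h b. h \<in> set (l x) \<Longrightarrow> \<mu> (g x h b) \<le> \<mu> b + B (csize x + csize h)"
  shows "polyf (\<lambda>x. foldl (\<lambda>b h. g x h b) (a x) (l x))"
proof -
  obtain bp where bp: "\<And>n. B n \<le> poly bp n" using assms(4) by (auto simp: poly_bounded_def)
  obtain ap where ap: "\<And>x. csize (a x) \<le> poly ap (csize x)"
    using a by (elim polyf_size) blast
  obtain lp where lp: "\<And>x. csize (l x) \<le> poly lp (csize x)"
    using l by (elim polyf_size) blast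
  let ?B = "\<lambda>n. poly bp (n + poly lp n)"
  have step: "\<mu> (g x h b) \<le> \<mu> b + ?B (csize x)" if h: "h \<in> set (l x)" for x h b
  proof -
    have "csize x + csize h \<le> csize x + poly lp (csize x)" using csize_mem[OF h] lp[of x] by simp
    from poly_nat_mono[OF this, of bp] bp[of "csize x + csize h"] B[OF h, of b] show ?thesis by linarith
  qed
  have grow: "\<mu> (foldl (\<lambda>b h. g x h b) b xs) \<le> \<mu> b + length xs * ?B (csize x)"
    if "set xs \<subseteq> set (l x)" for x xs b
    using that
  proof (induction xs arbitrary: b)
    case (Cons h xs)
    then have "\<mu> (foldl (\<lambda>b h. g x h b) (g x h b) xs) \<le> \<mu> (g x h b) + length xs * ?B (csize x)" by simp
    then show ?case using step[of h x b] Cons.prems by simp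
  qed simp
  show ?thesis
  proof (rule polyf_foldl[OF g l a])
    fix x n assume n: "n \<le> length (l x)"
    let ?r = "foldl (\<lambda>a h. g x h a) (a x) (take n (l x))"
    have "\<mu> ?r \<le> \<mu> (a x) + length (take n (l x)) * ?B (csize x)"
      by (rule grow) (rule set_take_subset)
    also have "\<dots> \<le> poly ap (csize x) + poly lp (csize x) * ?B (csize x)"
      using order_trans[OF \<mu>(1) ap[of x]] lp[of x] csize_list_pos[of "l x"] n by (intro add_mono mult_mono) auto
    finally have "C * \<mu> ?r + C \<le> C * (poly ap (csize x) + poly lp (csize x) * ?B (csize x)) + C" by simp
    with \<mu>(2)[of ?r]
    show "csize ?r \<le> C * (poly ap (csize x) + poly lp (csize x) * ?B (csize x)) + C" by linarith
  qed (intro poly_bounded_intros)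
qed

lemma polyf_foldl_csize:
  fixes g :: "'e::coded \<Rightarrow> 'h::coded \<Rightarrow> 'b::coded \<Rightarrow> 'b"
  assumes "polyf (\<lambda>p. g (fst p) (fst (snd p)) (snd (snd p)))" "polyf l" "polyf a" "poly_bounded B"
    and "\<And>x h b. h \<in> set (l x) \<Longrightarrow> csize (g x h b) \<le> csize b + B (csize x + csize h)"
  shows "polyf (\<lambda>x. foldl (\<lambda>b h. g x h b) (a x) (l x))"
  by (rule polyf_foldl_additive[where \<mu> = csize and C = 1, OF assms(1-4)]) (use assms(5) in auto)

lemma polyf_cong_tree:
  assumes "polyf g" "\<And>x. tree_of (f x) = tree_of (g x)"
  shows "polyf f"
  using assms unfolding polyf_def word_def by simp

lemma polyf_cong: "polyf g \<Longrightarrow> (\<And>x. f x = g x) \<Longrightarrow> polyf f"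
  by (rule polyf_cong_tree) auto

text \<open>A function of several arguments counts as a function of nested pairs; this lets such a
  fact act as an introduction rule for arbitrary arguments.\<close>

lemma polyf_uncurry:
  assumes "polyf (\<lambda>p. F (fst p) (snd p))" "polyf f" "polyf g"
  shows "polyf (\<lambda>x. F (f x) (g x))"
  using polyf_comp[OF assms(1) polyf_Pair[OF assms(2,3)]] by simp

section \<open>List functions\<close>

lemma polyf_rev [polyf_intros]:
  assumes "polyf f"
  shows "polyf (\<lambda>x. rev (f x))"
proof -
  have "polyf (\<lambda>x. foldl (\<lambda>a h. h # a) [] (f x))"
    by (rule polyf_foldl_csize[where B = "\<lambda>n. n + 1"]) (intro polyf_intros poly_bounded_intros assms | simp)+
  moreover have "foldl (\<lambda>a h. h # a) ys xs = rev xs @ ys" for xs ys :: "'b list"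
    by (induction xs arbitrary: ys) auto
  ultimately show ?thesis by simp
qed

lemma polyf_append [polyf_intros]:
  assumes "polyf f" "polyf g"
  shows "polyf (\<lambda>x. f x @ g x)"
proof -
  have "polyf (\<lambda>x. foldl (\<lambda>a h. h # a) (g x) (rev (f x)))"
    by (rule polyf_foldl_csize[where B = "\<lambda>n. n + 1"]) (intro polyf_intros poly_bounded_intros assms | simp)+
  moreover have "foldl (\<lambda>a h. h # a) ys xs = rev xs @ ys" for xs ys :: "'b list"
    by (induction xs arbitrary: ys) auto
  ultimately show ?thesis by simp
qed

lemma polyf_map [polyf_intros]:
  fixes l :: "'a::coded \<Rightarrow> 'b::coded list" and F :: "'a \<Rightarrow> 'b \<Rightarrow> 'c::coded"
  assumes F: "polyf (\<lambda>p. F (fst p) (snd p))" and l: "polyf l"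
  shows "polyf (\<lambda>x. map (\<lambda>h. F x h) (l x))"
proof -
  obtain q where q: "\<And>p. csize (F (fst p) (snd p)) \<le> poly q (csize p)"
    using F by (elim polyf_size) blast
  have "polyf (\<lambda>x. foldl (\<lambda>a h. F x h # a) [] (l x))"
  proof (rule polyf_foldl_csize[where B = "\<lambda>n. poly q (1 + n) + 1"])
    show "polyf (\<lambda>p. F (fst p) (fst (snd p)) # snd (snd p))"
      by (intro polyf_intros polyf_uncurry[OF F])
    show "csize (F x h # b) \<le> csize b + (poly q (1 + (csize x + csize h)) + 1)" for x h b
      using q[of "(x, h)"] by simp
  qed (intro poly_bounded_intros polyf_intros l)+
  then have "polyf (\<lambda>x. rev (foldl (\<lambda>a h. F x h # a) [] (l x)))" by (intro polyf_intros)
  moreover have "foldl (\<lambda>a h. F x h # a) ys xs = rev (map (F x) xs) @ ys" for x xs ys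
    by (induction xs arbitrary: ys) auto
  ultimately show ?thesis by simp
qed

lemma csize_bool: "csize (b :: bool) \<le> 3"
  by (cases b) auto

lemma polyf_list_all [polyf_intros]:
  assumes P: "polyf (\<lambda>p. P (fst p) (snd p))" and l: "polyf l"
  shows "polyf (\<lambda>x. list_all (\<lambda>h. P x h) (l x))"
proof -
  have "polyf (\<lambda>x. foldl (\<lambda>a h. a \<and> P x h) True (l x))"
  proof (rule polyf_foldl_csize[where B = "\<lambda>n. 3"])
    show "csize (b \<and> P x h) \<le> csize b + 3" for x h b using csize_bool[of "b \<and> P x h"] by linarith
  qed (intro poly_bounded_intros polyf_intros l polyf_uncurry[OF P])+
  moreover have "foldl (\<lambda>a h. a \<and> P x h) b xs \<longleftrightarrow> b \<and> list_all (P x) xs" for x xs b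
    by (induction xs arbitrary: b) auto
  ultimately show ?thesis by simp
qed

lemma csize_append: "csize (xs @ ys) + 1 = csize xs + csize ys"
  by (induction xs) auto

lemma polyf_concat [polyf_intros]:
  assumes "polyf f"
  shows "polyf (\<lambda>x. concat (f x))"
proof -
  have "polyf (\<lambda>x. foldl (\<lambda>a h. a @ h) [] (f x))"
  proof (rule polyf_foldl_csize[where B = "\<lambda>n. n"])
    show "csize (b @ h) \<le> csize b + (csize x + csize h)" for x and h b :: "'b list"
      using csize_append[of b h] by simp
  qed (intro polyf_intros poly_bounded_intros assms)+
  moreover have "foldl (\<lambda>a h. a @ h) ys xs = ys @ concat xs" for ys :: "'b list" and xs
    by (induction xs arbitrary: ys) auto
  ultimately show ?thesis by simp
qed

text \<open>The fold over one word consumes the other and records mismatches in a flag. The words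
  agree if the flag survives and nothing is left over.\<close>

lemma polyf_word_eq [polyf_intros]:
  fixes f g :: "'a::coded \<Rightarrow> bool list"
  assumes "polyf f" "polyf g"
  shows "polyf (\<lambda>x. f x = g x)"
proof -
  let ?G = "\<lambda>(s :: bool list \<times> bool) h. (tl (fst s), snd s \<and> fst s \<noteq> [] \<and> (hd (fst s) = h))"
  let ?r = "\<lambda>x. foldl ?G (g x, True) (f x)"
  have tl: "csize (tl l) \<le> csize l" for l :: "bool list" by (cases l) auto
  have "polyf ?r"
  proof (rule polyf_foldl_csize[where B = "\<lambda>n. 3"])
    show "csize (?G s h) \<le> csize s + 3" for s h
      using tl[of "fst s"] csize_bool[of "snd s \<and> fst s \<noteq> [] \<and> (hd (fst s) = h)"] by (cases s) simp
  qed (intro polyf_intros poly_bounded_intros assms)+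
  then have "polyf (\<lambda>x. snd (?r x) \<and> fst (?r x) = [])" by (intro polyf_intros)
  moreover have "(snd (foldl ?G (ys, b) xs) \<and> fst (foldl ?G (ys, b) xs) = []) \<longleftrightarrow> b \<and> xs = ys" for ys b xs
  proof (induction xs arbitrary: ys b)
    case (Cons a xs)
    then show ?case by (cases ys) auto
  qed auto
  ultimately show ?thesis by simp
qed

text \<open>An automaton with three components: whether a marker has just been read, the current
  word reversed, and the finished words in reverse order. It is defined on every input, including
  those that are not tuple codes.\<close>

definition undelim_step :: "bool \<times> bool list \<times> bool list list \<Rightarrow> bool \<Rightarrow> bool \<times> bool list \<times> bool list list" where
  "undelim_step s b =
    (if fst s then (False, b # fst (snd s), snd (snd s))
     else if b then (True, snd s)
     else (False, [], rev (fst (snd s)) # snd (snd s)))"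

definition undelim :: "bool list \<Rightarrow> bool list list" where
  "undelim v = rev (snd (snd (foldl undelim_step (False, [], []) v)))"

lemma undelim_tuple_code [simp]: "undelim (tuple_code ws) = ws"
proof -
  have bits: "foldl undelim_step (False, u, us) (concat (map (\<lambda>b. [True, b]) w)) = (False, rev w @ u, us)" for w u us
    by (induction w arbitrary: u) (auto simp: undelim_step_def)
  have "foldl undelim_step (False, [], us) (tuple_code ws) = (False, [], rev ws @ us)" for us
    by (induction ws arbitrary: us) (auto simp: tuple_code_def delim_def bits undelim_step_def)
  then show ?thesis by (simp add: undelim_def)
qed

lemma csize_rev [simp]: "csize (rev xs) = csize xs"
proof (induction xs)
  case (Cons x xs)
  then show ?case using csize_append[of "rev xs" "[x]"] by simp
qed simp

lemma polyf_undelim [polyf_intros]: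
  assumes "polyf f"
  shows "polyf (\<lambda>x. undelim (f x))"
proof -
  have "polyf (\<lambda>x. foldl (\<lambda>s b. undelim_step s b) (False, [], []) (f x))"
  proof (rule polyf_foldl_csize[where B = "\<lambda>n. n + 5"])
    show "csize (undelim_step s h) \<le> csize s + (csize x + csize h + 5)" for s h x
      using csize_bool[of "fst s"] by (cases s) (auto simp: undelim_step_def)
    show "polyf (\<lambda>p. undelim_step (snd (snd p)) (fst (snd p)))"
      unfolding undelim_step_def by (intro polyf_intros)
  qed (intro polyf_intros poly_bounded_intros assms)+
  then show ?thesis unfolding undelim_def by (intro polyf_intros)
qed

lemma polyf_delim [polyf_intros]: "polyf f \<Longrightarrow> polyf (\<lambda>x. delim (f x))"
  unfolding delim_def by (intro polyf_intros)

section \<open>Arithmetic on binary numbers\<close>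

instantiation nat :: coded
begin
definition "tree_of n = tree_of (binary n)"
instance ..
end

lemma word_nat: "word (n :: nat) = word (binary n)"
  by (simp add: word_def tree_of_nat_def)

text \<open>Unlike the range of \<open>binary\<close>, arguments with leading zeros are allowed, so
  every word of a certificate denotes a number.\<close>

fun val :: "bool list \<Rightarrow> nat" where
  "val [] = 0"
| "val (b # l) = of_bool b + 2 * val l"

lemma binary_0 [simp]: "binary 0 = []"
  by (simp add: binary.simps)

lemma binary_pos: "n > 0 \<Longrightarrow> binary n = odd n # binary (n div 2)"
  by (subst binary.simps) simp

lemma binary_eq_Nil_iff [simp]: "binary n = [] \<longleftrightarrow> n = 0"
  by (cases "n = 0") (simp_all add: binary_pos)

lemma val_binary [simp]: "val (binary n) = n"
proof (induction n rule: less_induct)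
  case (less n)
  then show ?case by (cases "n = 0") (auto simp: binary_pos odd_iff_mod_2_eq_one)
qed

lemma binary_bit: "binary (of_bool b + 2 * n) = (if n = 0 \<and> \<not> b then [] else b # binary n)"
  by (auto simp: binary_pos)

lemma tl_binary: "tl (binary n) = binary (n div 2)"
  by (cases "n = 0") (auto simp: binary_pos)

lemma hd_binary: "n > 0 \<Longrightarrow> hd (binary n) = odd n"
  by (simp add: binary_pos)

lemma less_power_length_binary: "n < 2 ^ length (binary n)"
proof (induction n rule: less_induct)
  case (less n)
  show ?case
  proof (cases "n = 0")
    case False
    then have "n div 2 < 2 ^ length (binary (n div 2))" using less by simp
    then show ?thesis using False by (simp add: binary_pos)
  qed simp
qed

lemma length_binary_le: "n < 2 ^ k \<Longrightarrow> length (binary n) \<le> k"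
proof (induction k arbitrary: n)
  case (Suc k)
  then show ?case using Suc.IH[of "n div 2"] by (cases "n = 0") (auto simp: binary_pos)
qed simp

lemma length_binary_mono: "m \<le> n \<Longrightarrow> length (binary m) \<le> length (binary n)"
  using length_binary_le less_power_length_binary order_le_less_trans by blast

lemma length_binary_add: "length (binary (m + n)) \<le> length (binary m) + length (binary n) + 1"
proof (rule length_binary_le)
  have "m < 2 ^ (length (binary m) + length (binary n))" "n < 2 ^ (length (binary m) + length (binary n))"
    using less_power_length_binary[of m] less_power_length_binary[of n]
    by (auto intro: order.strict_trans2 power_increasing)
  then show "m + n < 2 ^ (length (binary m) + length (binary n) + 1)" by simp
qed

lemma csize_bits: "length l \<le> csize (l :: bool list)" "csize (l :: bool list) \<le> 4 * length l + 4"
proof -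
  show "length l \<le> csize l" using csize_list_pos[of l] by simp
  show "csize l \<le> 4 * length l + 4"
  proof (induction l)
    case (Cons b l)
    then show ?case using csize_bool[of b] by simp
  qed simp
qed

lemma csize_nat: "length (binary n) \<le> csize n" "csize n \<le> 4 * length (binary n) + 4"
  unfolding word_nat by (rule csize_bits)+

lemma polyf_binary [polyf_intros]: "polyf f \<Longrightarrow> polyf (\<lambda>x. binary (f x))"
  by (erule polyf_cong_tree) (simp add: tree_of_nat_def)

text \<open>Numbers are coded by their canonical digits, so only leading zeros have to be stripped:
  reading from the most significant digit, a zero put onto an empty result is dropped.\<close>

lemma polyf_val [polyf_intros]:
  assumes "polyf f"
  shows "polyf (\<lambda>x. val (f x))"
proof (rule polyf_cong_tree)
  show "polyf (\<lambda>x. foldl (\<lambda>a b. if a = [] \<and> \<not> b then [] else b # a) [] (rev (f x)))"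
    by (rule polyf_foldl_csize[where B = "\<lambda>n. n + 5"]) (intro polyf_intros poly_bounded_intros assms | simp)+
  have "binary (val l) = foldl (\<lambda>a b. if a = [] \<and> \<not> b then [] else b # a) [] (rev l)" for l
    by (induction l) (auto simp: binary_bit simp del: of_bool_eq of_bool_def)
  then show "tree_of (val (f x)) = tree_of (foldl (\<lambda>a b. if a = [] \<and> \<not> b then [] else b # a) [] (rev (f x)))" for x
    by (simp add: tree_of_nat_def)
qed

lemma polyf_half [polyf_intros]: "polyf f \<Longrightarrow> polyf (\<lambda>x. (f x :: nat) div 2)"
  by (rule polyf_cong_tree[OF polyf_tl[OF polyf_binary]]) (auto simp: tree_of_nat_def tl_binary)

lemma polyf_odd [polyf_intros]:
  assumes "polyf f"
  shows "polyf (\<lambda>x. odd (f x :: nat))"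
proof (rule polyf_cong)
  show "polyf (\<lambda>x. binary (f x) \<noteq> [] \<and> hd (binary (f x)))" by (intro polyf_intros assms)
  show "odd (f x) \<longleftrightarrow> binary (f x) \<noteq> [] \<and> hd (binary (f x))" for x
    by (cases "f x = 0") (simp_all add: hd_binary)
qed

lemma csize_half: "csize (n div 2 :: nat) \<le> csize n"
proof -
  have "csize (tl l) \<le> csize l" for l :: "bool list" by (cases l) auto
  from this[of "binary n"] show ?thesis by (simp add: word_nat tl_binary)
qed

lemma nat_bit_cases:
  fixes n :: nat
  obtains m where "n = 2 * m" | m where "n = 2 * m + 1"
  using that by (meson evenE oddE)

text \<open>Comparison and addition run from the least significant bit upwards; the list only counts the
  steps.\<close>

definition le_step :: "nat \<times> nat \<times> bool \<Rightarrow> bool \<Rightarrow> nat \<times> nat \<times> bool" where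
  "le_step s h = (fst s div 2, fst (snd s) div 2,
     if odd (fst s) = odd (fst (snd s)) then snd (snd s) else odd (fst (snd s)))"

text \<open>The loop invariant: the higher digits not yet read decide, and the flag, which stands
  for the digits already read, breaks ties. It starts as \<open>True\<close> because equal numbers
  satisfy \<open>\<le>\<close>.\<close>

definition le_result :: "nat \<times> nat \<times> bool \<Rightarrow> bool" where
  "le_result s \<longleftrightarrow> fst s < fst (snd s) \<or> fst s = fst (snd s) \<and> snd (snd s)"

lemma le_result_step: "le_result (le_step s h) = le_result s"
proof -
  obtain m n c where s: "s = (m, n, c)" by (cases s)
  show ?thesis
    by (cases m rule: nat_bit_cases; cases n rule: nat_bit_cases) (auto simp: s le_result_def le_step_def)
qed

lemma foldl_le_step:
  "le_result (foldl le_step s l) = le_result s"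
  "fst (foldl le_step s l) = fst s div 2 ^ length l"
  "fst (snd (foldl le_step s l)) = fst (snd s) div 2 ^ length l"
  by (induction l arbitrary: s) (auto simp: le_result_step, simp_all add: le_step_def div_mult2_eq)

lemma less_power_length_binary_append:
  "m < 2 ^ length (binary m @ binary n)" "n < 2 ^ length (binary m @ binary n)"
  using less_power_length_binary[of m] less_power_length_binary[of n]
  by (auto intro: order.strict_trans2 power_increasing)

lemma polyf_le [polyf_intros]:
  assumes "polyf f" "polyf g"
  shows "polyf (\<lambda>x. (f x :: nat) \<le> g x)"
proof -
  \<comment> \<open>The two digit strings together are at least as long as either, so after that
    many halvings both remainders are 0.\<close>
  let ?l = "\<lambda>x. binary (f x) @ binary (g x)"
  let ?r = "\<lambda>x. foldl (\<lambda>s h. le_step s h) (f x, g x, True) (?l x)"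
  have "polyf ?r"
  proof (rule polyf_foldl_csize[where B = "\<lambda>n. 3"])
    show "csize (le_step s h) \<le> csize s + 3" for s h
      using csize_half[of "fst s"] csize_half[of "fst (snd s)"] csize_bool[of "odd (fst (snd s))"]
      by (cases s) (auto simp: le_step_def)
    show "polyf (\<lambda>p. le_step (snd (snd p)) (fst (snd p)))"
      unfolding le_step_def by (intro polyf_intros)
  qed (intro polyf_intros poly_bounded_intros assms)+
  then have "polyf (\<lambda>x. snd (snd (?r x)))" by (intro polyf_intros)
  moreover have "snd (snd (?r x)) \<longleftrightarrow> f x \<le> g x" for x
  proof -
    have "le_result (?r x) \<longleftrightarrow> f x \<le> g x"
      by (simp only: foldl_le_step) (auto simp: le_result_def)
    moreover have "fst (?r x) = 0" "fst (snd (?r x)) = 0"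
      unfolding foldl_le_step using less_power_length_binary_append[of "f x" "g x"]
        less_power_length_binary_append[of "g x" "f x"] by (simp_all only: fst_conv snd_conv div_less)
    ultimately show ?thesis by (simp add: le_result_def)
  qed
  ultimately show ?thesis by simp
qed

lemma polyf_less [polyf_intros]: "polyf f \<Longrightarrow> polyf g \<Longrightarrow> polyf (\<lambda>x. (f x :: nat) < g x)"
  unfolding not_le[symmetric] by (intro polyf_intros)

lemma polyf_nat_eq [polyf_intros]: "polyf f \<Longrightarrow> polyf g \<Longrightarrow> polyf (\<lambda>x. (f x :: nat) = g x)"
  unfolding order_eq_iff by (intro polyf_intros)

lemma val_append: "val (xs @ ys) = val xs + 2 ^ length xs * val ys"
  by (induction xs) (auto simp: algebra_simps)

text \<open>Components: what remains of both summands, the carry, and the digits produced so far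
  with the newest first. The new carry is the majority of the two digits and the old carry; nested
  equality of Booleans is their sum modulo 2.\<close>

definition add_step :: "nat \<times> nat \<times> bool \<times> bool list \<Rightarrow> bool \<Rightarrow> nat \<times> nat \<times> bool \<times> bool list" where
  "add_step s h = (fst s div 2, fst (snd s) div 2,
     (if odd (fst s) = odd (fst (snd s)) then odd (fst s) else fst (snd (snd s))),
     ((odd (fst s) = odd (fst (snd s))) = fst (snd (snd s))) # snd (snd (snd s)))"

text \<open>The loop invariant: the total that the state stands for. It is preserved by every
  round.\<close>

definition add_result :: "nat \<times> nat \<times> bool \<times> bool list \<Rightarrow> nat" where
  "add_result s = val (rev (snd (snd (snd s)))) +
     2 ^ length (snd (snd (snd s))) * (fst s + fst (snd s) + of_bool (fst (snd (snd s))))"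

lemma add_result_step: "add_result (add_step s h) = add_result s"
proof -
  obtain m n c l where s: "s = (m, n, c, l)" by (cases s)
  show ?thesis
    by (cases m rule: nat_bit_cases; cases n rule: nat_bit_cases; cases c)
      (auto simp: s add_result_def add_step_def val_append algebra_simps)
qed

lemma foldl_add_step:
  "add_result (foldl add_step s l) = add_result s"
  "fst (foldl add_step s l) = fst s div 2 ^ length l"
  "fst (snd (foldl add_step s l)) = fst (snd s) div 2 ^ length l"
  by (induction l arbitrary: s) (auto simp: add_result_step, simp_all add: add_step_def div_mult2_eq)

lemma polyf_add [polyf_intros]:
  assumes "polyf f" "polyf g"
  shows "polyf (\<lambda>x. (f x :: nat) + g x)"
proof -
  let ?l = "\<lambda>x. binary (f x) @ binary (g x)"
  let ?r = "\<lambda>x. foldl (\<lambda>s h. add_step s h) (f x, g x, False, []) (?l x)"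
  have "polyf ?r"
  proof (rule polyf_foldl_csize[where B = "\<lambda>n. 10"])
    show "csize (add_step s h) \<le> csize s + 10" for s h
    proof -
      obtain m n c l where s: "s = (m, n, c, l)" by (cases s)
      show ?thesis using csize_half[of m] csize_half[of n]
        csize_bool[of c] csize_bool[of "odd n"] csize_bool[of "\<not> c"]
        by (simp add: s add_step_def del: One_nat_def)
    qed
    show "polyf (\<lambda>p. add_step (snd (snd p)) (fst (snd p)))"
      unfolding add_step_def by (intro polyf_intros)
  qed (intro polyf_intros poly_bounded_intros assms)+
  \<comment> \<open>The last carry becomes the most significant digit.\<close>
  then have "polyf (\<lambda>x. val (rev (fst (snd (snd (?r x))) # snd (snd (snd (?r x))))))" by (intro polyf_intros)
  moreover have "val (rev (fst (snd (snd (?r x))) # snd (snd (snd (?r x))))) = f x + g x" for x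
  proof -
    have "add_result (?r x) = f x + g x"
      by (simp only: foldl_add_step) (simp add: add_result_def)
    moreover have "fst (?r x) = 0" "fst (snd (?r x)) = 0"
      unfolding foldl_add_step using less_power_length_binary_append[of "f x" "g x"]
        less_power_length_binary_append[of "g x" "f x"] by (simp_all only: fst_conv snd_conv div_less)
    ultimately show ?thesis by (simp add: add_result_def val_append)
  qed
  ultimately show ?thesis by simp
qed

lemmas polyf_foldl_nat = polyf_foldl_additive[where \<mu> = "\<lambda>n. length (binary n)" and C = 4, OF _ _ _ _ csize_nat]

text \<open>Horner's scheme over the digits of \<open>f x\<close>, highest first. The bound treats
  every round as adding the bit length of \<open>g x\<close> plus 2; this is crude, but the growth
  is additive, which is all that the fold rule asks for.\<close>

lemma polyf_mult [polyf_intros]: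
  assumes "polyf f" "polyf g"
  shows "polyf (\<lambda>x. (f x :: nat) * g x)"
proof -
  have "polyf (\<lambda>x. foldl (\<lambda>a b. a + a + (if b then g x else 0)) 0 (rev (binary (f x))))"
  proof -
    obtain q where q: "\<And>x. csize (g x) \<le> poly q (csize x)" using assms(2) by (elim polyf_size) blast
    show ?thesis
    proof (rule polyf_foldl_nat[where B = "\<lambda>n. poly q n + 2"])
      show "polyf (\<lambda>p. snd (snd p) + snd (snd p) + (if fst (snd p) then g (fst p) else 0))"
        by (intro polyf_intros polyf_comp[OF assms(2)])
      show "length (binary (a + a + (if h then g x else 0))) \<le> length (binary a) + (poly q (csize x + csize h) + 2)" for a x h
      proof -
        have "length (binary (a + a)) \<le> length (binary a) + 1"
          using less_power_length_binary[of a] by (intro length_binary_le) simp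
        moreover have "length (binary (if h then g x else 0)) \<le> poly q (csize x + csize h)"
          using csize_nat(1)[of "g x"] q[of x] poly_nat_mono[of "csize x" "csize x + csize h" q] by auto
        ultimately show ?thesis using length_binary_add[of "a + a" "if h then g x else 0"] by linarith
      qed
    qed (intro polyf_intros poly_bounded_intros assms)+
  qed
  moreover have "foldl (\<lambda>a b. a + a + (if b then n else 0)) 0 (rev l) = val l * n" for l and n :: nat
    by (induction l) (auto simp: algebra_simps)
  ultimately show ?thesis by simp
qed

lemma polyf_sum_list [polyf_intros]:
  assumes "polyf f"
  shows "polyf (\<lambda>x. sum_list (f x :: nat list))"
proof -
  have "polyf (\<lambda>x. foldl (\<lambda>a h. a + h) 0 (f x))"
  proof (rule polyf_foldl_nat[where B = "\<lambda>n. n + 1"])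
    show "length (binary (a + h)) \<le> length (binary a) + (csize x + csize h + 1)" for a h x
      using length_binary_add[of a h] csize_nat(1)[of h] by simp
  qed (intro polyf_intros poly_bounded_intros assms)+
  moreover have "foldl (\<lambda>a h. a + h) n l = n + sum_list l" for n :: nat and l
    by (induction l arbitrary: n) auto
  ultimately show ?thesis by simp
qed

lemma polyf_length [polyf_intros]:
  assumes "polyf f"
  shows "polyf (\<lambda>x. length (f x))"
proof -
  have "polyf (\<lambda>x. sum_list (map (\<lambda>_. 1 :: nat) (f x)))" by (intro polyf_intros assms)
  then show ?thesis by (simp add: sum_list_triv)
qed

lemma length_binary_le_self: "length (binary n) \<le> n"
  by (rule length_binary_le) (rule less_exp)

text \<open>The range is bounded by the length of a list rather than by a number: for a binary
  number the result could be exponentially long. This is why a certificate gives dimensions as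
  lengths of words.\<close>

lemma polyf_upt [polyf_intros]:
  assumes "polyf f"
  shows "polyf (\<lambda>x. [0..<length (f x)])"
proof -
  let ?G = "\<lambda>(s :: nat \<times> nat list) h. (fst s + 1, fst s # snd s)"
  obtain q where q: "\<And>x. csize (f x) \<le> poly q (csize x)" using assms by (elim polyf_size) blast
  have fold: "foldl ?G (0, []) l = (length l, rev [0..<length l])" for l :: "'b list"
    by (induction l rule: rev_induct) auto
  have upt: "csize [0..<n] \<le> 1 + n * (5 + 4 * n)" for n :: nat
  proof (induction n)
    case (Suc n)
    have "csize n \<le> 4 * n + 4" using csize_nat(2)[of n] length_binary_le_self[of n] by linarith
    then show ?case using Suc csize_append[of "[0..<n]" "[n]"] by (simp add: algebra_simps)
  qed simp
  have "polyf (\<lambda>x. foldl ?G (0, []) (f x))"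
  \<comment> \<open>A round adds the counter itself, whose size is not bounded by that of the list
    element, so an absolute bound on the prefixes replaces the additive one.\<close>
  proof (rule polyf_foldl[where B = "\<lambda>n. 1 + (4 * poly q n + 4) + (1 + poly q n * (5 + 4 * poly q n))"])
    fix x n assume n: "n \<le> length (f x)"
    have n: "n \<le> poly q (csize x)" using n q[of x] csize_list_pos[of "f x"] by linarith
    have "csize (n :: nat) \<le> 4 * poly q (csize x) + 4"
      using csize_nat(2)[of n] length_binary_le_self[of n] n by linarith
    moreover have "n * (5 + 4 * n) \<le> poly q (csize x) * (5 + 4 * poly q (csize x))"
      using n by (intro mult_mono) auto
    with upt[of n] have "csize [0..<n] \<le> 1 + poly q (csize x) * (5 + 4 * poly q (csize x))"
      by linarith
    ultimately show "csize (foldl ?G (0, []) (take n (f x))) \<le>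
        1 + (4 * poly q (csize x) + 4) + (1 + poly q (csize x) * (5 + 4 * poly q (csize x)))"
      unfolding fold using \<open>n \<le> length (f x)\<close> by (simp add: min_absorb2)
  qed (intro polyf_intros poly_bounded_intros assms)+
  then have "polyf (\<lambda>x. rev (snd (foldl ?G (0, []) (f x))))" by (intro polyf_intros)
  then show ?thesis unfolding fold by simp
qed

text \<open>The default keeps the verifier meaningful on words that are not well-formed
  certificates.\<close>

definition get :: "'a \<Rightarrow> 'a list \<Rightarrow> nat \<Rightarrow> 'a" where
  "get d xs n = (if n < length xs then xs ! n else d)"

lemma polyf_get [polyf_intros]:
  assumes "polyf f" "polyf n"
  shows "polyf (\<lambda>x. get d (f x) (n x))"
proof -
  let ?G = "\<lambda>x (s :: nat \<times> 'b) h. (fst s + 1, if fst s = n x then h else snd s)"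
  have "polyf (\<lambda>x. foldl (\<lambda>s h. ?G x s h) (0, d) (f x))"
  proof (rule polyf_foldl_additive[where \<mu> = "\<lambda>s. length (binary (fst s)) + csize (snd s)" and C = 5 and B = "\<lambda>n. n + 1"])
    show "length (binary (fst s)) + csize (snd s) \<le> csize s" for s :: "nat \<times> 'b"
      using csize_nat(1)[of "fst s"] by (cases s) simp
    show "csize s \<le> 5 * (length (binary (fst s)) + csize (snd s)) + 5" for s :: "nat \<times> 'b"
      using csize_nat(2)[of "fst s"] by (cases s) simp
    show "length (binary (fst (?G x s h))) + csize (snd (?G x s h)) \<le>
        length (binary (fst s)) + csize (snd s) + (csize x + csize h + 1)" for x h s
      using csize_pos[of x] length_binary_add[of "fst s" 1] by (auto simp: binary_pos)
  qed (intro polyf_intros polyf_comp[OF assms(2)] poly_bounded_intros assms)+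
  then have "polyf (\<lambda>x. snd (foldl (\<lambda>s h. ?G x s h) (0, d) (f x)))" by (intro polyf_intros)
  moreover have "foldl (\<lambda>s h. ?G x s h) (0, d) l = (length l, get d l (n x))" for x l
    by (induction l rule: rev_induct) (auto simp: get_def nth_append)
  ultimately show ?thesis by simp
qed

section \<open>Basic solutions of systems of inequalities\<close>

definition satisfies :: "(real vec \<times> real) set \<Rightarrow> real vec \<Rightarrow> bool" where
  "satisfies F x \<longleftrightarrow> (\<forall>(g, b) \<in> F. g \<bullet> x \<le> b)"

text \<open>Moves along the direction that keeps all rows of \<open>M\<close> but the \<open>k\<close>-th constant until a new
  constraint becomes tight. Its row has a nonzero product with that direction, so putting it in the
  place of row \<open>k\<close> keeps the matrix regular.\<close>

lemma exchange_row:
  fixes M :: "real mat" and F :: "(real vec \<times> real) set"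
  assumes F: "finite F" "F \<subseteq> carrier_vec n \<times> UNIV"
    and bounded: "\<forall>d \<in> carrier_vec n. d \<noteq> 0\<^sub>v n \<longrightarrow> (\<exists>(g, b) \<in> F. g \<bullet> d > 0)"
    and k: "k < n" and M: "M \<in> carrier_mat n n" "det M \<noteq> 0"
    and x: "x \<in> carrier_vec n" "satisfies F x"
    and tight: "\<forall>i<k. (row M i, row M i \<bullet> x) \<in> F"
  obtains x' M' where "M' \<in> carrier_mat n n" "det M' \<noteq> 0" "x' \<in> carrier_vec n" "satisfies F x'"
    "\<forall>i<Suc k. (row M' i, row M' i \<bullet> x') \<in> F"
proof -
  \<comment> \<open>Column \<open>k\<close> of the inverse of \<open>M\<close>, written with the
    adjugate.\<close>
  define d where "d = (1 / det M) \<cdot>\<^sub>v (adj_mat M *\<^sub>v unit_vec n k)"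
  note adj = adj_mat[OF M(1)]
  have d: "d \<in> carrier_vec n" using adj(1) by (simp add: d_def)
  have Md: "M *\<^sub>v d = unit_vec n k"
  proof -
    have "M *\<^sub>v d = (1 / det M) \<cdot>\<^sub>v (M *\<^sub>v (adj_mat M *\<^sub>v unit_vec n k))"
      unfolding d_def using M adj by (intro mult_mat_vec) auto
    also have "M *\<^sub>v (adj_mat M *\<^sub>v unit_vec n k) = (M * adj_mat M) *\<^sub>v unit_vec n k"
      using assoc_mult_mat_vec[OF M(1) adj(1) unit_vec_carrier] by simp
    also have "\<dots> = det M \<cdot>\<^sub>v unit_vec n k"
      unfolding adj(2) by (intro eq_vecI) (auto simp: k)
    finally show ?thesis using M(2) by (simp add: smult_smult_assoc)
  qed
  have row_d: "row M i \<bullet> d = (if i = k then 1 else 0)" if "i < n" for i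
    using arg_cong[OF Md, of "\<lambda>v. v $ i"] that k M(1) by simp
  have "d \<noteq> 0\<^sub>v n"
    using row_d[OF k] k M(1) by auto
  then obtain g1 b1 where g1: "(g1, b1) \<in> F" "g1 \<bullet> d > 0" using bounded d by blast
  \<comment> \<open>The ratio test of the simplex method: only constraints that grow along
    \<open>d\<close> limit the move. Boundedness guarantees that there is one, and the smallest
    ratio \<open>t\<close> is the longest feasible move.\<close>
  define G where "G = {p \<in> F. fst p \<bullet> d > 0}"
  define ratio where "ratio p = (snd p - fst p \<bullet> x) / (fst p \<bullet> d)" for p
  define t where "t = Min (ratio ` G)"
  have G: "finite G" "G \<noteq> {}" using F g1 by (auto simp: G_def)
  then have "t \<in> ratio ` G" unfolding t_def by (intro Min_in) auto
  then obtain g0 b0 where g0: "(g0, b0) \<in> F" "g0 \<bullet> d > 0" "t = ratio (g0, b0)"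
    by (auto simp: G_def)
  have t_le: "t \<le> ratio p" if "p \<in> G" for p unfolding t_def using G that by simp
  have "t \<ge> 0" using g0 x(2) by (auto simp: ratio_def satisfies_def)
  define x' where "x' = x + t \<cdot>\<^sub>v d"
  have x': "x' \<in> carrier_vec n" using x d by (simp add: x'_def)
  have prod_x': "g \<bullet> x' = g \<bullet> x + t * (g \<bullet> d)" if "g \<in> carrier_vec n" for g
    unfolding x'_def using that x d by (simp add: scalar_prod_add_distrib)
  have "satisfies F x'"
    unfolding satisfies_def
  proof clarify
    fix g b assume gb: "(g, b) \<in> F"
    then have g: "g \<in> carrier_vec n" using F(2) by auto
    have le: "g \<bullet> x \<le> b" using gb x(2) by (auto simp: satisfies_def)
    show "g \<bullet> x' \<le> b"
    proof (cases "g \<bullet> d > 0")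
      case True
      then have "t \<le> (b - g \<bullet> x) / (g \<bullet> d)" using t_le[of "(g, b)"] gb by (auto simp: G_def ratio_def)
      then show ?thesis using True prod_x'[OF g] by (simp add: field_simps)
    next
      case False
      then have "t * (g \<bullet> d) \<le> 0" using \<open>t \<ge> 0\<close> by (simp add: mult_nonneg_nonpos)
      then show ?thesis using le prod_x'[OF g] by simp
    qed
  qed
  have g0c: "g0 \<in> carrier_vec n" using F g0 by auto
  have g0_tight: "g0 \<bullet> x' = b0" using prod_x'[OF g0c] g0 by (simp add: ratio_def)
  define M' where "M' = mat n n (\<lambda>(i, j). if i = k then g0 $ j else M $$ (i, j))"
  have M': "M' \<in> carrier_mat n n" by (simp add: M'_def)
  have row_k: "row M' k = g0" using g0c k by (auto simp: M'_def)
  have row_i: "row M' i = row M i" if "i < n" "i \<noteq> k" for i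
    using that M(1) by (auto simp: M'_def)
  have "det M' \<noteq> 0"
  proof
    assume "det M' = 0"
    then obtain v where v: "v \<in> carrier_vec n" "v \<noteq> 0\<^sub>v n" "M' *\<^sub>v v = 0\<^sub>v n"
      using det_0_iff_vec_prod_zero_field[OF M'] by auto
    have row_v: "row M' i \<bullet> v = 0" if "i < n" for i
      using arg_cong[OF v(3), of "\<lambda>v. v $ i"] that M' by simp
    \<comment> \<open>A kernel vector \<open>v\<close> of \<open>M'\<close> annihilates all old rows
      but row \<open>k\<close>, so it must be the multiple \<open>c\<close> of \<open>d\<close>. The
      new row gives \<open>c * (g0 \<bullet> d) = 0\<close>, hence \<open>c = 0\<close> and
      \<open>v\<close> vanishes.\<close>
    define c where "c = row M k \<bullet> v"
    have cd: "c \<cdot>\<^sub>v d \<in> carrier_vec n" using d by simp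
    have "M *\<^sub>v (v - c \<cdot>\<^sub>v d) = 0\<^sub>v n"
    proof (rule eq_vecI)
      fix i assume "i < dim_vec (0\<^sub>v n :: real vec)"
      then have i: "i < n" by simp
      have rc: "row M i \<in> carrier_vec n" using M(1) by (auto simp: row_def)
      have "row M i \<bullet> (v - c \<cdot>\<^sub>v d) = row M i \<bullet> v - c * (row M i \<bullet> d)"
        using scalar_prod_minus_distrib[OF rc v(1) cd] rc d by simp
      also have "\<dots> = 0" using row_d[OF i] row_v[OF i] row_i[OF i] by (cases "i = k") (auto simp: c_def)
      finally show "(M *\<^sub>v (v - c \<cdot>\<^sub>v d)) $ i = 0\<^sub>v n $ i" using i M(1) by simp
    qed (use M in auto)
    then have "v - c \<cdot>\<^sub>v d = 0\<^sub>v n"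
      using det_0_iff_vec_prod_zero_field[OF M(1)] M(2) v(1) cd minus_carrier_vec by blast
    have "v $ i = (c \<cdot>\<^sub>v d) $ i" if "i < n" for i
      using arg_cong[OF \<open>v - c \<cdot>\<^sub>v d = 0\<^sub>v n\<close>, of "\<lambda>v. v $ i"] that v(1) cd by auto
    then have vcd: "v = c \<cdot>\<^sub>v d" using v(1) cd by (intro eq_vecI) auto
    have "c * (g0 \<bullet> d) = 0" using row_v[OF k] row_k g0c d vcd by simp
    then have "c = 0" using g0(2) by simp
    then show False using v(2) vcd d by auto
  qed
  moreover have "(row M' i, row M' i \<bullet> x') \<in> F" if "i < Suc k" for i
  proof (cases "i = k")
    case True
    then show ?thesis using row_k g0_tight g0(1) by simp
  next
    case False
    then have "i < k" "i < n" using that k by auto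
    moreover have "row M i \<in> carrier_vec n" using M(1) by (auto simp: row_def)
    ultimately show ?thesis using tight row_i[of i] row_d[of i] prod_x'[of "row M i"] by simp
  qed
  ultimately show thesis using that M' x' \<open>satisfies F x'\<close> by blast
qed

text \<open>The exchange starts from the identity matrix. Rows that have not been exchanged yet are
  mere placeholders that keep the matrix regular; after \<open>n\<close> rounds all rows come from
  tight constraints.\<close>

lemma exists_basic_solution:
  fixes F :: "(real vec \<times> real) set"
  assumes F: "finite F" "F \<subseteq> carrier_vec n \<times> UNIV"
    and bounded: "\<forall>d \<in> carrier_vec n. d \<noteq> 0\<^sub>v n \<longrightarrow> (\<exists>(g, b) \<in> F. g \<bullet> d > 0)"
    and x: "x \<in> carrier_vec n" "satisfies F x"
  obtains x' M where "M \<in> carrier_mat n n" "det M \<noteq> 0" "x' \<in> carrier_vec n" "satisfies F x'"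
    "\<forall>i<n. (row M i, row M i \<bullet> x') \<in> F"
proof -
  have "\<exists>x' M. M \<in> carrier_mat n n \<and> det M \<noteq> 0 \<and> x' \<in> carrier_vec n \<and> satisfies F x' \<and>
      (\<forall>i<k. (row M i, row M i \<bullet> x') \<in> F)" if "k \<le> n" for k
    using that
  proof (induction k)
    case 0
    show ?case by (intro exI[of _ x] exI[of _ "1\<^sub>m n"]) (use x in auto)
  next
    case (Suc k)
    then obtain y M where "M \<in> carrier_mat n n" "det M \<noteq> 0" "y \<in> carrier_vec n" "satisfies F y"
      "\<forall>i<k. (row M i, row M i \<bullet> y) \<in> F" by auto
    from exchange_row[OF F bounded _ this] Suc.prems show ?case by (metis Suc_le_lessD)
  qed
  from this[of n] that show thesis by auto
qed

section \<open>Integrality and size of determinants\<close>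

lemma det_Ints:
  fixes M :: "real mat"
  assumes "M \<in> carrier_mat n n" "\<And>i j. i < n \<Longrightarrow> j < n \<Longrightarrow> M $$ (i, j) \<in> \<int>"
  shows "det M \<in> \<int>"
  unfolding det_def'[OF assms(1)]
proof (intro Ints_sum Ints_mult Ints_prod)
  fix p i assume "p \<in> {p. p permutes {0..<n}}" "i \<in> {0..<n}"
  then show "M $$ (i, p i) \<in> \<int>" using assms(2)[of i "p i"] permutes_in_image[of p "{0..<n}" i] by auto
qed (auto simp: sign_def)

text \<open>Leibniz' formula has \<open>n!\<close> terms, each a product of \<open>n\<close>
  entries. This crude estimate already has polynomially many bits.\<close>

lemma abs_det_le:
  fixes M :: "real mat"
  assumes "M \<in> carrier_mat n n" "\<And>i j. i < n \<Longrightarrow> j < n \<Longrightarrow> \<bar>M $$ (i, j)\<bar> \<le> K"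
  shows "\<bar>det M\<bar> \<le> fact n * K ^ n"
proof -
  have "\<bar>det M\<bar> \<le> (\<Sum>p | p permutes {0..<n}. \<bar>signof p * (\<Prod>i = 0..<n. M $$ (i, p i))\<bar>)"
    unfolding det_def'[OF assms(1)] by (rule sum_abs)
  also have "\<dots> \<le> (\<Sum>p | p permutes {0..<n}. K ^ n)"
  proof (rule sum_mono)
    fix p assume p: "p \<in> {p. p permutes {0..<n}}"
    have "\<bar>signof p * (\<Prod>i = 0..<n. M $$ (i, p i))\<bar> = (\<Prod>i = 0..<n. \<bar>M $$ (i, p i)\<bar>)"
      by (simp add: abs_mult abs_prod sign_def)
    also have "\<dots> \<le> (\<Prod>i = 0..<n. K)"
      by (rule prod_mono) (use assms(2) p permutes_in_image[of p "{0..<n}"] in auto)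
    finally show "\<bar>signof p * (\<Prod>i = 0..<n. M $$ (i, p i))\<bar> \<le> K ^ n" by simp
  qed
  also have "\<dots> = fact n * K ^ n"
    by (simp add: card_permutations)
  finally show ?thesis .
qed

lemma exists_small_rational_solution:
  fixes F :: "(real vec \<times> real) set"
  assumes F: "finite F" "F \<subseteq> carrier_vec n \<times> UNIV"
    and int: "\<forall>(g, b) \<in> F. b \<in> \<int> \<and> (\<forall>j<n. g $ j \<in> \<int> \<and> \<bar>g $ j\<bar> \<le> K)"
    and bounded: "\<forall>d \<in> carrier_vec n. d \<noteq> 0\<^sub>v n \<longrightarrow> (\<exists>(g, b) \<in> F. g \<bullet> d > 0)"
    and x: "x \<in> carrier_vec n" "satisfies F x"
  obtains x' and D :: nat where "x' \<in> carrier_vec n" "satisfies F x'" "D > 0"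
    "real D \<le> fact n * K ^ n" "\<And>j. j < n \<Longrightarrow> x' $ j * real D \<in> \<int>"
proof -
  obtain x' M where M: "M \<in> carrier_mat n n" "det M \<noteq> 0" and x': "x' \<in> carrier_vec n" "satisfies F x'"
    and "\<forall>i<n. (row M i, row M i \<bullet> x') \<in> F"
    using exists_basic_solution[OF F bounded x] by blast
  then have tight: "\<And>i. i < n \<Longrightarrow> (row M i, row M i \<bullet> x') \<in> F" by blast
  have entry: "M $$ (i, j) \<in> \<int> \<and> \<bar>M $$ (i, j)\<bar> \<le> K" if "i < n" "j < n" for i j
    using bspec[OF int tight[OF that(1)]] that M(1) by simp
  have "det M \<in> \<int>" using det_Ints[OF M(1)] entry by blast
  then have "\<bar>det M\<bar> \<in> \<nat>" by (simp add: Nats_altdef2)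
  then obtain D where D: "\<bar>det M\<bar> = real D" by (auto elim: Nats_cases)
  have "x' $ j * real D \<in> \<int>" if j: "j < n" for j
  proof -
    \<comment> \<open>Tight right-hand sides are integers too. Only integrality of Cramer's
      numerators is used; their size will later follow from the box constraints.\<close>
    have "det (replace_col M (M *\<^sub>v x') j) \<in> \<int>"
    proof (rule det_Ints)
      show "replace_col M (M *\<^sub>v x') j \<in> carrier_mat n n" using M(1) by (auto simp: replace_col_def)
      show "replace_col M (M *\<^sub>v x') j $$ (i, l) \<in> \<int>" if "i < n" "l < n" for i l
        using that M(1) entry bspec[OF int tight[OF that(1)]] by (auto simp: replace_col_def)
    qed
    then have "x' $ j * det M \<in> \<int>" using cramer_lemma_mat[OF M(1) x'(1) j] by simp
    moreover have "x' $ j * real D = x' $ j * det M \<or> x' $ j * real D = - (x' $ j * det M)"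
      unfolding D[symmetric] by (cases "det M \<ge> 0") auto
    ultimately show ?thesis by auto
  qed
  moreover have "D > 0" using D M(2) by (cases D) auto
  moreover have "real D \<le> fact n * K ^ n" unfolding D[symmetric] using abs_det_le[OF M(1)] entry by blast
  ultimately show thesis using that x' by blast
qed

section \<open>The verifier\<close>

text \<open>The first certificate \<open>X\<close> is a tuple of words: words 0 to 5 have the dimensions as their lengths,
  6 is the bound \<open>R\<close>, 7 a common denominator of the coordinates of \<open>x\<close>, 8 a common denominator of all
  entries of the instance, 9 the tuple of the numerators of \<open>x\<close>, 10 the list of the signs of the entries,
  and 11 to 13 are the tuples of the numerators and denominators of the entries and of the numerators
  over the common denominator.\<close>

definition dimension :: "bool list list \<Rightarrow> nat \<Rightarrow> nat" where
  "dimension X d = length (get [] X d)"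

definition nth_val :: "bool list list \<Rightarrow> nat \<Rightarrow> nat" where
  "nth_val ws j = val (get [] ws j)"

definition num :: "bool list list \<Rightarrow> nat \<Rightarrow> nat \<Rightarrow> nat" where
  "num X i j = nth_val (undelim (get [] X i)) j"

definition neg :: "bool list list \<Rightarrow> nat \<Rightarrow> bool" where
  "neg X e = get False (get [] X 10) e"

definition code_of_cert :: "bool list list \<Rightarrow> bool list" where
  "code_of_cert X =
     concat (map (\<lambda>d. map (\<lambda>_. True) (get [] X d) @ [False]) [0, 1, 2, 3, 4, 5]) @
     delim (binary (nth_val X 6)) @
     concat (map (\<lambda>e. delim (neg X e # binary (num X 11 e)) @ delim (False # binary (num X 12 e)))
       [0..<dimension X 10])"

text \<open>Entries are numbered as in \<open>rat_entries\<close>: \<open>a\<close>,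
  \<open>b\<close>, then \<open>A\<close>, \<open>B\<close>, \<open>W\<close> and the matrices of
  \<open>T\<close>, each row by row. The offsets mark where the matrices begin; \<open>a\<close>
  starts at 0 and \<open>b\<close> right behind it.\<close>

definition off_A :: "bool list list \<Rightarrow> nat" where
  "off_A X = dimension X 0 + dimension X 2"

definition off_B :: "bool list list \<Rightarrow> nat" where
  "off_B X = off_A X + dimension X 0 * dimension X 1"

definition off_W :: "bool list list \<Rightarrow> nat" where
  "off_W X = off_B X + dimension X 2 * dimension X 3"

definition off_T :: "bool list list \<Rightarrow> nat" where
  "off_T X = off_W X + dimension X 4 * dimension X 5"

text \<open>A linear form is a list of pairs of an entry index and a natural coefficient. This is
  the contribution of the entries of sign \<open>s\<close>, in absolute value and multiplied by the
  common denominator.\<close>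

definition signed_sum :: "bool list list \<Rightarrow> bool \<Rightarrow> (nat \<times> nat) list \<Rightarrow> nat" where
  "signed_sum X s l = sum_list (map (\<lambda>p. if neg X (fst p) = s then num X 13 (fst p) * snd p else 0) l)"

definition lin_le :: "bool list list \<Rightarrow> (nat \<times> nat) list \<Rightarrow> (nat \<times> nat) list \<Rightarrow> bool" where
  "lin_le X l l' \<longleftrightarrow>
     signed_sum X False l + signed_sum X True l' \<le> signed_sum X True l + signed_sum X False l'"

definition row_A :: "bool list list \<Rightarrow> nat \<Rightarrow> (nat \<times> nat) list" where
  "row_A X i = map (\<lambda>j. (off_A X + i * dimension X 1 + j, num X 9 j)) [0..<dimension X 1]"

definition row_B :: "bool list list \<Rightarrow> bool list list \<Rightarrow> nat \<Rightarrow> (nat \<times> nat) list" where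
  "row_B X Y i = map (\<lambda>k. (off_B X + i * dimension X 3 + k, nth_val Y k)) [0..<dimension X 3]"

definition row_T :: "bool list list \<Rightarrow> bool list list \<Rightarrow> nat \<Rightarrow> nat \<Rightarrow> (nat \<times> nat) list" where
  "row_T X Y i k = map (\<lambda>j. (off_T X + k * (dimension X 4 * dimension X 1) + i * dimension X 1 + j,
     nth_val Y k * num X 9 j)) [0..<dimension X 1]"

text \<open>\<open>row_T\<close> uses the numerators of \<open>x\<close> only, so the terms of
  \<open>W y\<close> are multiplied by the denominator of \<open>x\<close> to match.\<close>

definition row_W :: "bool list list \<Rightarrow> bool list list \<Rightarrow> nat \<Rightarrow> (nat \<times> nat) list" where
  "row_W X Z i = map (\<lambda>l. (off_W X + i * dimension X 5 + l, nth_val X 7 * nth_val Z l)) [0..<dimension X 5]"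

text \<open>The condition on the sign excludes minus zero, which \<open>enc_int\<close> never
  produces. The last equation says that the scaled numerator over the common denominator is the same
  fraction.\<close>

definition check_entry :: "bool list list \<Rightarrow> nat \<Rightarrow> bool" where
  "check_entry X e \<longleftrightarrow> 0 < num X 12 e \<and> (neg X e \<longrightarrow> 0 < num X 11 e) \<and>
     num X 13 e * num X 12 e = num X 11 e * nth_val X 8"

definition check_inst :: "bool list \<Rightarrow> bool list list \<Rightarrow> bool" where
  "check_inst w X \<longleftrightarrow> w = code_of_cert X \<and>
     dimension X 10 = off_T X + dimension X 3 * (dimension X 4 * dimension X 1) \<and>
     0 < nth_val X 7 \<and> 0 < nth_val X 8 \<and> list_all (\<lambda>e. check_entry X e) [0..<dimension X 10]"

definition check_x :: "bool list list \<Rightarrow> bool" where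
  "check_x X \<longleftrightarrow>
     list_all (\<lambda>j. num X 9 j \<le> nth_val X 6 * nth_val X 7) [0..<dimension X 1] \<and>
     list_all (\<lambda>i. lin_le X (row_A X i) [(i, nth_val X 7)]) [0..<dimension X 0]"

definition check_u :: "bool list list \<Rightarrow> bool list list \<Rightarrow> bool" where
  "check_u X Y \<longleftrightarrow>
     list_all (\<lambda>k. nth_val Y k \<le> nth_val X 6) [0..<dimension X 3] \<and>
     list_all (\<lambda>i. lin_le X (row_B X Y i) [(dimension X 0 + i, 1)]) [0..<dimension X 2]"

definition check_y :: "bool list list \<Rightarrow> bool list list \<Rightarrow> bool list list \<Rightarrow> bool" where
  "check_y X Y Z \<longleftrightarrow>
     list_all (\<lambda>l. nth_val Z l \<le> nth_val X 6) [0..<dimension X 5] \<and>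
     list_all (\<lambda>i. lin_le X (concat (map (\<lambda>k. row_T X Y i k) [0..<dimension X 3]) @ row_W X Z i) [])
       [0..<dimension X 4]"

text \<open>A word for \<open>u\<close> that violates the constraints of \<open>U_d\<close> is
  accepted, which turns the quantifier over words into one over admissible \<open>u\<close>.\<close>

definition check :: "bool list \<Rightarrow> bool list list \<Rightarrow> bool list list \<Rightarrow> bool list list \<Rightarrow> bool" where
  "check w X Y Z \<longleftrightarrow> check_inst w X \<and> check_x X \<and> (check_u X Y \<longrightarrow> check_y X Y Z)"

definition verifier :: "bool list \<Rightarrow> bool" where
  "verifier v = check (get [] (undelim v) 0) (undelim (get [] (undelim v) 1))
     (undelim (get [] (undelim v) 2)) (undelim (get [] (undelim v) 3))"

section \<open>Polynomial running time of the verifier\<close>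

lemma polyf_dimension [polyf_intros]:
  "polyf f \<Longrightarrow> polyf g \<Longrightarrow> polyf (\<lambda>x. dimension (f x) (g x))"
  unfolding dimension_def by (intro polyf_intros)

lemma polyf_upt_dimension [polyf_intros]:
  "polyf f \<Longrightarrow> polyf g \<Longrightarrow> polyf (\<lambda>x. [0..<dimension (f x) (g x)])"
  unfolding dimension_def by (intro polyf_intros)

lemma polyf_nth_val [polyf_intros]:
  "polyf f \<Longrightarrow> polyf g \<Longrightarrow> polyf (\<lambda>x. nth_val (f x) (g x))"
  unfolding nth_val_def by (intro polyf_intros)

lemma polyf_num [polyf_intros]:
  "polyf f \<Longrightarrow> polyf g \<Longrightarrow> polyf h \<Longrightarrow> polyf (\<lambda>x. num (f x) (g x) (h x))"
  unfolding num_def by (intro polyf_intros)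

lemma polyf_neg [polyf_intros]:
  "polyf f \<Longrightarrow> polyf g \<Longrightarrow> polyf (\<lambda>x. neg (f x) (g x))"
  unfolding neg_def by (intro polyf_intros)

lemma polyf_code_of_cert [polyf_intros]:
  assumes "polyf f"
  shows "polyf (\<lambda>x. code_of_cert (f x))"
  by (rule polyf_comp[OF _ assms]) (unfold code_of_cert_def, intro polyf_intros)

lemma polyf_offsets [polyf_intros]:
  assumes "polyf f"
  shows "polyf (\<lambda>x. off_A (f x))" "polyf (\<lambda>x. off_B (f x))" "polyf (\<lambda>x. off_W (f x))" "polyf (\<lambda>x. off_T (f x))"
  unfolding off_A_def off_B_def off_W_def off_T_def by (intro polyf_intros assms)+

lemma polyf_lin_le [polyf_intros]:
  assumes "polyf f" "polyf g" "polyf h"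
  shows "polyf (\<lambda>x. lin_le (f x) (g x) (h x))"
proof -
  have "polyf (\<lambda>p. lin_le (fst p) (fst (snd p)) (snd (snd p)))"
    unfolding lin_le_def signed_sum_def by (intro polyf_intros)
  from polyf_comp[OF this polyf_Pair[OF assms(1) polyf_Pair[OF assms(2,3)]]] show ?thesis by simp
qed

lemma polyf_rows:
  shows "polyf (\<lambda>p. row_A (fst p) (snd p))" "polyf (\<lambda>p. row_B (fst p) (fst (snd p)) (snd (snd p)))"
    "polyf (\<lambda>p. row_T (fst p) (fst (snd p)) (fst (snd (snd p))) (snd (snd (snd p))))"
    "polyf (\<lambda>p. row_W (fst p) (fst (snd p)) (snd (snd p)))"
  unfolding row_A_def row_B_def row_T_def row_W_def by (intro polyf_intros)+

lemma polyf_uncurry3: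
  assumes "polyf (\<lambda>p. F (fst p) (fst (snd p)) (snd (snd p)))" "polyf f" "polyf g" "polyf h"
  shows "polyf (\<lambda>x. F (f x) (g x) (h x))"
  using polyf_comp[OF assms(1) polyf_Pair[OF assms(2) polyf_Pair[OF assms(3,4)]]] by simp

lemma polyf_uncurry4:
  assumes "polyf (\<lambda>p. F (fst p) (fst (snd p)) (fst (snd (snd p))) (snd (snd (snd p))))"
    "polyf f" "polyf g" "polyf h" "polyf k"
  shows "polyf (\<lambda>x. F (f x) (g x) (h x) (k x))"
  using polyf_comp[OF assms(1) polyf_Pair[OF assms(2) polyf_Pair[OF assms(3) polyf_Pair[OF assms(4,5)]]]] by simp

lemmas polyf_rows_intros [polyf_intros] = polyf_uncurry[OF polyf_rows(1)] polyf_uncurry3[OF polyf_rows(2)]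
  polyf_uncurry4[OF polyf_rows(3)] polyf_uncurry3[OF polyf_rows(4)]

lemma polyf_check_entry: "polyf (\<lambda>p. check_entry (fst p) (snd p))"
  unfolding check_entry_def by (intro polyf_intros)

lemma polyf_check_inst: "polyf (\<lambda>p. check_inst (fst p) (snd p))"
  unfolding check_inst_def by (intro polyf_intros polyf_uncurry[OF polyf_check_entry])

lemma polyf_check_x: "polyf check_x"
  unfolding check_x_def by (intro polyf_intros)

lemma polyf_check_u: "polyf (\<lambda>p. check_u (fst p) (snd p))"
  unfolding check_u_def by (intro polyf_intros)

lemma polyf_check_y: "polyf (\<lambda>p. check_y (fst p) (fst (snd p)) (snd (snd p)))"
  unfolding check_y_def by (intro polyf_intros)

lemma polyf_verifier: "polyf verifier"
  unfolding verifier_def check_def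
  by (intro polyf_intros polyf_uncurry[OF polyf_check_inst] polyf_comp[OF polyf_check_x]
    polyf_uncurry[OF polyf_check_u] polyf_uncurry3[OF polyf_check_y])

section \<open>Polynomial-time predicates on words\<close>

text \<open>The input word has to be turned into the serialised tree of a list of bits first. It is reversed
  onto stack 1, since the tree is built from its last bit on.\<close>

definition prepare_input :: com where
  "prepare_input = (pour 0 1 ;; Push 0 False ;;
     While_Not 1 None (If_Top 1 (Some True) (Pop 1 ;; push_word [True, True, False, False])
       (Pop 1 ;; push_word [True, False])))"

lemma runs_prepare_input:
  "runs prepare_input ((\<lambda>_. [])(0 := w)) (20 + 30 * length w) (main_stack (word w))"
proof -
  let ?body = "If_Top 1 (Some True) (Pop 1 ;; push_word [True, True, False, False]) (Pop 1 ;; push_word [True, False])"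
  have step: "runs ?body (stacks a (b # l) [] []) (1 + 20) (stacks ((True # word b) @ a) l [] [])" for a b l
  proof (rule runs_If_bit)
    have pop: "runs (Pop 1) (stacks a (b # l) [] []) 1 (stacks a l [] [])"
      using runs_Pop[of 1 "stacks a (b # l) [] []"] by simp
    show "runs (if b then Pop 1 ;; push_word [True, True, False, False] else Pop 1 ;; push_word [True, False])
        (stacks a (b # l) [] []) 20 (stacks ((True # word b) @ a) l [] [])"
      using runs_Seq[OF pop runs_push_word[of "True # word b" a l "[]" "[]"]] by (cases b) (auto elim: runs_mono)
  qed simp
  have loop: "runs (While_Not 1 None ?body) (stacks (word v) l [] []) (1 + 22 * length l) (main_stack (word (rev l @ v)))" for l v
  proof (induction l arbitrary: v)
    case Nil
    show ?case using runs_While_End[of "stacks (word v) [] [] []" 1 None] by simp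
  next
    case (Cons b l)
    have "runs ?body (stacks (word v) (b # l) [] []) (1 + 20) (stacks (word (b # v)) l [] [])"
      using step[of "word v" b l] by simp
    from runs_While_Step[OF _ this Cons.IH[of "b # v"]] show ?case
      by (auto elim!: runs_mono)
  qed
  have init: "(\<lambda>_. [])(0 := w) = main_stack w" by (auto simp: stacks_def)
  have "runs (pour 0 1) (main_stack w) (1 + 6 * length w) (stacks [] (rev w) [] [])"
    using runs_pour[of 0 1 "main_stack w"] by simp
  moreover have "runs (Push 0 False) (stacks [] (rev w) [] []) 2 (stacks (word ([] :: bool list)) (rev w) [] [])"
    using runs_Push[of 0 False "stacks [] (rev w) [] []"] by simp
  moreover have "runs (While_Not 1 None ?body) (stacks (word ([] :: bool list)) (rev w) [] []) (1 + 22 * length w) (main_stack (word w))"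
    using loop[of "[]" "rev w"] by simp
  ultimately have "runs prepare_input (main_stack w) (1 + (1 + 6 * length w) + (1 + 2 + (1 + 22 * length w))) (main_stack (word w))"
    unfolding prepare_input_def by (intro runs_Seq)
  then show ?thesis unfolding init by (rule runs_mono) simp
qed

text \<open>The codes of \<open>True\<close> and \<open>False\<close> differ in their first bit, so
  the top of stack 0 is the verdict. A word of length \<open>n\<close> has a code of at most
  \<open>4 * n + 4\<close> bits.\<close>

lemma PTIME_if_polyf:
  assumes "polyf P"
  shows "{w. P w} \<in> PTIME"
proof -
  obtain c p where c: "\<And>w m. runs c (main_stack (word w @ m)) (poly p (csize w)) (main_stack (word (P w) @ m))"
    using assms by (elim polyfE) blast
  have "poly_bounded (\<lambda>n. 1 + (20 + 30 * n) + poly p (4 * n + 4))" by (intro poly_bounded_intros)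
  then obtain q where q: "\<And>n. 1 + (20 + 30 * n) + poly p (4 * n + 4) \<le> poly q n" by (auto simp: poly_bounded_def)
  show ?thesis
  proof (rule PTIME_if_exec)
    fix w :: "bool list"
    have "runs (prepare_input ;; c) ((\<lambda>_. [])(0 := w)) (1 + (20 + 30 * length w) + poly p (4 * length w + 4))
        (main_stack (word (P w)))"
      using c[of w "[]"] csize_bits(2)[of w]
      by (intro runs_Seq[OF runs_prepare_input]) (auto elim!: runs_mono intro: poly_nat_mono)
    then obtain t where "t \<le> poly q (length w)"
        "exec (prepare_input ;; c) ((\<lambda>_. [])(0 := w)) t (main_stack (word (P w)))"
      using q[of "length w"] unfolding runs_def by (meson order_trans)
    then show "\<exists>t s. t \<le> poly q (length w) \<and> exec (prepare_input ;; c) ((\<lambda>_. [])(0 := w)) t s \<and>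
        (stack_top (s 0) = Some True \<longleftrightarrow> w \<in> {w. P w})"
      by (intro exI[of _ t] exI[of _ "main_stack (word (P w))"]) (cases "P w"; simp)
  qed
qed

section \<open>Instances given by their list of entries\<close>

lemma index_less:
  fixes n :: nat
  assumes "i < m" "j < n"
  shows "i * n + j < m * n"
proof -
  have "i * n + j < Suc i * n" using assms(2) by simp
  also have "\<dots> \<le> m * n" using assms(1) by (intro mult_le_mono1) simp
  finally show ?thesis .
qed

text \<open>Flattening in row-major order, used both for the rows of a matrix and for the list of
  matrices \<open>T\<close>.\<close>

lemma concat_map_upt:
  "concat (map (\<lambda>i. map (\<lambda>j. f (i * n + j)) [0..<n]) [0..<m]) = map f [0..<m * n]"
proof (induction m)
  case (Suc m)
  have "map (\<lambda>j. f (m * n + j)) [0..<n] = map f [m * n..<m * n + n]"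
    by (intro nth_equalityI) auto
  then show ?case using Suc upt_add_eq_append[of 0 "m * n" n] by (simp add: add.commute)
qed simp

lemma list_of_vec_vec: "list_of_vec (vec n f) = map f [0..<n]"
  by (intro nth_equalityI) (auto simp: list_of_vec_index)

lemma mat_entries_mat: "mat_entries (mat m n (\<lambda>(i, j). f (i * n + j))) = map f [0..<m * n]"
proof -
  have "mat_to_list (mat m n (\<lambda>(i, j). f (i * n + j))) = map (\<lambda>i. map (\<lambda>j. f (i * n + j)) [0..<n]) [0..<m]"
    by (auto simp: mat_to_list_def)
  then show ?thesis by (simp add: mat_entries_def concat_map_upt)
qed

text \<open>An instance as the verifier sees it: dimensions, the bound, and one flat sequence of
  entries in place of vectors and matrices.\<close>

locale two_stage_data =
  fixes mx nx mu nu my ny R :: nat and c :: "nat \<Rightarrow> rat"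
begin

definition "oA = mx + mu"
definition "oB = oA + mx * nx"
definition "oW = oB + mu * nu"
definition "oT = oW + my * ny"
definition "num_entries = oT + nu * (my * nx)"

lemmas offset_defs = oA_def oB_def oW_def oT_def num_entries_def

definition inst :: two_stage where
  "inst = \<lparr>bnd_R = R, vec_a = vec mx c, vec_b = vec mu (\<lambda>i. c (mx + i)),
     mat_A = mat mx nx (\<lambda>(i, j). c (oA + (i * nx + j))),
     mat_B = mat mu nu (\<lambda>(i, j). c (oB + (i * nu + j))),
     mat_W = mat my ny (\<lambda>(i, j). c (oW + (i * ny + j))),
     mats_T = map (\<lambda>k. mat my nx (\<lambda>(i, j). c (oT + (k * (my * nx) + (i * nx + j))))) [0..<nu]\<rparr>"

lemma inst_simps [simp]:
  "bnd_R inst = R" "vec_a inst = vec mx c" "vec_b inst = vec mu (\<lambda>i. c (mx + i))"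
  "m_x inst = mx" "n_x inst = nx" "m_u inst = mu" "n_u inst = nu" "m_y inst = my" "n_y inst = ny"
  by (simp_all add: inst_def)

lemma wf_inst: "wf_instance inst"
  by (auto simp: wf_instance_def inst_def)

lemma rat_entries_inst: "rat_entries inst = map c [0..<num_entries]"
proof -
  have shift: "map (\<lambda>e. c (a + e)) [0..<n] = map c [a..<a + n]" for a n
    by (intro nth_equalityI) auto
  have "rat_entries inst = map c [0..<mx] @ map (\<lambda>i. c (mx + i)) [0..<mu] @
      map (\<lambda>e. c (oA + e)) [0..<mx * nx] @ map (\<lambda>e. c (oB + e)) [0..<mu * nu] @
      map (\<lambda>e. c (oW + e)) [0..<my * ny] @ map (\<lambda>e. c (oT + e)) [0..<nu * (my * nx)]"
    unfolding rat_entries_def inst_def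
    by (simp add: list_of_vec_vec comp_def mat_entries_mat[of _ _ "\<lambda>e. c (_ + e)"]
        mat_entries_mat[of _ _ "\<lambda>e. c (_ + (_ + e))"] concat_map_upt[of "\<lambda>e. c (_ + e)"])
  also have "\<dots> = map c [0..<num_entries]"
    unfolding shift map_append[symmetric] append_assoc[symmetric]
    by (simp add: offset_defs upt_add_eq_append[symmetric] flip: upt_add_eq_append)
  finally show ?thesis .
qed

abbreviation rc :: "nat \<Rightarrow> real" where "rc e \<equiv> real_of_rat (c e)"

text \<open>The feasibility conditions in coordinates. Vectors become functions of which only
  finitely many values matter, and the integral vectors in the box become functions into the natural
  numbers.\<close>

definition x_ok :: "(nat \<Rightarrow> real) \<Rightarrow> bool" where
  "x_ok x \<longleftrightarrow> (\<forall>j<nx. 0 \<le> x j \<and> x j \<le> real R) \<and>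
     (\<forall>i<mx. (\<Sum>j<nx. rc (oA + i * nx + j) * x j) \<le> rc i)"

definition u_ok :: "(nat \<Rightarrow> nat) \<Rightarrow> bool" where
  "u_ok u \<longleftrightarrow> (\<forall>k<nu. u k \<le> R) \<and>
     (\<forall>i<mu. (\<Sum>k<nu. rc (oB + i * nu + k) * real (u k)) \<le> rc (mx + i))"

definition y_ok :: "(nat \<Rightarrow> real) \<Rightarrow> (nat \<Rightarrow> nat) \<Rightarrow> (nat \<Rightarrow> nat) \<Rightarrow> bool" where
  "y_ok x u y \<longleftrightarrow> (\<forall>l<ny. y l \<le> R) \<and>
     (\<forall>i<my. (\<Sum>j<nx. (\<Sum>k<nu. real (u k) * rc (oT + k * (my * nx) + i * nx + j)) * x j) +
        (\<Sum>l<ny. rc (oW + i * ny + l) * real (y l)) \<le> 0)"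

definition solvable :: bool where
  "solvable \<longleftrightarrow> (\<exists>x. x_ok x \<and> (\<forall>u. u_ok u \<longrightarrow> (\<exists>y. y_ok x u y)))"

lemma mem_X_c: "x \<in> X_c inst \<longleftrightarrow> x \<in> carrier_vec nx \<and> x_ok (($) x)"
  by (auto simp: X_c_def x_ok_def box_def less_eq_vec_def inst_def scalar_prod_def
      atLeast0LessThan add.assoc)

lemma mem_U_d: "vec nu (\<lambda>k. real (u k)) \<in> U_d inst \<longleftrightarrow> u_ok u"
  by (auto simp: U_d_def u_ok_def box_def int_vecs_def less_eq_vec_def inst_def scalar_prod_def
      atLeast0LessThan add.assoc)

lemma mem_Y_d:
  assumes "x \<in> carrier_vec nx"
  shows "vec ny (\<lambda>l. real (y l)) \<in> Y_d inst x (vec nu (\<lambda>k. real (u k))) \<longleftrightarrow> y_ok (($) x) u y"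
  using assms
  by (auto simp: Y_d_def y_ok_def T_of_def box_def int_vecs_def less_eq_vec_def inst_def scalar_prod_def
      atLeast0LessThan add.assoc)

lemma int_box_vec:
  assumes "v \<in> box R n \<inter> int_vecs n"
  obtains u where "v = vec n (\<lambda>k. real (u k))"
proof -
  have "v = vec n (\<lambda>k. real (nat \<lfloor>v $ k\<rfloor>))"
  proof (rule eq_vecI)
    fix k assume "k < dim_vec (vec n (\<lambda>k. real (nat \<lfloor>v $ k\<rfloor>)))"
    then have k: "k < n" by simp
    then have "v $ k \<in> \<int>" "0 \<le> v $ k" using assms by (auto simp: box_def int_vecs_def)
    then show "v $ k = vec n (\<lambda>k. real (nat \<lfloor>v $ k\<rfloor>)) $ k" using k by (auto elim!: Ints_cases)
  qed (use assms in \<open>auto simp: box_def\<close>)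
  then show thesis by (rule that)
qed

lemma yes_instance_inst: "yes_instance inst \<longleftrightarrow> solvable"
proof
  assume "yes_instance inst"
  then obtain x where x: "x \<in> X_c inst" "\<forall>u \<in> U_d inst. \<exists>y. y \<in> Y_d inst x u"
    by (auto simp: yes_instance_def)
  have xc: "x \<in> carrier_vec nx" "x_ok (($) x)" using x(1) by (simp_all add: mem_X_c)
  have "\<exists>y. y_ok (($) x) u y" if "u_ok u" for u
  proof -
    have "\<exists>y. y \<in> Y_d inst x (vec nu (\<lambda>k. real (u k)))"
      using bspec[OF x(2), of "vec nu (\<lambda>k. real (u k))"] mem_U_d that by auto
    then obtain y where y: "y \<in> Y_d inst x (vec nu (\<lambda>k. real (u k)))" ..
    then have "y \<in> box R ny \<inter> int_vecs ny" by (simp add: Y_d_def)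
    from int_box_vec[OF this] obtain y' where "y = vec ny (\<lambda>k. real (y' k))" .
    then have "y_ok (($) x) u y'" using y mem_Y_d[OF xc(1)] by simp
    then show ?thesis by blast
  qed
  then show solvable using xc unfolding solvable_def by blast
next
  assume solvable
  then obtain x where x: "x_ok x" "\<And>u. u_ok u \<Longrightarrow> \<exists>y. y_ok x u y" by (auto simp: solvable_def)
  let ?x = "vec nx x"
  have ok: "x_ok (($) ?x) \<longleftrightarrow> x_ok x" "y_ok (($) ?x) u y \<longleftrightarrow> y_ok x u y" for u y
    by (auto simp: x_ok_def y_ok_def)
  show "yes_instance inst"
    unfolding yes_instance_def
  proof (intro bexI[of _ ?x] ballI)
    show "?x \<in> X_c inst" using x(1) ok by (simp add: mem_X_c)
    fix v assume v: "v \<in> U_d inst"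
    then have "v \<in> box R nu \<inter> int_vecs nu" by (simp add: U_d_def)
    from int_box_vec[OF this] obtain u where u: "v = vec nu (\<lambda>k. real (u k))" .
    then have "u_ok u" using v mem_U_d by simp
    then obtain y where "y_ok x u y" using x(2) by blast
    then have "vec ny (\<lambda>l. real (y l)) \<in> Y_d inst ?x v" unfolding u using ok mem_Y_d[of ?x] by simp
    then show "\<exists>y. y \<in> Y_d inst ?x v" ..
  qed
qed

end

text \<open>Inverts the flattening by division with remainder. The value 0 beyond the last entry
  makes the sequence comparable as a whole with the one read from a certificate.\<close>

lemma wf_instance_obtain_entries:
  assumes "wf_instance I"
  obtains c where "I = two_stage_data.inst (m_x I) (n_x I) (m_u I) (n_u I) (m_y I) (n_y I) (bnd_R I) c"
    "\<And>e. e \<ge> two_stage_data.num_entries (m_x I) (n_x I) (m_u I) (n_u I) (m_y I) (n_y I) \<Longrightarrow> c e = 0"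
proof -
  \<comment> \<open>The offsets do not depend on the entries, so a dummy sequence gives access to
    them before \<open>c\<close> is defined.\<close>
  interpret D: two_stage_data "m_x I" "n_x I" "m_u I" "n_u I" "m_y I" "n_y I" "bnd_R I" "\<lambda>_. 0" .
  let ?n = "m_y I * n_x I"
  define c where "c e =
    (if e < m_x I then vec_a I $ e
     else if e < D.oA then vec_b I $ (e - m_x I)
     else if e < D.oB then mat_A I $$ ((e - D.oA) div n_x I, (e - D.oA) mod n_x I)
     else if e < D.oW then mat_B I $$ ((e - D.oB) div n_u I, (e - D.oB) mod n_u I)
     else if e < D.oT then mat_W I $$ ((e - D.oW) div n_y I, (e - D.oW) mod n_y I)
     else if e < D.num_entries then (mats_T I ! ((e - D.oT) div ?n)) $$ ((e - D.oT) mod ?n div n_x I, (e - D.oT) mod ?n mod n_x I)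
     else 0)" for e
  interpret E: two_stage_data "m_x I" "n_x I" "m_u I" "n_u I" "m_y I" "n_y I" "bnd_R I" c .
  have wf: "dim_vec (vec_a I) = m_x I" "dim_vec (vec_b I) = m_u I" "length (mats_T I) = n_u I"
    "\<And>k. k < n_u I \<Longrightarrow> mats_T I ! k \<in> carrier_mat (m_y I) (n_x I)"
    using assms by (auto simp: wf_instance_def)
  have le: "m_x I \<le> D.oA" "D.oA \<le> D.oB" "D.oB \<le> D.oW" "D.oW \<le> D.oT"
    by (simp_all add: D.offset_defs)
  have A: "c (D.oA + (i * n_x I + j)) = mat_A I $$ (i, j)" if "i < m_x I" "j < n_x I" for i j
  proof -
    have "\<not> D.oA + (i * n_x I + j) < m_x I" "D.oA + (i * n_x I + j) < D.oB"
      using index_less[OF that] le(1) unfolding D.oB_def by linarith+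
    then show ?thesis using that by (simp add: c_def)
  qed
  have B: "c (D.oB + (i * n_u I + j)) = mat_B I $$ (i, j)" if "i < m_u I" "j < n_u I" for i j
  proof -
    have "\<not> D.oB + (i * n_u I + j) < m_x I" "\<not> D.oB + (i * n_u I + j) < D.oA"
      "D.oB + (i * n_u I + j) < D.oW"
      using index_less[OF that] le(1,2) unfolding D.oW_def by linarith+
    then show ?thesis using that by (simp add: c_def)
  qed
  have W: "c (D.oW + (i * n_y I + j)) = mat_W I $$ (i, j)" if "i < m_y I" "j < n_y I" for i j
  proof -
    have "\<not> D.oW + (i * n_y I + j) < m_x I" "\<not> D.oW + (i * n_y I + j) < D.oA"
      "\<not> D.oW + (i * n_y I + j) < D.oB" "D.oW + (i * n_y I + j) < D.oT"
      using index_less[OF that] le(1-3) unfolding D.oT_def by linarith+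
    then show ?thesis using that by (simp add: c_def)
  qed
  have T: "c (D.oT + (k * ?n + (i * n_x I + j))) = mats_T I ! k $$ (i, j)" if "i < m_y I" "j < n_x I" "k < n_u I" for i j k
  proof -
    let ?t = "k * ?n + (i * n_x I + j)"
    have "\<not> D.oT + ?t < m_x I" "\<not> D.oT + ?t < D.oA" "\<not> D.oT + ?t < D.oB" "\<not> D.oT + ?t < D.oW"
      using le by linarith+
    moreover have "?t < n_u I * ?n" using index_less[OF that(3) index_less[OF that(1,2)]] .
    then have "D.oT + ?t < D.num_entries" by (simp add: D.num_entries_def)
    moreover have "?t div ?n = k + (i * n_x I + j) div ?n"
      using index_less[OF that(1,2)] by (intro div_mult_self3) linarith
    then have "?t div ?n = k" using index_less[OF that(1,2)] by simp
    moreover have "?t mod ?n = i * n_x I + j" using index_less[OF that(1,2)] by simp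
    ultimately show ?thesis using that by (simp add: c_def)
  qed
  have "I = E.inst"
  proof (rule two_stage.equality)
    show "vec_a I = vec_a E.inst" using wf by (intro eq_vecI) (auto simp: c_def)
    show "vec_b I = vec_b E.inst" using wf by (intro eq_vecI) (auto simp: c_def D.offset_defs)
    show "mat_A I = mat_A E.inst" by (intro eq_matI) (auto simp: E.inst_def A)
    show "mat_B I = mat_B E.inst" by (intro eq_matI) (auto simp: E.inst_def B)
    show "mat_W I = mat_W E.inst" by (intro eq_matI) (auto simp: E.inst_def W)
    show "mats_T I = mats_T E.inst"
    proof (rule nth_equalityI)
      show "mats_T I ! k = mats_T E.inst ! k" if "k < length (mats_T I)" for k
        using that wf(3) wf(4)[of k] by (intro eq_matI) (auto simp: E.inst_def T)
    qed (auto simp: E.inst_def wf)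
  qed auto
  moreover have "c e = 0" if "e \<ge> D.num_entries" for e
  proof -
    have "D.oT \<le> D.num_entries" by (simp add: D.num_entries_def)
    then show ?thesis using le that by (simp add: c_def)
  qed
  ultimately show thesis by (rule that)
qed

section \<open>Solutions of polynomial size\<close>

context two_stage_data
begin

lemma small_solution:
  fixes ci :: "nat \<Rightarrow> int"
  assumes "Q > 0" and ci: "\<And>e. rc e * real Q = of_int (ci e)" and K: "\<And>e. \<bar>ci e\<bar> \<le> int K"
    and solvable
  obtains D N where "D > 0" "D \<le> fact nx * (1 + K + nu * (R * K)) ^ nx"
    "\<And>j. j < nx \<Longrightarrow> N j \<le> R * D" "x_ok (\<lambda>j. real (N j) / real D)"
    "\<And>u. u_ok u \<Longrightarrow> \<exists>y. y_ok (\<lambda>j. real (N j) / real D) u y"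
proof -
  obtain x f where x: "x_ok x" and f: "\<And>u. u_ok u \<Longrightarrow> y_ok x u (f u)"
    using \<open>solvable\<close> unfolding solvable_def by metis
  \<comment> \<open>Bounds all coefficients: 1 for the box constraints, \<open>K\<close> for the
    rows of \<open>A\<close>, and \<open>nu * (R * K)\<close> for those of \<open>T(u)\<close>,
    which are sums of \<open>nu\<close> products.\<close>
  let ?K = "1 + K + nu * (R * K)"
  \<comment> \<open>One representative for each \<open>u\<close>, with value 0 outside the
    dimension, so that the box leaves only finitely many.\<close>
  define U where "U = {u. u_ok u \<and> (\<forall>k. k \<notin> {..<nu} \<longrightarrow> u k = 0)}"
  have "finite U"
  proof (rule finite_subset)
    show "U \<subseteq> {u. \<forall>k. (k \<in> {..<nu} \<longrightarrow> u k \<in> {..R}) \<and> (k \<notin> {..<nu} \<longrightarrow> u k = 0)}"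
      by (auto simp: U_def u_ok_def)
  qed (intro finite_set_of_finite_funs; simp)
  define t where "t u i j = (\<Sum>k<nu. real (u k) * of_int (ci (oT + k * (my * nx) + i * nx + j)))" for u i j
  define s where "s y i = (\<Sum>l<ny. of_int (ci (oW + i * ny + l)) * real (y l))" for y :: "nat \<Rightarrow> nat" and i
  define FA where "FA = (\<lambda>i. (vec nx (\<lambda>j. of_int (ci (oA + i * nx + j)) :: real), of_int (ci i) :: real)) ` {..<mx}"
  define FU where "FU = (\<lambda>j. (unit_vec nx j :: real vec, real R)) ` {..<nx}"
  define FL where "FL = (\<lambda>j. (- unit_vec nx j :: real vec, 0 :: real)) ` {..<nx}"
  \<comment> \<open>With \<open>y = f u\<close> frozen, \<open>W y\<close> is a constant and moves
    to the right-hand side.\<close>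
  define FT where "FT = (\<lambda>(u, i). (vec nx (t u i), - s (f u) i)) ` (U \<times> {..<my})"
  let ?F = "FA \<union> FU \<union> FL \<union> FT"
  note F_defs = FA_def FU_def FL_def FT_def
  have scale_le: "a \<le> b \<longleftrightarrow> a * real Q \<le> b * real Q" for a b :: real
    using \<open>Q > 0\<close> by simp
  have scaled_A: "(\<Sum>j<nx. rc (oA + i * nx + j) * z j) * real Q = (\<Sum>j<nx. of_int (ci (oA + i * nx + j)) * z j)" for i z
    unfolding sum_distrib_right by (intro sum.cong refl) (simp add: ci[symmetric])
  have scaled_T: "((\<Sum>j<nx. (\<Sum>k<nu. real (u k) * rc (oT + k * (my * nx) + i * nx + j)) * z j) +
        (\<Sum>l<ny. rc (oW + i * ny + l) * real (y l))) * real Q = (\<Sum>j<nx. t u i j * z j) + s y i" for u i z and y :: "nat \<Rightarrow> nat"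
    unfolding t_def s_def sum_distrib_right distrib_right
    by (intro arg_cong2[of _ _ _ _ "(+)"] sum.cong refl) (simp_all add: ci[symmetric])
  have sat: "satisfies ?F z \<longleftrightarrow> x_ok (($) z) \<and> (\<forall>u\<in>U. y_ok (($) z) u (f u))"
    if z: "z \<in> carrier_vec nx" for z
  proof -
    have "satisfies FA z \<longleftrightarrow> (\<forall>i<mx. (\<Sum>j<nx. rc (oA + i * nx + j) * z $ j) \<le> rc i)"
      unfolding scale_le[of "\<Sum>j<nx. rc (oA + _ * nx + j) * z $ j"] scaled_A ci
      using z by (auto simp: FA_def satisfies_def scalar_prod_def atLeast0LessThan)
    moreover have "satisfies FU z \<longleftrightarrow> (\<forall>j<nx. z $ j \<le> real R)"
      using z by (auto simp: FU_def satisfies_def)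
    moreover have "satisfies FL z \<longleftrightarrow> (\<forall>j<nx. 0 \<le> z $ j)"
      using z by (auto simp: FL_def satisfies_def)
    moreover have "satisfies FT z \<longleftrightarrow> (\<forall>u\<in>U. \<forall>i<my. (\<Sum>j<nx. t u i j * z $ j) + s (f u) i \<le> 0)"
    proof -
      have "a + b \<le> 0 \<longleftrightarrow> a \<le> - b" for a b :: real by linarith
      moreover have "vec nx (t u i) \<bullet> z = (\<Sum>j<nx. t u i j * z $ j)" for u i
        using z by (simp add: scalar_prod_def atLeast0LessThan)
      ultimately show ?thesis by (auto simp: FT_def satisfies_def)
    qed
    moreover have "y_ok (($) z) u (f u) \<longleftrightarrow> (\<forall>i<my. (\<Sum>j<nx. t u i j * z $ j) + s (f u) i \<le> 0)" if "u \<in> U" for u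
    proof -
      have "\<forall>l<ny. f u l \<le> R" using f[of u] that by (simp add: U_def y_ok_def)
      then show ?thesis unfolding y_ok_def scale_le[of "_ + _" 0] scaled_T
        using \<open>Q > 0\<close> by (auto simp: mult_le_0_iff)
    qed
    moreover have "satisfies ?F z \<longleftrightarrow> satisfies FA z \<and> satisfies FU z \<and> satisfies FL z \<and> satisfies FT z"
      unfolding satisfies_def by (simp only: ball_Un conj_assoc)
    ultimately show ?thesis unfolding x_ok_def by (simp only: all_conj_distrib imp_conjR conj_ac) blast
  qed
  have x': "vec nx x \<in> carrier_vec nx" "satisfies ?F (vec nx x)"
  proof -
    have "x_ok (($) (vec nx x)) \<longleftrightarrow> x_ok x" "\<And>u y. y_ok (($) (vec nx x)) u y \<longleftrightarrow> y_ok x u y"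
      by (auto simp: x_ok_def y_ok_def)
    then show "satisfies ?F (vec nx x)" using sat[of "vec nx x"] x f by (simp add: U_def)
  qed simp
  have Fin: "finite ?F" using \<open>finite U\<close> by (auto simp: F_defs)
  have F_carrier: "?F \<subseteq> carrier_vec nx \<times> UNIV" by (auto simp: F_defs)
  have t_bound: "\<bar>t u i j\<bar> \<le> real ?K" if "u \<in> U" for u i j
  proof -
    have "\<bar>t u i j\<bar> \<le> (\<Sum>k<nu. \<bar>real (u k) * of_int (ci (oT + k * (my * nx) + i * nx + j))\<bar>)"
      unfolding t_def by (rule sum_abs)
    also have "\<dots> \<le> (\<Sum>k<nu. real R * real K)"
    proof (rule sum_mono)
      fix k assume "k \<in> {..<nu}"
      then have "u k \<le> R" using that by (simp add: U_def u_ok_def)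
      moreover have "\<bar>real_of_int (ci (oT + k * (my * nx) + i * nx + j))\<bar> \<le> real K"
        using K[of "oT + k * (my * nx) + i * nx + j"] by linarith
      ultimately show "\<bar>real (u k) * of_int (ci (oT + k * (my * nx) + i * nx + j))\<bar> \<le> real R * real K"
        unfolding abs_mult by (intro mult_mono) auto
    qed
    also have "\<dots> = real (nu * (R * K))" by simp
    also have "\<dots> \<le> real ?K" by (subst of_nat_le_iff) simp
    finally show ?thesis .
  qed
  have K_bound: "\<bar>real_of_int (ci e)\<bar> \<le> real ?K" for e
  proof -
    have "\<bar>real_of_int (ci e)\<bar> \<le> real K" using K[of e] by linarith
    also have "\<dots> \<le> real ?K" by (subst of_nat_le_iff) simp
    finally show ?thesis .
  qed
  have K_ge: "1 \<le> real ?K" by (subst of_nat_1[symmetric], subst of_nat_le_iff) simp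
  have int: "\<forall>(g, b) \<in> ?F. b \<in> \<int> \<and> (\<forall>j<nx. g $ j \<in> \<int> \<and> \<bar>g $ j\<bar> \<le> real ?K)"
  proof -
    have "t u i j \<in> \<int>" "s y i \<in> \<int>" for u i j y
      unfolding t_def s_def by (intro Ints_sum Ints_mult; simp)+
    then show ?thesis using t_bound K_bound K_ge unfolding F_defs
      by (auto simp del: of_nat_add of_nat_mult of_nat_Suc simp: unit_vec_def)
  qed
  \<comment> \<open>The rows of the box contain each unit vector and its negative, so every nonzero
    direction leaves the box.\<close>
  have bounded: "\<forall>d \<in> carrier_vec nx. d \<noteq> 0\<^sub>v nx \<longrightarrow> (\<exists>(g, b) \<in> ?F. g \<bullet> d > 0)"
  proof (intro ballI impI)
    fix d :: "real vec" assume d: "d \<in> carrier_vec nx" "d \<noteq> 0\<^sub>v nx"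
    then obtain j where j: "j < nx" "d $ j \<noteq> 0" by (metis carrier_vecD eq_vecI index_zero_vec(1) index_zero_vec(2))
    then have "unit_vec nx j \<bullet> d > 0 \<or> - unit_vec nx j \<bullet> d > 0" using d(1) by auto
    moreover have "(unit_vec nx j, real R) \<in> ?F" "(- unit_vec nx j, 0) \<in> ?F"
      using j by (auto simp: F_defs)
    ultimately show "\<exists>(g, b) \<in> ?F. g \<bullet> d > 0" by blast
  qed
  obtain z D where z: "z \<in> carrier_vec nx" "satisfies ?F z" and D: "D > 0"
    "real D \<le> fact nx * real ?K ^ nx" and zD: "\<And>j. j < nx \<Longrightarrow> z $ j * real D \<in> \<int>"
    using exists_small_rational_solution[OF Fin F_carrier int bounded x'] by blast
  define N where "N j = nat \<lfloor>z $ j * real D\<rfloor>" for j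
  have box: "0 \<le> z $ j" "z $ j \<le> real R" if "j < nx" for j
    using z sat that by (auto simp: x_ok_def)
  have N: "real (N j) = z $ j * real D" if "j < nx" for j
  proof -
    have "z $ j * real D \<in> \<int>" by (rule zD[OF that])
    then obtain m :: int where "z $ j * real D = of_int m" by (elim Ints_cases)
    moreover have "0 \<le> z $ j * real D" using box[OF that] by simp
    ultimately show ?thesis by (simp add: N_def)
  qed
  have N_div: "real (N j) / real D = z $ j" if "j < nx" for j using N[OF that] D(1) by simp
  have ok: "x_ok (\<lambda>j. real (N j) / real D) \<longleftrightarrow> x_ok (($) z)"
    "y_ok (\<lambda>j. real (N j) / real D) u y \<longleftrightarrow> y_ok (($) z) u y" for u y
    by (auto simp: x_ok_def y_ok_def N_div)
  show thesis
  proof (rule that)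
    show "D > 0" by (rule D)
    show "D \<le> fact nx * ?K ^ nx" 
    proof -
      have "real D \<le> real (fact nx * ?K ^ nx)"
        unfolding of_nat_mult of_nat_power of_nat_fact by (rule D(2))
      then show ?thesis by (simp only: of_nat_le_iff)
    qed
    show "N j \<le> R * D" if "j < nx" for j
    proof -
      have "real (N j) \<le> real R * real D" unfolding N[OF that] using box[OF that] by (intro mult_right_mono) auto
      then show ?thesis by (metis of_nat_le_iff of_nat_mult)
    qed
    show "x_ok (\<lambda>j. real (N j) / real D)" unfolding ok using sat[OF z(1)] z(2) by blast
    fix u assume u: "u_ok u"
    \<comment> \<open>An arbitrary admissible \<open>u\<close> is answered by the value of
      \<open>f\<close> at its representative in \<open>U\<close>.\<close>
    define u' where "u' k = (if k < nu then u k else 0)" for k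
    have "u_ok u'" "\<And>y. y_ok (($) z) u' y \<longleftrightarrow> y_ok (($) z) u y"
      using u by (auto simp: u_ok_def y_ok_def u'_def)
    then have "y_ok (($) z) u (f u')" using sat[OF z(1)] z(2) by (auto simp: U_def u'_def)
    then show "\<exists>y. y_ok (\<lambda>j. real (N j) / real D) u y" unfolding ok by blast
  qed
qed

end

section \<open>Correctness of the verifier\<close>

definition signed :: "bool \<Rightarrow> nat \<Rightarrow> int" where
  "signed s n = (if s then - int n else int n)"

lemma signed_over_common_denominator:
  fixes r :: real
  assumes r: "r * real q = of_int (signed s p)" and q: "q > 0" and eq: "p' * q = p * Q"
  shows "r * real Q = of_int (signed s p')"
proof -
  have "real p' * real q = real p * real Q"
    unfolding of_nat_mult[symmetric] eq ..
  then have "of_int (signed s p) * real Q = of_int (signed s p') * real q"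
    by (simp add: signed_def)
  with r have "r * real Q * real q = of_int (signed s p') * real q"
    by (metis mult.commute mult.left_commute)
  then show ?thesis using q by simp
qed

definition entry :: "bool list list \<Rightarrow> nat \<Rightarrow> rat" where
  "entry X e = (if e < dimension X 10 then Rat.Fract (signed (neg X e) (num X 11 e)) (int (num X 12 e)) else 0)"

locale checked_cert =
  fixes w :: "bool list" and X :: "bool list list"
  assumes check_inst: "check_inst w X"
begin

sublocale two_stage_data "dimension X 0" "dimension X (Suc 0)" "dimension X 2" "dimension X 3"
  "dimension X 4" "dimension X 5" "nth_val X 6" "entry X" .

lemma offsets [simp]: "off_A X = oA" "off_B X = oB" "off_W X = oW" "off_T X = oT"
  by (simp_all add: off_A_def off_B_def off_W_def off_T_def offset_defs)

lemma dimension_10: "dimension X 10 = num_entries"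
  using check_inst by (simp add: check_inst_def num_entries_def)

lemma den_pos: "0 < nth_val X 7" "0 < nth_val X 8"
  using check_inst by (simp_all add: check_inst_def)

lemma entry_checked: "e < num_entries \<Longrightarrow> check_entry X e"
  using check_inst dimension_10 by (auto simp: check_inst_def list_all_iff)

lemma encodes_inst: "encodes w inst"
proof -
  let ?fs = "map (\<lambda>e. (signed (neg X e) (num X 11 e), int (num X 12 e))) [0..<num_entries]"
  have "list_all2 (\<lambda>(p, q) r. q > 0 \<and> r = Rat.Fract p q) ?fs (rat_entries inst)"
    unfolding rat_entries_inst
    by (auto simp: list_all2_conv_all_nth entry_def dimension_10 dest!: entry_checked simp: check_entry_def)
  moreover have "enc_int (signed (neg X e) (num X 11 e)) = delim (neg X e # binary (num X 11 e))"
    "enc_int (int (num X 12 e)) = delim (False # binary (num X 12 e))" if "e < num_entries" for e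
    using entry_checked[OF that] by (auto simp: enc_int_def signed_def check_entry_def)
  then have "concat (map (\<lambda>(p, q). enc_int p @ enc_int q) ?fs) =
      concat (map (\<lambda>e. delim (neg X e # binary (num X 11 e)) @ delim (False # binary (num X 12 e))) [0..<num_entries])"
    by (intro arg_cong[of _ _ concat]) (simp add: comp_def)
  moreover have "w = code_of_cert X" using check_inst by (simp add: check_inst_def)
  moreover have "map (\<lambda>_. True) (get [] X d) = replicate (dimension X d) True" for d
    by (simp add: dimension_def map_replicate_const)
  ultimately show ?thesis
    unfolding encodes_def
    by (intro exI[of _ ?fs]) (simp add: code_of_cert_def dimension_10 enc_nat_def enc_dim_def)
qed

definition lin :: "(nat \<times> nat) list \<Rightarrow> real" where
  "lin l = sum_list (map (\<lambda>p. rc (fst p) * real (snd p)) l)"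

lemma scaled_entry:
  assumes "e < num_entries"
  shows "rc e * real (nth_val X 8) = of_int (signed (neg X e) (num X 13 e))"
proof -
  have q: "num X 12 e > 0" and eq: "num X 13 e * num X 12 e = num X 11 e * nth_val X 8"
    using entry_checked[OF assms] by (auto simp: check_entry_def)
  have "rc e * real (num X 12 e) = of_int (signed (neg X e) (num X 11 e))"
    using assms q by (simp add: entry_def dimension_10 of_rat_rat)
  then show ?thesis using q eq by (rule signed_over_common_denominator)
qed

lemma signed_sum_diff:
  assumes "\<forall>p \<in> set l. fst p < num_entries"
  shows "real (signed_sum X False l) - real (signed_sum X True l) = real (nth_val X 8) * lin l"
  using assms
proof (induction l)
  case (Cons p l)
  define t where "t = rc (fst p) * real (snd p)"
  have "real (nth_val X 8) * t = of_int (signed (neg X (fst p)) (num X 13 (fst p))) * real (snd p)"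
    unfolding t_def using scaled_entry[of "fst p"] Cons.prems by (metis list.set_intros(1) mult.assoc mult.commute)
  moreover have "lin (p # l) = t + lin l"
    by (simp add: lin_def t_def)
  moreover have "signed_sum X s (p # l) = (if neg X (fst p) = s then num X 13 (fst p) * snd p else 0) + signed_sum X s l" for s
    by (simp add: signed_sum_def)
  moreover have "real (signed_sum X False l) - real (signed_sum X True l) = real (nth_val X 8) * lin l"
    using Cons by simp
  ultimately show ?case
    by (cases "neg X (fst p)") (simp_all add: distrib_left signed_def)
qed (simp add: signed_sum_def lin_def)

lemma lin_le_iff:
  assumes "\<forall>p \<in> set l. fst p < num_entries" "\<forall>p \<in> set l'. fst p < num_entries"
  shows "lin_le X l l' \<longleftrightarrow> lin l \<le> lin l'"
proof -
  have "lin_le X l l' \<longleftrightarrow> real (signed_sum X False l + signed_sum X True l') \<le> real (signed_sum X True l + signed_sum X False l')"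
    unfolding lin_le_def of_nat_le_iff ..
  also have "\<dots> \<longleftrightarrow> real (nth_val X 8) * lin l \<le> real (nth_val X 8) * lin l'"
    unfolding signed_sum_diff[OF assms(1), symmetric] signed_sum_diff[OF assms(2), symmetric] by auto
  finally show ?thesis using den_pos by simp
qed

lemma sum_list_upt: "sum_list (map f [0..<n]) = (\<Sum>j<n. f j :: real)"
  by (simp add: interv_sum_list_conv_sum_set_nat atLeast0LessThan)

lemma check_x_iff: "check_x X \<longleftrightarrow> x_ok (\<lambda>j. real (num X 9 j) / real (nth_val X 7))"
proof -
  let ?D = "real (nth_val X 7)"
  have "num X 9 j \<le> nth_val X 6 * nth_val X 7 \<longleftrightarrow> real (num X 9 j) / ?D \<le> real (nth_val X 6)" for j
    using den_pos(1) by (simp add: pos_divide_le_eq flip: of_nat_mult)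
  moreover have "lin_le X (row_A X i) [(i, nth_val X 7)] \<longleftrightarrow>
      (\<Sum>j<dimension X (Suc 0). rc (oA + i * dimension X (Suc 0) + j) * (real (num X 9 j) / ?D)) \<le> rc i"
    if i: "i < dimension X 0" for i
  proof -
    have "oA + i * dimension X (Suc 0) + j < num_entries" if "j < dimension X (Suc 0)" for j
      using index_less[OF i that] by (simp add: offset_defs)
    moreover have "i < num_entries" using i by (simp add: offset_defs)
    ultimately have "lin_le X (row_A X i) [(i, nth_val X 7)] \<longleftrightarrow>
        (\<Sum>j<dimension X (Suc 0). rc (oA + i * dimension X (Suc 0) + j) * real (num X 9 j)) \<le> rc i * ?D"
      by (subst lin_le_iff) (auto simp: row_A_def lin_def comp_def sum_list_upt)
    also have "\<dots> \<longleftrightarrow> (\<Sum>j<dimension X (Suc 0). rc (oA + i * dimension X (Suc 0) + j) * real (num X 9 j)) / ?D \<le> rc i"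
      using den_pos(1) by (simp add: pos_divide_le_eq)
    finally show ?thesis by (simp add: sum_divide_distrib)
  qed
  ultimately show ?thesis by (auto simp: check_x_def x_ok_def list_all_iff)
qed

lemma check_u_iff: "check_u X Y \<longleftrightarrow> u_ok (nth_val Y)"
proof -
  have "lin_le X (row_B X Y i) [(dimension X 0 + i, 1)] \<longleftrightarrow>
      (\<Sum>k<dimension X 3. rc (oB + i * dimension X 3 + k) * real (nth_val Y k)) \<le> rc (dimension X 0 + i)"
    if i: "i < dimension X 2" for i
  proof -
    have "oB + i * dimension X 3 + k < num_entries" if "k < dimension X 3" for k
      using index_less[OF i that] by (simp add: offset_defs)
    moreover have "dimension X 0 + i < num_entries" using i by (simp add: offset_defs)
    ultimately show ?thesis
      by (subst lin_le_iff) (auto simp: row_B_def lin_def comp_def sum_list_upt)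
  qed
  then show ?thesis by (auto simp: check_u_def u_ok_def list_all_iff)
qed

lemma check_y_iff:
  "check_y X Y Z \<longleftrightarrow> y_ok (\<lambda>j. real (num X 9 j) / real (nth_val X 7)) (nth_val Y) (nth_val Z)"
proof -
  let ?D = "real (nth_val X 7)" and ?nx = "dimension X (Suc 0)" and ?my = "dimension X 4"
  let ?t = "\<lambda>i k j. rc (oT + k * (?my * ?nx) + i * ?nx + j)"
  have "lin_le X (concat (map (\<lambda>k. row_T X Y i k) [0..<dimension X 3]) @ row_W X Z i) [] \<longleftrightarrow>
      (\<Sum>j<?nx. (\<Sum>k<dimension X 3. real (nth_val Y k) * ?t i k j) * (real (num X 9 j) / ?D)) +
      (\<Sum>l<dimension X 5. rc (oW + i * dimension X 5 + l) * real (nth_val Z l)) \<le> 0"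
    (is "_ \<longleftrightarrow> ?S + ?W \<le> 0") if i: "i < ?my" for i
  proof -
    have bT: "oT + k * (?my * ?nx) + i * ?nx + j < num_entries" if "k < dimension X 3" "j < ?nx" for k j
      using index_less[OF that(1) index_less[OF i that(2)]] by (simp add: num_entries_def)
    have bW: "oW + i * dimension X 5 + l < num_entries" if "l < dimension X 5" for l
      using index_less[OF i that] by (simp add: offset_defs)
    have concat: "lin (concat (map h ks)) = sum_list (map (\<lambda>k. lin (h k)) ks)" for h and ks :: "nat list"
      by (induction ks) (simp_all add: lin_def)
    have "lin (concat (map (\<lambda>k. row_T X Y i k) [0..<dimension X 3])) =
        (\<Sum>k<dimension X 3. \<Sum>j<?nx. ?t i k j * (real (nth_val Y k) * real (num X 9 j)))"
      unfolding concat sum_list_upt by (simp add: lin_def row_T_def comp_def sum_list_upt)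
    also have "\<dots> = (\<Sum>j<?nx. \<Sum>k<dimension X 3. ?t i k j * (real (nth_val Y k) * real (num X 9 j)))"
      by (rule sum.swap)
    also have "\<dots> = ?D * ?S"
      using den_pos(1) by (simp add: sum_distrib_left sum_distrib_right mult_ac)
    finally have T: "lin (concat (map (\<lambda>k. row_T X Y i k) [0..<dimension X 3])) = ?D * ?S" .
    have W: "lin (row_W X Z i) = ?D * ?W"
      by (simp add: lin_def row_W_def comp_def sum_list_upt sum_distrib_left mult_ac)
    have "lin_le X (concat (map (\<lambda>k. row_T X Y i k) [0..<dimension X 3]) @ row_W X Z i) [] \<longleftrightarrow>
        lin (concat (map (\<lambda>k. row_T X Y i k) [0..<dimension X 3]) @ row_W X Z i) \<le> lin []"
      using bT bW by (intro lin_le_iff) (auto simp: row_T_def row_W_def)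
    also have "\<dots> \<longleftrightarrow> ?D * (?S + ?W) \<le> 0"
      using T W by (simp add: lin_def distrib_left)
    finally show ?thesis using den_pos(1) by (auto simp: mult_le_0_iff)
  qed
  then show ?thesis by (auto simp: check_y_def y_ok_def list_all_iff)
qed

end

lemma nth_val_map_binary: "nth_val (map (\<lambda>k. binary (u k)) [0..<n]) k = (if k < n then u k else 0)"
  by (simp add: nth_val_def get_def)

lemma length_delim: "length (delim v) = 2 * length v + 1"
  by (induction v) (auto simp: delim_def)

lemma length_tuple_code_le:
  "length ws \<le> a \<Longrightarrow> \<forall>v \<in> set ws. length v \<le> b \<Longrightarrow> length (tuple_code ws) \<le> a * (2 * b + 1)"
proof (induction ws arbitrary: a)
  case (Cons v ws)
  then obtain a' where a: "a = Suc a'" "length ws \<le> a'" by (cases a) auto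
  then show ?case using Cons.IH[OF a(2)] Cons.prems(2) by (simp add: tuple_code_def length_delim)
qed (simp add: tuple_code_def)

section \<open>Certificates of polynomial length\<close>

text \<open>All numbers in a certificate for an input of length \<open>L\<close> are below \<open>2\<close> to the power \<open>num_bound L\<close>:
  the determinant is at most \<open>n! K\<^sup>n\<close> with \<open>n \<le> L\<close> and \<open>K\<close> at most \<open>2\<close> to the power \<open>2 + 2 L + (L + L\<^sup>2)\<close>, and
  numerators of \<open>x\<close> are at most \<open>R < 2\<^sup>L\<close> times larger.\<close>

definition num_bound :: "nat \<Rightarrow> nat" where
  "num_bound L = L + (L * L + (2 + 2 * L + (L + L * L)) * L) + 1"

text \<open>A certificate has 14 words; the longest are tuples of at most \<open>L\<close> numbers
  of \<open>num_bound L\<close> bits. The second summand covers the words that are not tuples, and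
  doubling plus 1 is the cost of delimiting.\<close>

definition cert_bound :: "nat \<Rightarrow> nat" where
  "cert_bound L = 14 * (2 * (L * (2 * num_bound L + 1) + num_bound L) + 1)"

lemma poly_bounded_cert_bound: "poly_bounded cert_bound"
  unfolding cert_bound_def num_bound_def by (intro poly_bounded_intros)

lemma length_values_le_cert_bound:
  assumes "n \<le> L" "\<And>k. k < n \<Longrightarrow> u k \<le> R" "length (binary R) \<le> L"
  shows "length (tuple_code (map (\<lambda>k. binary (u k)) [0..<n])) \<le> cert_bound L"
proof -
  have "length (tuple_code (map (\<lambda>k. binary (u k)) [0..<n])) \<le> L * (2 * L + 1)"
    using assms length_binary_mono order_trans
    by (intro length_tuple_code_le) (auto, blast)
  also have "\<dots> \<le> cert_bound L"
  proof -
    have "L * (2 * L + 1) \<le> L * (2 * num_bound L + 1)"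
      by (intro mult_le_mono2) (simp add: num_bound_def)
    moreover have "a \<le> 14 * (2 * (a + b) + 1)" for a b :: nat by simp
    ultimately show ?thesis unfolding cert_bound_def by (rule order_trans)
  qed
  finally show ?thesis .
qed

lemma length_le_length_concat: "v \<in> set vs \<Longrightarrow> length v \<le> length (concat vs)"
  by (induction vs) auto

lemma encodes_length:
  assumes "encodes w I"
  shows "m_x I \<le> length w" "n_x I \<le> length w" "m_u I \<le> length w" "n_u I \<le> length w"
    "m_y I \<le> length w" "n_y I \<le> length w" "length (binary (bnd_R I)) \<le> length w"
  using assms by (auto simp: encodes_def enc_dim_def enc_nat_def length_delim)

context two_stage_data
begin

lemma x_ok_cong: "(\<And>j. j < nx \<Longrightarrow> x j = x' j) \<Longrightarrow> x_ok x \<longleftrightarrow> x_ok x'"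
  by (simp add: x_ok_def cong: sum.cong_simp)

lemma u_ok_cong: "(\<And>k. k < nu \<Longrightarrow> u k = u' k) \<Longrightarrow> u_ok u \<longleftrightarrow> u_ok u'"
  by (simp add: u_ok_def cong: sum.cong_simp)

lemma y_ok_cong:
  assumes "\<And>j. j < nx \<Longrightarrow> x j = x' j" "\<And>k. k < nu \<Longrightarrow> u k = u' k" "\<And>l. l < ny \<Longrightarrow> y l = y' l"
  shows "y_ok x u y \<longleftrightarrow> y_ok x' u' y'"
proof -
  have "(\<Sum>j<nx. (\<Sum>k<nu. real (u k) * rc (oT + k * (my * nx) + i * nx + j)) * x j) =
      (\<Sum>j<nx. (\<Sum>k<nu. real (u' k) * rc (oT + k * (my * nx) + i * nx + j)) * x' j)"
    "(\<Sum>l<ny. rc (oW + i * ny + l) * real (y l)) = (\<Sum>l<ny. rc (oW + i * ny + l) * real (y' l))" for i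
    using assms by (auto intro!: sum.cong arg_cong2[of _ _ _ _ "(*)"])
  then show ?thesis using assms(3) by (simp add: y_ok_def)
qed

end

text \<open>Short \<open>Y\<close> suffice: an admissible \<open>u\<close> has values at most
  \<open>R\<close>, whose canonical digits are no longer than the input.\<close>

lemma soundness:
  assumes "check_inst w X" "check_x X"
    and Z: "\<And>Y. length (tuple_code Y) \<le> cert_bound (length w) \<Longrightarrow> check_u X Y \<Longrightarrow> \<exists>Z. check_y X Y Z"
  shows "w \<in> Bounded_Two_Stage"
proof -
  interpret checked_cert w X by standard (rule assms(1))
  have "solvable"
    unfolding solvable_def
  proof (intro exI[of _ "\<lambda>j. real (num X 9 j) / real (nth_val X 7)"] conjI allI impI)
    show "x_ok (\<lambda>j. real (num X 9 j) / real (nth_val X 7))" using assms(2) by (simp add: check_x_iff)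
    fix u assume u: "u_ok u"
    let ?Y = "map (\<lambda>k. binary (u k)) [0..<dimension X 3]"
    have Y: "nth_val ?Y k = u k" if "k < dimension X 3" for k using that by (simp add: nth_val_map_binary)
    have "u_ok (nth_val ?Y) \<longleftrightarrow> u_ok u" by (rule u_ok_cong) (rule Y)
    then have "check_u X ?Y" using u by (simp only: check_u_iff)
    moreover have "length (tuple_code ?Y) \<le> cert_bound (length w)"
      using u encodes_length[OF encodes_inst]
      by (intro length_values_le_cert_bound[where R = "nth_val X 6"]) (auto simp: u_ok_def)
    ultimately obtain Z where "check_y X ?Y Z" using assms(3) by blast
    then have "y_ok (\<lambda>j. real (num X 9 j) / real (nth_val X 7)) (nth_val ?Y) (nth_val Z)"
      by (simp only: check_y_iff)
    moreover have "y_ok x (nth_val ?Y) y \<longleftrightarrow> y_ok x u y" for x y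
      by (rule y_ok_cong) (simp_all add: Y)
    ultimately show "\<exists>y. y_ok (\<lambda>j. real (num X 9 j) / real (nth_val X 7)) u y" by blast
  qed
  then show ?thesis
    unfolding Bounded_Two_Stage_def using wf_inst encodes_inst yes_instance_inst by blast
qed

text \<open>\<open>Y\<close> may be of any length here, because a list that passes
  \<open>check_u\<close> is read as an admissible \<open>u\<close> whatever it looks like.\<close>

lemma completeness:
  assumes "w \<in> Bounded_Two_Stage"
  obtains X where "length (tuple_code X) \<le> cert_bound (length w)" "check_inst w X" "check_x X"
    "\<And>Y. check_u X Y \<Longrightarrow> \<exists>Z. length (tuple_code Z) \<le> cert_bound (length w) \<and> check_y X Y Z"
proof -
  obtain I where I: "wf_instance I" "encodes w I" "yes_instance I"
    using assms by (auto simp: Bounded_Two_Stage_def)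
  define mx nx mu nu my ny R where dims: "mx = m_x I" "nx = n_x I" "mu = m_u I" "nu = n_u I"
    "my = m_y I" "ny = n_y I" "R = bnd_R I"
  obtain c where "I = two_stage_data.inst mx nx mu nu my ny R c"
    and c0: "\<And>e. e \<ge> two_stage_data.num_entries mx nx mu nu my ny \<Longrightarrow> c e = 0"
    using wf_instance_obtain_entries[OF I(1)] unfolding dims by blast
  interpret P: two_stage_data mx nx mu nu my ny R c .
  have inst: "I = P.inst" by fact
  let ?L = "length w" and ?E = "P.num_entries"
  have le: "mx \<le> ?L" "nx \<le> ?L" "mu \<le> ?L" "nu \<le> ?L" "my \<le> ?L" "ny \<le> ?L" "length (binary R) \<le> ?L"
    using encodes_length[OF I(2)] unfolding dims by auto
  obtain fs where fs: "list_all2 (\<lambda>(p, q) r. q > 0 \<and> r = Rat.Fract p q) fs (map c [0..<?E])"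
    and w: "w = concat (map enc_dim [mx, nx, mu, nu, my, ny]) @ enc_nat R @
      concat (map (\<lambda>(p, q). enc_int p @ enc_int q) fs)"
    using I(2) unfolding encodes_def inst P.rat_entries_inst P.inst_simps by blast
  have len: "length fs = ?E" using list_all2_lengthD[OF fs] by simp
  \<comment> \<open>Numerators and denominators are taken as they stand in the input, not in lowest
    terms, so that encoding them again reproduces \<open>w\<close>.\<close>
  define p q s where "p e = nat \<bar>fst (fs ! e)\<bar>" and "q e = nat (snd (fs ! e))" and "s e = (fst (fs ! e) < 0)" for e
  have entry: "snd (fs ! e) > 0" "c e = Rat.Fract (fst (fs ! e)) (snd (fs ! e))" if "e < ?E" for e
    using list_all2_nthD[OF fs, of e] that len by (auto simp: case_prod_beta)
  have q_pos: "q e > 0" if "e < ?E" for e using entry[OF that] by (simp add: q_def)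
  have fs_nth: "fs ! e = (signed (s e) (p e), int (q e))" if "e < ?E" for e
    using entry(1)[OF that] by (cases "fs ! e") (auto simp: signed_def s_def p_def q_def)
  have enc: "enc_int (signed (s e) (p e)) = delim (s e # binary (p e))" "enc_int (int (q e)) = delim (False # binary (q e))" for e
    by (auto simp: enc_int_def signed_def s_def p_def)
  let ?code = "\<lambda>e. delim (s e # binary (p e)) @ delim (False # binary (q e))"
  have "map (\<lambda>(p, q). enc_int p @ enc_int q) fs = map ?code [0..<?E]"
    using fs_nth len by (intro nth_equalityI) (auto simp: enc)
  with w have w: "w = concat (map enc_dim [mx, nx, mu, nu, my, ny]) @ enc_nat R @ concat (map ?code [0..<?E])" by simp
  have pq_le: "length (binary (p e)) \<le> ?L" "length (binary (q e)) \<le> ?L" if "e < ?E" for e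
  proof -
    have "length (?code e) \<le> ?L"
      using length_le_length_concat[of "?code e" "map ?code [0..<?E]"] that unfolding w by auto
    then show "length (binary (p e)) \<le> ?L" "length (binary (q e)) \<le> ?L" by (auto simp: length_delim)
  qed
  have E_le: "?E \<le> ?L"
  proof -
    have "length xs \<le> length (concat (map ?code xs))" for xs
      by (induction xs) (auto simp: length_delim)
    from this[of "[0..<?E]"] show ?thesis by (subst w) simp
  qed
  \<comment> \<open>The product serves as the common denominator: at most \<open>?L\<close> factors
    of at most \<open>?L\<close> bits each.\<close>
  define Q where "Q = (\<Prod>e<?E. q e)"
  have "Q > 0" using q_pos by (auto simp: Q_def intro: prod_pos)
  have "Q \<le> (\<Prod>e<?E. 2 ^ ?L)"
    unfolding Q_def
  proof (rule prod_mono, safe)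
    fix e assume "e < ?E"
    then have "q e < 2 ^ length (binary (q e))" "length (binary (q e)) \<le> ?L"
      using less_power_length_binary pq_le by auto
    then show "q e \<le> 2 ^ ?L" by (meson le_trans less_imp_le one_le_numeral power_increasing)
  qed
  also have "\<dots> \<le> 2 ^ (?L * ?L)"
    using E_le by (simp add: power_mult[symmetric])
  finally have Q_le: "Q \<le> 2 ^ (?L * ?L)" .
  \<comment> \<open>Beyond the last entry the value is 0, so that the bound and the scaling identity
    hold for every index, as \<open>small_solution\<close> demands.\<close>
  define P' where "P' e = (if e < ?E then p e * (Q div q e) else 0)" for e
  have P'_eq: "P' e * q e = p e * Q" if "e < ?E" for e
  proof -
    have "q e dvd Q" unfolding Q_def using that by (intro dvd_prodI) auto
    then show ?thesis using that by (simp add: P'_def)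
  qed
  have P'_le: "P' e \<le> 2 ^ (?L + ?L * ?L)" for e
  proof (cases "e < ?E")
    case True
    have "p e < 2 ^ length (binary (p e))" "length (binary (p e)) \<le> ?L"
      using less_power_length_binary pq_le True by auto
    then have "p e \<le> 2 ^ ?L" by (meson le_trans less_imp_le one_le_numeral power_increasing)
    moreover have "Q div q e \<le> 2 ^ (?L * ?L)" using Q_le by (meson div_le_dividend le_trans)
    ultimately show ?thesis using True by (simp add: P'_def power_add mult_le_mono)
  qed (simp add: P'_def)
  have scaled: "P.rc e * real Q = of_int (signed (s e) (P' e))" for e
  proof (cases "e < ?E")
    case True
    have "P.rc e * real (q e) = of_int (signed (s e) (p e))"
      using entry(2)[OF True] q_pos[OF True] by (simp add: fs_nth[OF True] of_rat_rat)
    then show ?thesis using q_pos[OF True] P'_eq[OF True] by (rule signed_over_common_denominator)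
  qed (simp add: c0 P'_def signed_def)
  have "\<bar>signed (s e) (P' e)\<bar> \<le> int (2 ^ (?L + ?L * ?L))" for e
    using P'_le[of e] by (simp add: signed_def flip: of_nat_power)
  moreover have P.solvable using I(3) P.yes_instance_inst inst by simp
  ultimately obtain D N where D: "D > 0" "D \<le> fact nx * (1 + 2 ^ (?L + ?L * ?L) + nu * (R * 2 ^ (?L + ?L * ?L))) ^ nx"
    and N: "\<And>j. j < nx \<Longrightarrow> N j \<le> R * D" and x: "P.x_ok (\<lambda>j. real (N j) / real D)"
    and y: "\<And>u. P.u_ok u \<Longrightarrow> \<exists>y. P.y_ok (\<lambda>j. real (N j) / real D) u y"
    using P.small_solution[OF \<open>Q > 0\<close> scaled] by blast
  have R_less: "R < 2 ^ ?L"
    using less_power_length_binary[of R] le(7) by (meson one_le_numeral order_less_le_trans power_increasing)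
  let ?d = "?L * ?L + (2 + 2 * ?L + (?L + ?L * ?L)) * ?L"
  have D_le: "D \<le> 2 ^ ?d"
  proof -
    let ?K = "2 ^ (?L + ?L * ?L) :: nat"
    have "nu \<le> 2 ^ ?L" using le(4) less_exp[of ?L] by linarith
    then have "nu * (R * ?K) \<le> 2 ^ ?L * (2 ^ ?L * ?K)" using R_less by (intro mult_le_mono) auto
    also have "\<dots> = 2 ^ (2 * ?L + (?L + ?L * ?L))" by (simp add: power_add mult_2)
    finally have "nu * (R * ?K) \<le> 2 ^ (2 * ?L + (?L + ?L * ?L))" .
    moreover have "?K \<le> 2 ^ (2 * ?L + (?L + ?L * ?L))" by (intro power_increasing) auto
    moreover have "(1 :: nat) \<le> 2 ^ (2 * ?L + (?L + ?L * ?L))" by simp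
    \<comment> \<open>Each of the three summands is at most the same power of 2, and
      \<open>3 \<le> 2 ^ 2\<close>; this is where the 2 in \<open>num_bound\<close> comes
      from.\<close>
    ultimately have "1 + ?K + nu * (R * ?K) \<le> 4 * 2 ^ (2 * ?L + (?L + ?L * ?L))" by linarith
    also have "\<dots> = 2 ^ (2 + 2 * ?L + (?L + ?L * ?L))" by (simp add: power_add)
    finally have "(1 + ?K + nu * (R * ?K)) ^ nx \<le> (2 ^ (2 + 2 * ?L + (?L + ?L * ?L))) ^ nx"
      by (intro power_mono) auto
    also have "\<dots> = 2 ^ ((2 + 2 * ?L + (?L + ?L * ?L)) * nx)" by (simp only: power_mult)
    also have "\<dots> \<le> 2 ^ ((2 + 2 * ?L + (?L + ?L * ?L)) * ?L)"
      using le(2) by (intro power_increasing mult_le_mono2) auto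
    finally have 1: "(1 + ?K + nu * (R * ?K)) ^ nx \<le> 2 ^ ((2 + 2 * ?L + (?L + ?L * ?L)) * ?L)" .
    have "fact nx \<le> nx ^ nx" by (rule order_trans[OF fact_le_power]) simp
    also have "\<dots> \<le> (2 ^ ?L) ^ nx" using le(2) less_exp[of ?L] by (intro power_mono) linarith+
    also have "\<dots> \<le> 2 ^ (?L * ?L)" using le(2) by (simp add: power_mult[symmetric])
    finally have "fact nx * (1 + ?K + nu * (R * ?K)) ^ nx \<le> 2 ^ (?L * ?L) * 2 ^ ((2 + 2 * ?L + (?L + ?L * ?L)) * ?L)"
      using 1 by (rule mult_le_mono)
    then show ?thesis using D(2) by (simp only: power_add)
  qed
  \<comment> \<open>\<open>length_binary_le\<close> asks for a strict bound, which the final 1 in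
    \<open>num_bound\<close> provides.\<close>
  have bits: "length (binary n) \<le> num_bound ?L" if "n \<le> 2 ^ (?L + ?d)" for n
  proof (rule length_binary_le)
    have "(2 :: nat) ^ (?L + ?d) < 2 ^ num_bound ?L"
      unfolding num_bound_def by (intro power_strict_increasing) simp_all
    then show "n < 2 ^ num_bound ?L" using that by (rule le_less_trans[rotated])
  qed
  have pow_le: "(2 :: nat) ^ a \<le> 2 ^ (?L + ?d)" if "a \<le> ?L + ?d" for a
    using that by (intro power_increasing) auto
  have D_bits: "length (binary D) \<le> num_bound ?L"
    using D_le pow_le[of ?d] by (intro bits) linarith
  have N_bits: "length (binary (N j)) \<le> num_bound ?L" if "j < nx" for j
  proof (rule bits)
    have "R * D \<le> 2 ^ ?L * 2 ^ ?d" using R_less D_le by (intro mult_le_mono) auto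
    then show "N j \<le> 2 ^ (?L + ?d)" using N[OF that] by (simp only: power_add)
  qed
  have Q_bits: "length (binary Q) \<le> num_bound ?L"
    using Q_le pow_le[of "?L * ?L"] by (intro bits) linarith
  have P'_bits: "length (binary (P' e)) \<le> num_bound ?L" for e
    using P'_le[of e] pow_le[of "?L + ?L * ?L"] by (intro bits) linarith
  have L_le: "?L \<le> num_bound ?L" by (simp add: num_bound_def)
  define X where "X = [replicate mx True, replicate nx True, replicate mu True, replicate nu True,
     replicate my True, replicate ny True, binary R, binary D, binary Q,
     tuple_code (map (\<lambda>j. binary (N j)) [0..<nx]), map s [0..<?E],
     tuple_code (map (\<lambda>e. binary (p e)) [0..<?E]), tuple_code (map (\<lambda>e. binary (q e)) [0..<?E]),
     tuple_code (map (\<lambda>e. binary (P' e)) [0..<?E])]"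
  have X_dims: "dimension X 0 = mx" "dimension X (Suc 0) = nx" "dimension X 2 = mu" "dimension X 3 = nu"
    "dimension X 4 = my" "dimension X 5 = ny" "dimension X 10 = ?E"
    by (simp_all add: X_def dimension_def get_def)
  have X_vals: "nth_val X 6 = R" "nth_val X 7 = D" "nth_val X 8 = Q"
    by (simp_all add: X_def nth_val_def get_def)
  have X_nums: "num X 9 j = (if j < nx then N j else 0)" "num X 11 e = (if e < ?E then p e else 0)"
    "num X 12 e = (if e < ?E then q e else 0)" "num X 13 e = P' e" "neg X e = (e < ?E \<and> s e)" for j e
    by (simp_all add: X_def num_def neg_def get_def nth_val_def P'_def)
  have X_get: "map (\<lambda>_. True) (get [] X d) = replicate (dimension X d) True" for d
    by (simp add: dimension_def map_replicate_const)
  have "code_of_cert X = concat (map enc_dim [mx, nx, mu, nu, my, ny]) @ enc_nat R @ concat (map ?code [0..<?E])"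
  proof -
    have "concat (map (\<lambda>e. delim (neg X e # binary (num X 11 e)) @ delim (False # binary (num X 12 e))) [0..<?E]) =
        concat (map ?code [0..<?E])"
      by (intro arg_cong[of _ _ concat] map_cong refl) (simp add: X_nums)
    then show ?thesis by (simp add: code_of_cert_def X_get X_dims X_vals enc_nat_def enc_dim_def)
  qed
  then have code: "w = code_of_cert X" using w by simp
  have "check_entry X e" if "e < ?E" for e
    using that q_pos[OF that] P'_eq[OF that] by (auto simp: check_entry_def X_nums X_vals s_def p_def)
  moreover have "dimension X 10 = off_T X + dimension X 3 * (dimension X 4 * dimension X (Suc 0))"
    by (simp add: X_dims off_T_def off_W_def off_B_def off_A_def P.offset_defs)
  ultimately have check_inst: "check_inst w X"
    using code D(1) \<open>Q > 0\<close> by (simp add: check_inst_def X_vals list_all_iff X_dims(7))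
  interpret C: checked_cert w X by standard (rule check_inst)
  \<comment> \<open>Equality of the whole sequences turns the statements about the instance read
    from \<open>X\<close> into statements about \<open>I\<close>.\<close>
  have entry_X: "entry X = c"
  proof
    fix e show "entry X e = c e"
      using entry(2)[of e] c0[of e] by (simp add: entry_def X_dims X_nums fs_nth)
  qed
  have num_9: "real (num X 9 j) / real D = real (N j) / real D" if "j < nx" for j
    using that by (simp add: X_nums)
  show thesis
  proof (rule that)
    show "check_inst w X" by (rule check_inst)
    show "check_x X"
      unfolding C.check_x_iff X_dims X_vals entry_X by (rule iffD2[OF P.x_ok_cong x]) (rule num_9)
    show "\<exists>Z. length (tuple_code Z) \<le> cert_bound ?L \<and> check_y X Y Z" if "check_u X Y" for Y
    proof -
      have "P.u_ok (nth_val Y)" using that unfolding C.check_u_iff X_dims X_vals entry_X .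
      from y[OF this] obtain y' where y': "P.y_ok (\<lambda>j. real (N j) / real D) (nth_val Y) y'" by blast
      let ?Z = "map (\<lambda>l. binary (y' l)) [0..<ny]"
      have Z: "nth_val ?Z l = y' l" if "l < ny" for l using that by (simp add: nth_val_map_binary)
      have "check_y X Y ?Z"
        unfolding C.check_y_iff X_dims X_vals entry_X
        by (rule iffD2[OF P.y_ok_cong y']) (simp_all add: num_9 Z)
      moreover have "length (tuple_code ?Z) \<le> cert_bound ?L"
        using y' le by (intro length_values_le_cert_bound[where R = R]) (auto simp: P.y_ok_def)
      ultimately show ?thesis by blast
    qed
    let ?T = "?L * (2 * num_bound ?L + 1)"
    have tuple: "length (tuple_code ws) \<le> ?T + num_bound ?L"
      if "length ws \<le> ?L" "\<forall>v \<in> set ws. length v \<le> num_bound ?L" for ws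
      using length_tuple_code_le[OF that] by simp
    have "length v \<le> ?T + num_bound ?L" if "v \<in> set X" for v
    proof -
      have "length (tuple_code (map (\<lambda>j. binary (N j)) [0..<nx])) \<le> ?T + num_bound ?L"
        using N_bits le by (intro tuple) auto
      moreover have "length (tuple_code (map (\<lambda>e. binary (p e)) [0..<?E])) \<le> ?T + num_bound ?L"
        using pq_le(1) E_le L_le order_trans by (intro tuple) (auto, blast)
      moreover have "length (tuple_code (map (\<lambda>e. binary (q e)) [0..<?E])) \<le> ?T + num_bound ?L"
        using pq_le(2) E_le L_le order_trans by (intro tuple) (auto, blast)
      moreover have "length (tuple_code (map (\<lambda>e. binary (P' e)) [0..<?E])) \<le> ?T + num_bound ?L"
        using P'_bits E_le by (intro tuple) auto
      ultimately show ?thesis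
        using that le E_le L_le D_bits Q_bits unfolding X_def
        by (auto intro: trans_le_add2)
    qed
    moreover have "length X = 14" by (simp add: X_def)
    ultimately show "length (tuple_code X) \<le> cert_bound ?L"
      unfolding cert_bound_def by (intro length_tuple_code_le) auto
  qed
qed

lemma verifier_tuple_code:
  "verifier (tuple_code [w, X, Y, Z]) = check w (undelim X) (undelim Y) (undelim Z)"
  by (simp add: verifier_def get_def)

theorem theorem13:
  shows "Bounded_Two_Stage \<in> Sigma3P"
proof -
  obtain p where p: "\<And>n. cert_bound n \<le> poly p n"
    using poly_bounded_cert_bound by (auto simp: poly_bounded_def)
  have words: "v \<in> words_upto (poly p n)" if "length v \<le> cert_bound n" for v n
    using that p[of n] by (simp add: words_upto_def)
  have "w \<in> Bounded_Two_Stage \<longleftrightarrow>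
     (\<exists>X \<in> words_upto (poly p (length w)). \<forall>Y \<in> words_upto (poly p (length w)).
      \<exists>Z \<in> words_upto (poly p (length w)). tuple_code [w, X, Y, Z] \<in> {v. verifier v})" (is "_ \<longleftrightarrow> ?R") for w
  proof
    assume "w \<in> Bounded_Two_Stage"
    then obtain X where X: "length (tuple_code X) \<le> cert_bound (length w)" "check_inst w X" "check_x X"
      "\<And>Y. check_u X Y \<Longrightarrow> \<exists>Z. length (tuple_code Z) \<le> cert_bound (length w) \<and> check_y X Y Z"
      by (rule completeness) blast
    have "\<exists>Z \<in> words_upto (poly p (length w)). verifier (tuple_code [w, tuple_code X, Y, Z])" for Y
    proof (cases "check_u X (undelim Y)")
      case True
      then obtain Z where "length (tuple_code Z) \<le> cert_bound (length w)" "check_y X (undelim Y) Z" using X(4) by blast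
      then show ?thesis using X words by (intro bexI[of _ "tuple_code Z"]) (auto simp: verifier_tuple_code check_def)
    next
      case False
      \<comment> \<open>If \<open>Y\<close> codes no admissible \<open>u\<close>, nothing is asked
        of \<open>Z\<close> and the empty word will do.\<close>
      then show ?thesis using X by (intro bexI[of _ "[]"]) (auto simp: verifier_tuple_code check_def words_upto_def)
    qed
    then show ?R using words[OF X(1)] by auto
  next
    assume ?R
    then obtain X where "\<forall>Y \<in> words_upto (poly p (length w)).
        \<exists>Z \<in> words_upto (poly p (length w)). check w (undelim X) (undelim Y) (undelim Z)"
      by (auto simp: verifier_tuple_code)
    then have X: "\<exists>Z. check w (undelim X) (undelim Y) (undelim Z)" if "Y \<in> words_upto (poly p (length w))" for Y
      using that by blast
    show "w \<in> Bounded_Two_Stage"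
    proof (rule soundness)
      show "check_inst w (undelim X)" "check_x (undelim X)"
        \<comment> \<open>The checks of the instance and of \<open>x\<close> do not depend on
          \<open>Y\<close>, so any one word, here the empty one, yields them.\<close>
        using X[of "[]"] by (auto simp: words_upto_def check_def)
      show "\<exists>Z. check_y (undelim X) Y Z"
        if "length (tuple_code Y) \<le> cert_bound (length w)" "check_u (undelim X) Y" for Y
        using X[OF words[OF that(1)]] that(2) by (auto simp: check_def)
    qed
  qed
  then show ?thesis
    unfolding Sigma3P_def using PTIME_if_polyf[OF polyf_verifier] by blast
qed

end
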